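(* Let $Q:\mathbf{T}\to\mathbb{R}$ be a $C^{3}$ potential such that $\inf_{\mathbf{T}}\frac{d\mu_Q}{d\alpha}>0$, and let $\rho>0$. Then: (1) if $Q$ satisfies $T(\rho)$, then $\mu_Q$ satisfies $P(\rho)$; (2) if $Q$ satisfies $LSI(\rho)$, then $\mu_Q$ satisfies $P(\rho)$; (3) if $Q$ satisfies $HWI(\rho)$, then $\mu_Q$ satisfies $P(\rho)$.
   Context: $\mathbf{T}$ is the unit circle in $\mathbb{C}$ and $\alpha$ is the normalized (probability) Haar measure on $\mathbf{T}$. A measure on $\mathbf{T}$ is called smooth if it has a smooth density with respect to $\alpha$. For a differentiable function $\phi$ on $\mathbf{T}$, $\phi'(z)=\frac{d}{dt}\big|_{t=0}\phi(ze^{it})$. For a continuous $Q:\mathbf{T}\to\mathbb{R}$ (a potential) and a probability measure $\mu$ on $\mathbf{T}$, $E_Q(\mu)=\int Q\,d\mu-\iint\log|x-y|\,\mu(dx)\mu(dy)$; $\mu_Q$ denotes the (unique) minimizer of $E_Q$ over probability measures on $\mathbf{T}$. For a smooth probability measure $\mu$ on $\mathbf{T}$, with density $m$ with respect to $\alpha$, define $H\mu:\mathbf{T}\to\mathbb{R}$ by the principal value integral $H\mu(e^{ix})=\mathrm{p.v.}\int\cot\big(\frac{x-y}{2}\big)\,m(e^{iy})\,\frac{dy}{2\pi}$ over an interval of length $2\pi$, and $I_Q(\mu)=\int(H\mu-Q')^{2}\,d\mu-\big(\int Q'\,d\mu\big)^{2}$ (this is non-negative). Modified Wasserstein distance: let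 $\exp(x)=e^{ix}$ for $x\in\mathbb{R}$. For a measure $\mu$ on $\mathbf{T}$ let $\bar\mu$ be the measure on $\mathbb{R}$ given by $\bar\mu(A)=\sum_{n\in\mathbb{Z}}\mu(\exp(A\cap[2n\pi,2(n+1)\pi)))$, and let $\bar\mu_u$ be the restriction of $\bar\mu$ to $[u,u+2\pi)$. For probability measures $\mu,\nu$ on $\mathbf{T}$ and $p\ge1$, $$\mathcal{W}_p(\mu,\nu)=\sup\Big\{W_p(\bar\mu_u,\bar\nu_v): u,v\in[0,2\pi],\ \int x\,\bar\mu_u(dx)=\int x\,\bar\nu_v(dx)\Big\},$$ where $W_p$ is the standard $p$-Wasserstein distance on $\mathbb{R}$ (cost $|x-y|^p$, with the power $1/p$), and the supremum over the empty set is $+\infty$. Inequalities: - $Q$ satisfies $T(\rho)$ if $\rho\,\mathcal{W}_2^{2}(\mu,\mu_Q)\le E_Q(\mu)-E_Q(\mu_Q)$ for every smooth probability measure $\mu$ on $\mathbf{T}$. - $Q$ satisfies $LSI(\rho)$ if $E_Q(\mu)-E_Q(\mu_Q)\le\frac{1}{4\rho}I_Q(\mu)$ for every smooth probability measure $\mu$ on $\mathbf{T}$. - $Q$ satisfies $HWI(\rho)$ if $E_Q(\mu)-E_Q(\mu_Q)\le\sqrt{I_Q(\mu)}\,\mathcal{W}_2(\mu,\mu_Q)-\rho\,\mathcal{W}_2^{2}(\mu,\mu_Q)$ for every smooth probability measure $\mu$ on $\mathbf{T}$. - A probability measure $\mu$ on $\mathbf{T}$ satisfies $P(\rho)$ if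 $2\rho\iint\big|\frac{f(z)-f(w)}{z-w}\big|^{2}\alpha(dz)\alpha(dw)\le\int|f'|^{2}d\mu-\big|\int f'\,d\mu\big|^{2}$ for every smooth $f:\mathbf{T}\to\mathbb{C}$. *)

theory Defs
  imports "HOL-Probability.Probability"
begin

section \<open>Functions on the unit circle\<close>

text \<open>
  A function on the circle is a function on the complex plane of which only the values on
  the unit circle are ever used.
\<close>

definition circle :: "complex set"
  where "circle = sphere 0 1"

definition circle_deriv :: "(complex \<Rightarrow> 'a::real_normed_vector) \<Rightarrow> complex \<Rightarrow> 'a"
  where "circle_deriv \<phi> z = vector_derivative (\<lambda>t. \<phi> (z * cis t)) (at 0)"

primrec circle_Ck :: "nat \<Rightarrow> (complex \<Rightarrow> 'a::real_normed_vector) \<Rightarrow> bool"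
  where
    "circle_Ck 0 \<phi> \<longleftrightarrow> continuous_on circle \<phi>"
  | "circle_Ck (Suc k) \<phi> \<longleftrightarrow>
       (\<forall>z\<in>circle. (\<lambda>t. \<phi> (z * cis t)) differentiable (at 0)) \<and> circle_Ck k (circle_deriv \<phi>)"

definition circle_smooth :: "(complex \<Rightarrow> 'a::real_normed_vector) \<Rightarrow> bool"
  where "circle_smooth \<phi> \<longleftrightarrow> (\<forall>k. circle_Ck k \<phi>)"


section \<open>Measures on the unit circle\<close>

definition circle_borel :: "complex measure"
  where "circle_borel = restrict_space borel circle"

definition haar :: "complex measure"
  where "haar = distr (uniform_measure lborel {0..<2 * pi}) circle_borel cis"

definition circle_prob :: "complex measure \<Rightarrow> bool"
  where "circle_prob \<mu> \<longleftrightarrow> prob_space \<mu> \<and> sets \<mu> = sets circle_borel"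

definition is_smooth_density :: "complex measure \<Rightarrow> (complex \<Rightarrow> real) \<Rightarrow> bool"
  where "is_smooth_density \<mu> m \<longleftrightarrow>
    circle_smooth m \<and> (\<forall>z\<in>circle. 0 \<le> m z) \<and> \<mu> = density haar (\<lambda>z. ennreal (m z))"

definition smooth_prob :: "complex measure \<Rightarrow> bool"
  where "smooth_prob \<mu> \<longleftrightarrow> circle_prob \<mu> \<and> (\<exists>m. is_smooth_density \<mu> m)"

text \<open>The choice is harmless: two continuous densities of the same measure agree on the circle.\<close>

definition smooth_density :: "complex measure \<Rightarrow> complex \<Rightarrow> real"
  where "smooth_density \<mu> = (SOME m. is_smooth_density \<mu> m)"

text \<open>
  Densities are only determined almost everywhere; the infimum of the density is positive if
  this holds for some version of it, i.e. if its essential infimum is positive.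
\<close>

definition density_inf_pos :: "complex measure \<Rightarrow> bool"
  where "density_inf_pos \<mu> \<longleftrightarrow>
    (\<exists>m \<in> borel_measurable haar. \<mu> = density haar m \<and> (0::ennreal) < (INF z\<in>circle. m z))"


section \<open>Energy and equilibrium measure\<close>

text \<open>
  The integral of an extended real function, as the difference of the integrals of its positive
  and negative parts (\<^const>\<open>e2ennreal\<close> maps negative values to 0).  It is applied only to
  the logarithmic kernel, which is bounded above by \<^term>\<open>ln 2\<close> on the circle.
\<close>

definition ereal_integral :: "'a measure \<Rightarrow> ('a \<Rightarrow> ereal) \<Rightarrow> ereal"
  where "ereal_integral M f =
    enn2ereal (\<integral>\<^sup>+ x. e2ennreal (f x) \<partial>M) - enn2ereal (\<integral>\<^sup>+ x. e2ennreal (- f x) \<partial>M)"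

text \<open>The value on the diagonal is needed because \<^term>\<open>ln (0::real) = 0\<close> in HOL.\<close>

definition log_kernel :: "complex \<Rightarrow> complex \<Rightarrow> ereal"
  where "log_kernel x y = (if x = y then - \<infinity> else ereal (ln (cmod (x - y))))"

definition energy :: "(complex \<Rightarrow> real) \<Rightarrow> complex measure \<Rightarrow> ereal"
  where "energy Q \<mu> =
    ereal (\<integral>x. Q x \<partial>\<mu>) - ereal_integral (\<mu> \<Otimes>\<^sub>M \<mu>) (\<lambda>(x, y). log_kernel x y)"

definition is_equilibrium :: "(complex \<Rightarrow> real) \<Rightarrow> complex measure \<Rightarrow> bool"
  where "is_equilibrium Q \<mu> \<longleftrightarrow>
    circle_prob \<mu> \<and> (\<forall>\<nu>. circle_prob \<nu> \<longrightarrow> energy Q \<mu> \<le> energy Q \<nu>)"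


section \<open>Hilbert transform and Fisher information\<close>

definition hilbert_transform :: "complex measure \<Rightarrow> complex \<Rightarrow> real"
  where "hilbert_transform \<mu> z =
    (let x = Arg z in
      Lim (at_right 0) (\<lambda>\<epsilon>. LBINT y:{x - pi..x - \<epsilon>} \<union> {x + \<epsilon>..x + pi}.
        cot ((x - y) / 2) * smooth_density \<mu> (cis y) / (2 * pi)))"

definition fisher_info :: "(complex \<Rightarrow> real) \<Rightarrow> complex measure \<Rightarrow> real"
  where "fisher_info Q \<mu> =
    (\<integral>z. (hilbert_transform \<mu> z - circle_deriv Q z)\<^sup>2 \<partial>\<mu>) - (\<integral>z. circle_deriv Q z \<partial>\<mu>)\<^sup>2"


section \<open>Wasserstein distances\<close>

definition couplings :: "real measure \<Rightarrow> real measure \<Rightarrow> (real \<times> real) measure set"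
  where "couplings \<mu> \<nu> =
    {\<gamma>. sets \<gamma> = sets (borel \<Otimes>\<^sub>M borel) \<and> distr \<gamma> borel fst = \<mu> \<and> distr \<gamma> borel snd = \<nu>}"

definition ennreal_powr :: "ennreal \<Rightarrow> real \<Rightarrow> ennreal"
  where "ennreal_powr c a = (if c = \<infinity> then \<infinity> else ennreal (enn2real c powr a))"

definition wasserstein :: "real \<Rightarrow> real measure \<Rightarrow> real measure \<Rightarrow> ennreal"
  where "wasserstein p \<mu> \<nu> =
    ennreal_powr (INF \<gamma>\<in>couplings \<mu> \<nu>. \<integral>\<^sup>+ (x, y). ennreal (\<bar>x - y\<bar> powr p) \<partial>\<gamma>) (1 / p)"

definition circle_lift :: "complex measure \<Rightarrow> real measure"
  where "circle_lift \<mu> = measure_of UNIV (sets borel)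
    (\<lambda>A. \<integral>\<^sup>+ n. emeasure \<mu> (cis ` (A \<inter> {2 * real_of_int n * pi..<2 * (real_of_int n + 1) * pi}))
      \<partial>count_space (UNIV :: int set))"

text \<open>The restriction to a period is kept as a measure on the whole real line.\<close>

definition circle_cut :: "complex measure \<Rightarrow> real \<Rightarrow> real measure"
  where "circle_cut \<mu> u = density (circle_lift \<mu>) (indicator {u..<u + 2 * pi})"

text \<open>In \<^typ>\<open>ennreal\<close> the supremum of the empty set is 0, hence the case distinction.\<close>

definition circle_wasserstein :: "real \<Rightarrow> complex measure \<Rightarrow> complex measure \<Rightarrow> ennreal"
  where "circle_wasserstein p \<mu> \<nu> =
    (let S = {wasserstein p (circle_cut \<mu> u) (circle_cut \<nu> v) | u v.
                u \<in> {0..2 * pi} \<and> v \<in> {0..2 * pi} \<and>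
                (\<integral>x. x \<partial>circle_cut \<mu> u) = (\<integral>x. x \<partial>circle_cut \<nu> v)}
     in if S = {} then \<infinity> else Sup S)"


section \<open>Functional inequalities\<close>

text \<open>
  In the three transport and entropy inequalities, \<open>\<mu>Q\<close> stands for the equilibrium measure
  of \<open>Q\<close>.
\<close>

definition satisfies_T :: "(complex \<Rightarrow> real) \<Rightarrow> complex measure \<Rightarrow> real \<Rightarrow> bool"
  where "satisfies_T Q \<mu>Q \<rho> \<longleftrightarrow>
    (\<forall>\<mu>. smooth_prob \<mu> \<longrightarrow>
      ereal \<rho> * (enn2ereal (circle_wasserstein 2 \<mu> \<mu>Q))\<^sup>2 \<le> energy Q \<mu> - energy Q \<mu>Q)"

definition satisfies_LSI :: "(complex \<Rightarrow> real) \<Rightarrow> complex measure \<Rightarrow> real \<Rightarrow> bool"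
  where "satisfies_LSI Q \<mu>Q \<rho> \<longleftrightarrow>
    (\<forall>\<mu>. smooth_prob \<mu> \<longrightarrow>
      energy Q \<mu> - energy Q \<mu>Q \<le> ereal (1 / (4 * \<rho>) * fisher_info Q \<mu>))"

definition satisfies_HWI :: "(complex \<Rightarrow> real) \<Rightarrow> complex measure \<Rightarrow> real \<Rightarrow> bool"
  where "satisfies_HWI Q \<mu>Q \<rho> \<longleftrightarrow>
    (\<forall>\<mu>. smooth_prob \<mu> \<longrightarrow>
      energy Q \<mu> - energy Q \<mu>Q \<le>
        ereal (sqrt (fisher_info Q \<mu>)) * enn2ereal (circle_wasserstein 2 \<mu> \<mu>Q)
          - ereal \<rho> * (enn2ereal (circle_wasserstein 2 \<mu> \<mu>Q))\<^sup>2)"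

definition satisfies_P :: "complex measure \<Rightarrow> real \<Rightarrow> bool"
  where "satisfies_P \<mu> \<rho> \<longleftrightarrow>
    (\<forall>f :: complex \<Rightarrow> complex. circle_smooth f \<longrightarrow>
      2 * \<rho> * (\<integral>w. (\<integral>z. (cmod ((f z - f w) / (z - w)))\<^sup>2 \<partial>haar) \<partial>haar)
        \<le> (\<integral>z. (cmod (circle_deriv f z))\<^sup>2 \<partial>\<mu>) - (cmod (\<integral>z. circle_deriv f z \<partial>\<mu>))\<^sup>2)"

end

theory Submission
  imports Defs "HOL-Computational_Algebra.Polynomial"
begin

text \<open>
  All three implications are linearizations at the equilibrium measure \<open>\<mu>Q\<close>. In terms of the moments
  \<open>M\<^sub>k = \<integral> z\<^sup>k d\<mu>\<close> the energy is \<open>\<integral> Q d\<mu> + \<Sum> |M\<^sub>k|\<^sup>2 / k\<close>, a quadratic functional whose criticality at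
  \<open>\<mu>Q\<close> reads \<open>M\<^sub>k = - k \<integral> Q z\<^sup>k d\<alpha>\<close>. Since \<open>\<mu>Q\<close> need not be smooth, it is replaced by its Fejer means, which stay above
  the lower bound of the density of \<open>\<mu>Q\<close>; adding \<open>\<epsilon> Re d\<close> for a polynomial \<open>d\<close> with \<open>d(0) = 0\<close> gives smooth
  probability measures whose energy gap tends to \<open>\<epsilon>\<^sup>2 \<Sum> |d\<^sub>k|\<^sup>2 / (4 k)\<close>. As the Hilbert transform maps \<open>Re d\<close> to
  \<open>Im d\<close> and \<open>\<mu>Q\<close> to \<open>Q'\<close>, the Fisher information tends to \<open>\<epsilon>\<^sup>2 Var (Im d)\<close> up to \<open>O(\<epsilon>\<^sup>3)\<close>. Taking
  \<open>d = \<Sum> k p\<^sub>k z\<^sup>k\<close>, so that \<open>Im d\<close> is minus the derivative of \<open>f = Re \<Sum> p\<^sub>k z\<^sup>k\<close>, LSI becomes P for \<open>f\<close>. For T, a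
  second-order Taylor expansion of \<open>f\<close> along a coupling of cuts with equal means bounds the increment of
  \<open>\<integral> f\<close> by \<open>\<theta>/2 Var (f') + (1/(2\<theta>) + L/2) W\<^sup>2\<close>, and the equality of means is what turns the second moment of \<open>f'\<close>
  into its variance. HWI implies LSI for the measures used.
\<close>
section \<open>Integration over the circle\<close>


text \<open>The inequalities are given for smooth measures only, whereas \<open>\<mu>Q\<close> is a
  measure with density bounded below. Two parameters therefore tend to their limits in a fixed
  order: first the smoothing index \<open>N\<close> at fixed \<open>\<epsilon>\<close>, then
  \<open>\<epsilon>\<close>. This keeps the smoothing error, for which no rate is available, from
  being divided by \<open>\<epsilon>\<^sup>2\<close>. Fejer means come from a nonnegative kernel, so
  they keep the lower bound that pays for the perturbation; they also shrink every moment, so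
  minimality squeezes their energy to that of \<open>\<mu>Q\<close>, whatever the regularity of its
  density. Criticality identifies the conjugate function of the Fejer mean of \<open>\<mu>Q\<close>
  with the Fejer mean of \<open>Q'\<close>, so the convergence of Hilbert transforms is Fejer's
  theorem for the continuous function \<open>Q'\<close>. On the side of P, real parts of polynomials
  give a coefficient inequality by the Douglas formula; it reaches smooth complex functions by
  approximating the derivative and applying Fatou's lemma.\<close>

lemma circle_iff: "z \<in> circle \<longleftrightarrow> cmod z = 1"
  by (simp add: circle_def)

lemma cis_in_circle [simp]: "cis t \<in> circle"
  by (simp add: circle_iff)

lemma mult_in_circle: "z \<in> circle \<Longrightarrow> w \<in> circle \<Longrightarrow> z * w \<in> circle"
  by (simp add: circle_iff norm_mult)

lemma cnj_in_circle [simp]: "cnj z \<in> circle \<longleftrightarrow> z \<in> circle"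
  by (simp add: circle_iff)

lemma circle_cnj_mult: "z \<in> circle \<Longrightarrow> z * cnj z = 1"
  by (simp add: circle_iff complex_norm_square [symmetric] flip: complex_norm_square)

lemma circle_eq_range_cis: "circle = range cis"
proof
  show "circle \<subseteq> range cis"
  proof
    fix z assume "z \<in> circle"
    then have "z = cis (Arg z)" using rcis_cmod_Arg[of z] by (simp add: circle_iff rcis_def)
    then show "z \<in> range cis" by blast
  qed
qed auto

lemma compact_circle: "compact circle"
  by (simp add: circle_def)

lemma space_circle_borel [simp]: "space circle_borel = circle"
  by (simp add: circle_borel_def space_restrict_space)

lemma measurable_circle_borel_id [measurable]: "(\<lambda>z. z) \<in> measurable circle_borel borel"
  unfolding circle_borel_def by (rule measurable_restrict_space1) simp

lemma measurable_into_circle_borel: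
  assumes "f \<in> borel_measurable M" "\<And>x. x \<in> space M \<Longrightarrow> f x \<in> circle"
  shows "f \<in> measurable M circle_borel"
  unfolding circle_borel_def by (rule measurable_restrict_space2) (use assms in auto)

lemma measurable_cis [measurable]: "cis \<in> measurable borel circle_borel"
  by (rule measurable_into_circle_borel) (auto intro!: borel_measurable_continuous_onI continuous_intros)

lemma measurable_cis_borel [measurable]: "cis \<in> borel_measurable borel"
  by (auto intro!: borel_measurable_continuous_onI continuous_intros)

lemma measurable_circle_continuous:
  "continuous_on circle f \<Longrightarrow> f \<in> borel_measurable circle_borel"
  unfolding circle_borel_def by (rule borel_measurable_continuous_on_restrict)

lemma sets_haar [simp, measurable_cong]: "sets haar = sets circle_borel"
  by (simp add: haar_def)

lemma space_haar [simp]: "space haar = circle"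
  by (simp add: haar_def)

lemma emeasure_lborel_period: "emeasure lborel {0..<2 * pi} = ennreal (2 * pi)"
  by simp

lemma prob_space_haar: "prob_space haar"
  unfolding haar_def
proof (rule prob_space.prob_space_distr)
  show "prob_space (uniform_measure lborel {0..<2 * pi})"
    by (rule prob_space_uniform_measure) auto
  show "cis \<in> measurable (uniform_measure lborel {0..<2 * pi}) circle_borel" by measurable
qed

lemma circle_prob_haar: "circle_prob haar"
  by (simp add: circle_prob_def prob_space_haar)

lemma circle_prob_sets: "circle_prob \<mu> \<Longrightarrow> sets \<mu> = sets circle_borel"
  by (simp add: circle_prob_def)

lemma circle_prob_space: "circle_prob \<mu> \<Longrightarrow> space \<mu> = circle"
  using sets_eq_imp_space_eq[of \<mu> circle_borel] by (simp add: circle_prob_def)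

lemma circle_prob_measurable_continuous:
  assumes "circle_prob \<mu>" "continuous_on circle f"
  shows "f \<in> borel_measurable \<mu>"
  using measurable_circle_continuous[OF assms(2)] measurable_cong_sets[OF circle_prob_sets[OF assms(1)] refl]
  by blast

lemma circle_bounded:
  fixes f :: "complex \<Rightarrow> 'a::real_normed_vector"
  assumes "continuous_on circle f"
  obtains B where "0 < B" "\<And>z. z \<in> circle \<Longrightarrow> norm (f z) \<le> B"
proof -
  have "bounded (f ` circle)"
    by (intro compact_imp_bounded compact_continuous_image assms compact_circle)
  then obtain B where "B > 0" "\<forall>x\<in>f ` circle. norm x \<le> B" unfolding bounded_pos by auto
  then show thesis using that[of B] by auto
qed

lemma circle_prob_integrable:
  fixes f :: "complex \<Rightarrow> 'a::{banach, second_countable_topology}"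
  assumes \<mu>: "circle_prob \<mu>" and f: "continuous_on circle f"
  shows "integrable \<mu> f"
proof -
  interpret prob_space \<mu> using \<mu> by (simp add: circle_prob_def)
  obtain B where "0 < B" and B: "\<And>z. z \<in> circle \<Longrightarrow> norm (f z) \<le> B" using circle_bounded[OF f] by blast
  show ?thesis
    by (rule integrable_const_bound[of _ B])
      (auto simp: circle_prob_space[OF \<mu>] B intro!: circle_prob_measurable_continuous \<mu> f)
qed

section \<open>Haar measure through the angle, and its rotation invariance\<close>

lemma integral_haar:
  fixes f :: "complex \<Rightarrow> 'a::euclidean_space"
  assumes "continuous_on circle f"
  shows "(\<integral>z. f z \<partial>haar) = (1 / (2 * pi)) *\<^sub>R integral {0..2 * pi} (\<lambda>t. f (cis t))"
    and "continuous_on UNIV (\<lambda>t. f (cis t))"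
proof -
  show c: "continuous_on UNIV (\<lambda>t. f (cis t))"
    by (rule continuous_on_compose2[OF assms]) (auto intro!: continuous_intros)
  have [measurable]: "f \<in> borel_measurable circle_borel"
    by (rule measurable_circle_continuous[OF assms])
  have e: "(\<lambda>x. indicator {0..<2 * pi} x / emeasure lborel {0..<2 * pi})
      = (\<lambda>x. ennreal (indicator {0..<2*pi} x / (2 * pi)))"
    by (auto simp: fun_eq_iff indicator_def divide_ennreal ennreal_1[symmetric] simp del: ennreal_1)
  have [measurable]: "(\<lambda>t. f (cis t)) \<in> borel_measurable borel"
    by measurable
  have "(\<integral>z. f z \<partial>haar) = (\<integral>t. f (cis t) \<partial>uniform_measure lborel {0..<2 * pi})"
    unfolding haar_def by (rule integral_distr) measurable
  also have "\<dots> = (\<integral>t. (indicator {0..<2*pi} t / (2 * pi)) *\<^sub>R f (cis t) \<partial>lborel)"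
    unfolding uniform_measure_def e by (rule integral_density) auto
  also have "\<dots> = (\<integral>t. (1 / (2 * pi)) *\<^sub>R (indicator {0..2*pi} t *\<^sub>R f (cis t)) \<partial>lborel)"
  proof (rule integral_cong_AE)
    show "AE t in lborel. (indicator {0..<2*pi} t / (2 * pi)) *\<^sub>R f (cis t)
        = (1 / (2 * pi)) *\<^sub>R (indicator {0..2*pi} t *\<^sub>R f (cis t))"
      using AE_lborel_singleton[of "2*pi"]
    proof (rule eventually_mono)
      fix t :: real assume "t \<noteq> 2 * pi"
      then have "indicat_real {0..<2*pi} t = indicator {0..2*pi} t" by (auto simp: indicator_def)
      then show "(indicator {0..<2*pi} t / (2 * pi)) *\<^sub>R f (cis t)
        = (1 / (2 * pi)) *\<^sub>R (indicator {0..2*pi} t *\<^sub>R f (cis t))" by simp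
    qed
  qed measurable
  also have "\<dots> = (1 / (2 * pi)) *\<^sub>R (LBINT t:{0..2*pi}. f (cis t))"
    unfolding integral_scaleR_right by (simp add: set_lebesgue_integral_def)
  also have "(LBINT t:{0..2*pi}. f (cis t)) = integral {0..2*pi} (\<lambda>t. f (cis t))"
    by (intro set_borel_integral_eq_integral(2))
      (auto simp: set_integrable_def intro!: borel_integrable_compact continuous_on_subset[OF c])
  finally show "(\<integral>z. f z \<partial>haar) = (1 / (2 * pi)) *\<^sub>R integral {0..2 * pi} (\<lambda>t. f (cis t))" .
qed

lemma nn_integral_haar:
  assumes [measurable]: "f \<in> borel_measurable circle_borel"
  shows "(\<integral>\<^sup>+z. f z \<partial>haar) = (\<integral>\<^sup>+t\<in>{0..<2*pi}. f (cis t) \<partial>lborel) / ennreal (2 * pi)"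
proof -
  have "(\<integral>\<^sup>+z. f z \<partial>haar) = (\<integral>\<^sup>+t. f (cis t) \<partial>uniform_measure lborel {0..<2 * pi})"
    unfolding haar_def by (rule nn_integral_distr) measurable
  also have "\<dots> = (\<integral>\<^sup>+t\<in>{0..<2*pi}. f (cis t) \<partial>lborel) / ennreal (2 * pi)"
    using emeasure_lborel_period by (subst nn_integral_uniform_measure) (auto simp del: emeasure_lborel_Ico)
  finally show ?thesis .
qed

text \<open>The period is split at \<open>s\<close>. The piece below \<open>s\<close> is moved up by
  one period, and the two translated pieces tile the period again.\<close>

lemma nn_integral_period_shift:
  fixes g :: "real \<Rightarrow> ennreal"
  assumes [measurable]: "g \<in> borel_measurable borel" and per: "\<And>t. g (t + 2 * pi) = g t"
    and s: "0 \<le> s" "s \<le> 2 * pi"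
  shows "(\<integral>\<^sup>+t\<in>{0..<2*pi}. g (s + t) \<partial>lborel) = (\<integral>\<^sup>+t\<in>{0..<2*pi}. g t \<partial>lborel)"
proof -
  have "(\<integral>\<^sup>+t\<in>{0..<2*pi}. g t \<partial>lborel)
      = (\<integral>\<^sup>+t\<in>{0..<s}. g t \<partial>lborel) + (\<integral>\<^sup>+t\<in>{s..<2*pi}. g t \<partial>lborel)"
    using s by (subst nn_integral_add[symmetric]) (auto intro!: nn_integral_cong simp: indicator_def)
  also have "(\<integral>\<^sup>+t\<in>{0..<s}. g t \<partial>lborel) = (\<integral>\<^sup>+t\<in>{2*pi-s..<2*pi}. g (s + t) \<partial>lborel)"
  proof -
    have "(\<integral>\<^sup>+t\<in>{0..<s}. g t \<partial>lborel)
        = (\<integral>\<^sup>+t. g ((s - 2 * pi) + 1 * t) * indicator {0..<s} ((s - 2 * pi) + 1 * t) \<partial>lborel)"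
      by (subst nn_integral_real_affine[where c=1 and t="s - 2 * pi"]) auto
    also have "\<dots> = (\<integral>\<^sup>+t\<in>{2*pi-s..<2*pi}. g (s + t) \<partial>lborel)"
    proof (rule nn_integral_cong)
      fix t
      have "g ((s - 2 * pi) + 1 * t) = g (s + t)"
        using per[of "s - 2 * pi + t"] by (simp add: algebra_simps)
      then show "g ((s - 2 * pi) + 1 * t) * indicator {0..<s} ((s - 2 * pi) + 1 * t) = g (s + t) * indicator {2*pi-s..<2*pi} t"
        by (auto simp: indicator_def)
    qed
    finally show ?thesis .
  qed
  also have "(\<integral>\<^sup>+t\<in>{s..<2*pi}. g t \<partial>lborel) = (\<integral>\<^sup>+t\<in>{0..<2*pi-s}. g (s + t) \<partial>lborel)"
    by (subst nn_integral_real_affine[where c=1 and t=s]) (auto intro!: nn_integral_cong simp: indicator_def)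
  also have "(\<integral>\<^sup>+t\<in>{2*pi-s..<2*pi}. g (s + t) \<partial>lborel) + (\<integral>\<^sup>+t\<in>{0..<2*pi-s}. g (s + t) \<partial>lborel)
     = (\<integral>\<^sup>+t\<in>{0..<2*pi}. g (s + t) \<partial>lborel)"
    using s by (subst nn_integral_add[symmetric]) (auto intro!: nn_integral_cong simp: indicator_def)
  finally show ?thesis by simp
qed

lemma measurable_circle_mult [measurable]:
  "w \<in> circle \<Longrightarrow> (\<lambda>z. w * z) \<in> measurable circle_borel circle_borel"
  by (rule measurable_into_circle_borel) (auto intro: mult_in_circle)

lemma nn_integral_haar_rotate:
  assumes [measurable]: "f \<in> borel_measurable circle_borel" and w: "w \<in> circle"
  shows "(\<integral>\<^sup>+z. f (w * z) \<partial>haar) = (\<integral>\<^sup>+z. f z \<partial>haar)"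
proof -
  obtain s where s: "0 \<le> s" "s \<le> 2 * pi" "w = cis s"
    using Arg2pi_ge_0[of w] Arg2pi_lt_2pi[of w] Arg2pi_eq[of w] w
    by (auto simp: circle_iff cis_conv_exp intro!: that[of "Arg2pi w"])
  have [measurable]: "(\<lambda>z. f (w * z)) \<in> borel_measurable circle_borel"
    by (rule measurable_compose[OF measurable_circle_mult[OF w]]) measurable
  have [measurable]: "(\<lambda>z. f (cis z)) \<in> borel_measurable borel" by measurable
  have "cis (t + 2 * pi) = cis t" for t
    by (simp add: cis_mult[symmetric])
  then have "(\<integral>\<^sup>+t\<in>{0..<2*pi}. f (cis (s + t)) \<partial>lborel) = (\<integral>\<^sup>+t\<in>{0..<2*pi}. f (cis t) \<partial>lborel)"
    by (intro nn_integral_period_shift[where g="\<lambda>t. f (cis t)"]) (use s in auto)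
  moreover have "(\<integral>\<^sup>+z. f (w * z) \<partial>haar) = (\<integral>\<^sup>+t\<in>{0..<2*pi}. f (cis (s + t)) \<partial>lborel) / ennreal (2 * pi)"
    by (subst nn_integral_haar) (simp_all add: s(3) cis_mult)
  ultimately show ?thesis
    by (simp only: nn_integral_haar[OF assms(1)])
qed

lemma distr_haar_rotate:
  assumes w: "w \<in> circle"
  shows "distr haar circle_borel (\<lambda>z. w * z) = haar"
proof (rule measure_eqI)
  note [measurable] = measurable_circle_mult[OF w]
  fix A assume "A \<in> sets (distr haar circle_borel (\<lambda>z. w * z))"
  then have A [measurable]: "A \<in> sets circle_borel" by simp
  have "emeasure (distr haar circle_borel (\<lambda>z. w * z)) A = (\<integral>\<^sup>+z. indicator A z \<partial>distr haar circle_borel (\<lambda>z. w * z))"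
    by simp
  also have "\<dots> = (\<integral>\<^sup>+z. indicator A (w * z) \<partial>haar)"
    by (rule nn_integral_distr) measurable
  also have "\<dots> = (\<integral>\<^sup>+z. indicator A z \<partial>haar)" by (rule nn_integral_haar_rotate[OF _ w]) measurable
  finally show "emeasure (distr haar circle_borel (\<lambda>z. w * z)) A = emeasure haar A" by simp
qed simp

lemma integral_haar_rotate:
  fixes f :: "complex \<Rightarrow> 'a::{banach, second_countable_topology}"
  assumes [measurable]: "f \<in> borel_measurable circle_borel" and w: "w \<in> circle"
  shows "(\<integral>z. f (w * z) \<partial>haar) = (\<integral>z. f z \<partial>haar)"
proof -
  note [measurable] = measurable_circle_mult[OF w]
  show ?thesis
    by (subst (2) distr_haar_rotate[OF w, symmetric], subst integral_distr) auto
qed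

section \<open>Orthogonality of powers and Parseval's identity\<close>

text \<open>Rotation by some \<open>w\<close> with \<open>w ^ k = -1\<close> turns the integral into
  its negative. The value \<open>0 ^ k\<close> includes the case \<open>k = 0\<close>.\<close>

lemma integral_haar_power: "(\<integral>z. z ^ k \<partial>haar) = (0::complex) ^ k"
proof (cases "k = 0")
  case True then show ?thesis using prob_space.prob_space[OF prob_space_haar] by simp
next
  case False
  define w where "w = cis (pi / real k)"
  have "cis (pi / real k) ^ k = cis (real k * (pi / real k))" by (rule Complex.DeMoivre)
  also have "real k * (pi / real k) = pi" using False by simp
  finally have "cis (pi / real k) ^ k = cis pi" .
  then have wk: "w ^ k = -1" unfolding w_def by (simp only: cis_pi)
  have "(\<integral>z. z ^ k \<partial>haar) = (\<integral>z. (w * z) ^ k \<partial>haar)"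
    by (rule integral_haar_rotate[symmetric])
      (auto simp: w_def intro!: measurable_circle_continuous continuous_intros)
  also have "\<dots> = - (\<integral>z. z ^ k \<partial>haar)" by (simp add: power_mult_distrib wk)
  finally show ?thesis using False by simp
qed

text \<open>A point has exactly one angle in the half-open period. Atomlessness is what makes the
  diagonal of difference quotients negligible.\<close>

lemma emeasure_haar_singleton: "emeasure haar {w} = 0"
proof (cases "w \<in> circle")
  case True
  obtain s where s: "0 \<le> s" "s < 2 * pi" "w = cis s"
    using Arg2pi_ge_0[of w] Arg2pi_lt_2pi[of w] Arg2pi_eq[of w] True
    by (auto simp: circle_iff cis_conv_exp intro!: that[of "Arg2pi w"])
  have m [measurable]: "{w} \<in> sets circle_borel"
    unfolding circle_borel_def sets_restrict_space using True by (auto intro!: image_eqI[of _ _ "{w}"])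
  have "emeasure haar {w} = (\<integral>\<^sup>+z. indicator {w} z \<partial>haar)" by simp
  also have "\<dots> = (\<integral>\<^sup>+t\<in>{0..<2*pi}. indicator {w} (cis t) \<partial>lborel) / ennreal (2 * pi)"
    by (rule nn_integral_haar) measurable
  also have "(\<integral>\<^sup>+t\<in>{0..<2*pi}. indicator {w} (cis t) \<partial>lborel) = (\<integral>\<^sup>+t. indicator {s} t \<partial>lborel)"
  proof (rule nn_integral_cong)
    fix t :: real
    have "t = s" if "cis t = cis s" "0 \<le> t" "t < 2 * pi"
      using that s Arg2pi_unique[of 1 t "cis s"] Arg2pi_unique[of 1 s "cis s"] by (simp add: cis_conv_exp)
    then show "(indicator {w} (cis t) * indicator {0..<2*pi} t :: ennreal) = indicator {s} t"
      using s by (auto simp: indicator_def)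
  qed
  finally show ?thesis by simp
next
  case False
  then have "{w} \<notin> sets haar" using sets.sets_into_space[of "{w}" haar] by auto
  then show ?thesis by (rule emeasure_notin_sets)
qed

lemma circle_AE_neq: "AE z in haar. z \<noteq> w"
proof (rule AE_I)
  show "{z \<in> space haar. \<not> z \<noteq> w} \<subseteq> circle \<inter> {w}" by auto
  show "emeasure haar (circle \<inter> {w}) = 0"
    by (cases "w \<in> circle") (simp_all add: emeasure_haar_singleton)
  show "circle \<inter> {w} \<in> sets haar"
    by (auto simp: circle_borel_def sets_restrict_space)
qed

lemma continuous_on_circle_poly [continuous_intros]: "continuous_on A (poly (p::complex poly))"
  by (rule continuous_on_poly[of A "\<lambda>x. x" p, simplified])

lemma integral_haar_power_cnj:
  "(\<integral>z. z ^ j * cnj (z ^ k) \<partial>haar) = (if j = k then 1 else 0)"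
proof -
  have *: "z ^ j * cnj (z ^ k) = z ^ (j - k)" if "z \<in> circle" "k \<le> j" for z j k
  proof -
    have "z ^ j = z ^ (j - k) * z ^ k" using that by (simp flip: power_add)
    then have "z ^ j * cnj (z ^ k) = z ^ (j - k) * (z * cnj z) ^ k"
      by (simp add: power_mult_distrib)
    then show ?thesis using circle_cnj_mult[OF that(1)] by simp
  qed
  show ?thesis
  proof (cases "k \<le> j")
    case True
    have "(\<integral>z. z ^ j * cnj (z ^ k) \<partial>haar) = (\<integral>z. z ^ (j - k) \<partial>haar)"
      by (rule Bochner_Integration.integral_cong) (use * True in auto)
    then show ?thesis using True by (auto simp: integral_haar_power)
  next
    case False
    have "(\<integral>z. z ^ j * cnj (z ^ k) \<partial>haar) = (\<integral>z. cnj (z ^ (k - j)) \<partial>haar)"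
    proof (rule Bochner_Integration.integral_cong[OF refl])
      fix z assume "z \<in> space haar"
      then have "cnj (z ^ k * cnj (z ^ j)) = cnj (z ^ (k - j))" using *[of z j k] False by simp
      then show "z ^ j * cnj (z ^ k) = cnj (z ^ (k - j))" by (simp add: mult.commute)
    qed
    also have "\<dots> = cnj (0 ^ (k - j))" by (simp add: integral_haar_power flip: complex_cnj_power)
    finally show ?thesis using False by (auto simp: )
  qed
qed

lemma integral_poly:
  assumes \<mu>: "circle_prob \<mu>" and c: "continuous_on circle g"
  shows "(\<integral>z. g z * poly p z \<partial>\<mu>) = (\<Sum>k\<le>degree p. coeff p k * (\<integral>z. g z * z ^ k \<partial>\<mu>))"
proof -
  have "(\<integral>z. g z * poly p z \<partial>\<mu>) = (\<integral>z. (\<Sum>k\<le>degree p. coeff p k * (g z * z ^ k)) \<partial>\<mu>)"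
    by (simp add: poly_altdef sum_distrib_left mult_ac)
  also have "\<dots> = (\<Sum>k\<le>degree p. coeff p k * (\<integral>z. g z * z ^ k \<partial>\<mu>))"
    by (subst Bochner_Integration.integral_sum)
      (auto intro!: circle_prob_integrable \<mu> continuous_intros c)
  finally show ?thesis .
qed

lemma integral_haar_power_poly: "(\<integral>z. z ^ k * poly p z \<partial>haar) = 0 ^ k * coeff p 0"
proof -
  have "(\<integral>z. z ^ k * poly p z \<partial>haar) = (\<Sum>j\<le>degree p. coeff p j * (\<integral>z. z ^ (k + j) \<partial>haar))"
    by (subst integral_poly) (auto intro!: circle_prob_haar continuous_intros simp: power_add)
  also have "\<dots> = (\<Sum>j\<le>degree p. if j = 0 then 0 ^ k * coeff p 0 else 0)"
    by (rule sum.cong) (auto simp: integral_haar_power)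
  finally show ?thesis by simp
qed

lemma integral_haar_poly: "(\<integral>z. poly p z \<partial>haar) = coeff p 0"
  using integral_haar_power_poly[of 0 p] by simp

lemma integral_haar_cnj_power_poly: "(\<integral>z. cnj (z ^ k) * poly p z \<partial>haar) = coeff p k"
proof -
  have "(\<integral>z. cnj (z ^ k) * poly p z \<partial>haar) = (\<Sum>j\<le>degree p. coeff p j * (\<integral>z. z ^ j * cnj (z ^ k) \<partial>haar))"
    by (subst integral_poly) (auto intro!: circle_prob_haar continuous_intros simp: mult.commute)
  also have "\<dots> = (\<Sum>j\<le>degree p. if j = k then coeff p k else 0)"
    by (rule sum.cong) (auto simp: integral_haar_power_cnj simp del: complex_cnj_power)
  also have "\<dots> = coeff p k" by (auto simp: coeff_eq_0)
  finally show ?thesis .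
qed

text \<open>With \<open>Re p = (p + cnj p) / 2\<close>, the product \<open>z ^ k * p\<close> has no
  constant term, so only the conjugate half contributes. This is the source of the factor 1/2
  between the coefficients of a density and its moments.\<close>

lemma integral_haar_power_Re_poly:
  assumes "0 < k"
  shows "(\<integral>z. z ^ k * of_real (Re (poly p z)) \<partial>haar) = cnj (coeff p k) / 2"
proof -
  have "(\<integral>z. z ^ k * of_real (Re (poly p z)) \<partial>haar)
     = (\<integral>z. (z ^ k * poly p z) / 2 + cnj (cnj (z ^ k) * poly p z) / 2 \<partial>haar)"
    by (rule Bochner_Integration.integral_cong)
      (auto simp: complex_eq_iff field_simps)
  also have "\<dots> = (\<integral>z. (z ^ k * poly p z) / 2 \<partial>haar) + (\<integral>z. cnj (cnj (z ^ k) * poly p z) / 2 \<partial>haar)"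
    by (rule Bochner_Integration.integral_add)
      (auto intro!: circle_prob_integrable circle_prob_haar continuous_intros)
  also have "(\<integral>z. (z ^ k * poly p z) / 2 \<partial>haar) = 0"
    using assms by (simp add: integral_haar_power_poly)
  also have "(\<integral>z. cnj (cnj (z ^ k) * poly p z) / 2 \<partial>haar) = cnj (coeff p k) / 2"
    unfolding integral_divide_zero Bochner_Integration.integral_cnj integral_haar_cnj_power_poly ..
  finally show ?thesis by simp
qed

lemma integral_haar_norm_poly:
  "(\<integral>z. (cmod (poly p z))\<^sup>2 \<partial>haar) = (\<Sum>k\<le>degree p. (cmod (coeff p k))\<^sup>2)"
proof -
  have "complex_of_real (\<integral>z. (cmod (poly p z))\<^sup>2 \<partial>haar) = (\<integral>z. cnj (poly p z) * poly p z \<partial>haar)"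
    unfolding integral_complex_of_real [symmetric] complex_norm_square by (simp only: mult.commute)
  also have "\<dots> = (\<Sum>k\<le>degree p. coeff p k * (\<integral>z. cnj (cnj (z ^ k) * poly p z) \<partial>haar))"
    by (subst integral_poly) (auto intro!: circle_prob_haar continuous_intros simp: mult.commute)
  also have "\<dots> = (\<Sum>k\<le>degree p. coeff p k * cnj (coeff p k))"
    by (simp only: Bochner_Integration.integral_cnj integral_haar_cnj_power_poly)
  also have "\<dots> = complex_of_real (\<Sum>k\<le>degree p. (cmod (coeff p k))\<^sup>2)"
    unfolding of_real_sum complex_norm_square ..
  finally show ?thesis using of_real_eq_iff by blast
qed

section \<open>Logarithmic energy and moments\<close>


lemma borel_measurable_cnj [measurable]: "cnj \<in> borel_measurable borel"
  by (intro borel_measurable_continuous_onI continuous_intros)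

definition moment :: "complex measure \<Rightarrow> nat \<Rightarrow> complex"
  where "moment \<mu> k = (\<integral>z. z ^ k \<partial>\<mu>)"

context
  fixes \<mu> :: "complex measure"
  assumes \<mu>: "circle_prob \<mu>"
begin

interpretation prob_space \<mu> using \<mu> by (simp add: circle_prob_def)
interpretation pair: pair_prob_space \<mu> \<mu> ..

lemma circle_pair_measurable:
  "fst \<in> borel_measurable (\<mu> \<Otimes>\<^sub>M \<mu>)" "snd \<in> borel_measurable (\<mu> \<Otimes>\<^sub>M \<mu>)"
proof -
  have "(\<lambda>z. z) \<in> borel_measurable \<mu>"
    by (rule circle_prob_measurable_continuous[OF \<mu>]) (rule continuous_on_id)
  then show "fst \<in> borel_measurable (\<mu> \<Otimes>\<^sub>M \<mu>)" "snd \<in> borel_measurable (\<mu> \<Otimes>\<^sub>M \<mu>)"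
    by measurable
qed

lemma circle_pair_space: "p \<in> space (\<mu> \<Otimes>\<^sub>M \<mu>) \<longleftrightarrow> fst p \<in> circle \<and> snd p \<in> circle"
  by (cases p) (auto simp: space_pair_measure circle_prob_space[OF \<mu>])

text \<open>On the circle \<open>|x - y| = |1 - x * cnj y|\<close>, so the logarithmic kernel is a
  series in \<open>x * cnj y\<close>. Its powers separate the variables, which produces the squared
  moments.\<close>

lemma integral_pair_power:
  "integrable (\<mu> \<Otimes>\<^sub>M \<mu>) (\<lambda>p. (fst p * cnj (snd p)) ^ k)"
  "(\<integral>p. (fst p * cnj (snd p)) ^ k \<partial>(\<mu> \<Otimes>\<^sub>M \<mu>)) = of_real ((cmod (moment \<mu> k))\<^sup>2)"
proof -
  note [measurable] = circle_pair_measurable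
  show i: "integrable (\<mu> \<Otimes>\<^sub>M \<mu>) (\<lambda>p. (fst p * cnj (snd p)) ^ k)"
    by (rule pair.P.integrable_const_bound[of _ 1])
      (auto simp: circle_pair_space circle_iff norm_power norm_mult)
  have "(\<integral>p. (fst p * cnj (snd p)) ^ k \<partial>(\<mu> \<Otimes>\<^sub>M \<mu>))
      = (\<integral>x. (\<integral>y. x ^ k * cnj (y ^ k) \<partial>\<mu>) \<partial>\<mu>)"
    by (subst pair.integral_fst'[symmetric, OF i]) (simp add: power_mult_distrib)
  also have "\<dots> = (\<integral>x. x ^ k * cnj (moment \<mu> k) \<partial>\<mu>)"
    unfolding integral_mult_right_zero Bochner_Integration.integral_cnj moment_def ..
  also have "\<dots> = moment \<mu> k * cnj (moment \<mu> k)"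
    by (simp add: moment_def)
  also have "\<dots> = of_real ((cmod (moment \<mu> k))\<^sup>2)" by (simp only: complex_norm_square)
  finally show "(\<integral>p. (fst p * cnj (snd p)) ^ k \<partial>(\<mu> \<Otimes>\<^sub>M \<mu>)) = of_real ((cmod (moment \<mu> k))\<^sup>2)" .
qed

text \<open>Real part of the series of \<open>- Ln (1 - w)\<close>; division by 0 makes the term at
  \<open>k = 0\<close> vanish.\<close>

lemma neg_ln_sums:
  assumes "cmod w < 1"
  shows "(\<lambda>k. Re (w ^ k) / real k) sums (- ln (cmod (1 - w)))"
proof -
  have "(\<lambda>n. - ((- (- w)) ^ n) / complex_of_nat n) sums Ln (1 + (- w))"
    by (rule Ln_series') (use assms in simp)
  then have "(\<lambda>n. - (- ((- (- w)) ^ n) / complex_of_nat n)) sums (- Ln (1 - w))"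
    by (intro sums_minus) simp
  then have "(\<lambda>n. w ^ n / complex_of_nat n) sums (- Ln (1 - w))" by simp
  then have "(\<lambda>n. Re (w ^ n / complex_of_nat n)) sums Re (- Ln (1 - w))" by (rule sums_Re)
  moreover have "w \<noteq> 1" using assms by auto
  ultimately show ?thesis
    by (simp add: Re_divide_of_nat)
qed

text \<open>Damping by \<open>r < 1\<close> gives the summable majorant \<open>r ^ k\<close>, which
  permits termwise integration. The summand \<open>ln 2\<close> makes the integrand nonnegative, as
  the modulus inside the logarithm is below 2.\<close>

lemma nn_integral_log_smoothed:
  assumes r: "0 \<le> r" "r < 1"
  shows "(\<integral>\<^sup>+p. ennreal (ln 2 - ln (cmod (1 - of_real r * (fst p * cnj (snd p))))) \<partial>(\<mu> \<Otimes>\<^sub>M \<mu>))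
    = ennreal (ln 2) + (\<Sum>k. ennreal (r ^ k * ((cmod (moment \<mu> k))\<^sup>2 / real k)))"
proof -
  note [measurable] = circle_pair_measurable
  define f where "f k p = r ^ k * (Re ((fst p * cnj (snd p)) ^ k) / real k)" for k and p :: "complex \<times> complex"
  have fb: "\<bar>f k p\<bar> \<le> r ^ k" if "p \<in> space (\<mu> \<Otimes>\<^sub>M \<mu>)" for k p
  proof -
    have "\<bar>Re ((fst p * cnj (snd p)) ^ k)\<bar> \<le> cmod ((fst p * cnj (snd p)) ^ k)" by (rule abs_Re_le_cmod)
    also have "\<dots> = 1" using that by (simp add: circle_pair_space circle_iff norm_power norm_mult)
    finally have "\<bar>Re ((fst p * cnj (snd p)) ^ k) / real k\<bar> \<le> 1"
      by (cases "k = 0") (auto simp: field_simps)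
    then have "r ^ k * \<bar>Re ((fst p * cnj (snd p)) ^ k) / real k\<bar> \<le> r ^ k * 1"
      using r by (intro mult_left_mono) auto
    then show ?thesis using r by (simp add: f_def abs_mult)
  qed
  have geo: "summable (\<lambda>k. r ^ k)" using r by (intro summable_geometric) auto
  have fi: "integrable (\<mu> \<Otimes>\<^sub>M \<mu>) (f k)" for k
    unfolding f_def using integral_pair_power(1)[of k]
    by (intro integrable_mult_right integrable_divide integrable_Re) auto
  have fval: "(\<integral>p. f k p \<partial>(\<mu> \<Otimes>\<^sub>M \<mu>)) = r ^ k * ((cmod (moment \<mu> k))\<^sup>2 / real k)" for k
    unfolding f_def using integral_pair_power[of k] by (simp add: integral_Re)
  have s1: "summable (\<lambda>k. norm (f k p))" if "p \<in> space (\<mu> \<Otimes>\<^sub>M \<mu>)" for p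
    by (rule summable_comparison_test'[OF geo]) (use fb[OF that] in auto)
  have s2: "summable (\<lambda>k. \<integral>p. norm (f k p) \<partial>(\<mu> \<Otimes>\<^sub>M \<mu>))"
  proof (rule summable_comparison_test'[OF geo])
    fix k
    have "(\<integral>p. norm (f k p) \<partial>(\<mu> \<Otimes>\<^sub>M \<mu>)) \<le> (\<integral>p. r ^ k \<partial>(\<mu> \<Otimes>\<^sub>M \<mu>))"
      by (rule integral_mono) (use fb fi in auto)
    then show "norm (\<integral>p. norm (f k p) \<partial>(\<mu> \<Otimes>\<^sub>M \<mu>)) \<le> r ^ k" by (simp add: pair.P.prob_space)
  qed
  have AEs: "AE p in \<mu> \<Otimes>\<^sub>M \<mu>. summable (\<lambda>k. norm (f k p))" using s1 by (intro AE_I2)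
  have sm: "(\<lambda>k. \<integral>p. f k p \<partial>(\<mu> \<Otimes>\<^sub>M \<mu>)) sums (\<integral>p. (\<Sum>k. f k p) \<partial>(\<mu> \<Otimes>\<^sub>M \<mu>))"
    by (rule sums_integral[OF fi AEs s2])
  have it: "integrable (\<mu> \<Otimes>\<^sub>M \<mu>) (\<lambda>p. \<Sum>k. f k p)"
    by (rule integrable_suminf[OF fi AEs s2])
  have lt: "cmod (of_real r * (fst p * cnj (snd p))) < 1" if "p \<in> space (\<mu> \<Otimes>\<^sub>M \<mu>)" for p
    using that r by (simp add: circle_pair_space circle_iff norm_mult)
  have fs: "(\<Sum>k. f k p) = - ln (cmod (1 - of_real r * (fst p * cnj (snd p))))"
    if "p \<in> space (\<mu> \<Otimes>\<^sub>M \<mu>)" for p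
  proof -
    have "Re ((of_real r * (fst p * cnj (snd p))) ^ k) / real k = f k p" for k
      by (simp add: f_def power_mult_distrib flip: of_real_power)
    then show ?thesis using neg_ln_sums[OF lt[OF that]] by (simp add: sums_iff)
  qed
  have nn: "0 \<le> ln 2 - ln (cmod (1 - of_real r * (fst p * cnj (snd p))))" if "p \<in> space (\<mu> \<Otimes>\<^sub>M \<mu>)" for p
  proof -
    have "0 < cmod (1 - of_real r * (fst p * cnj (snd p)))" using lt[OF that] by auto
    moreover have "cmod (1 - of_real r * (fst p * cnj (snd p))) \<le> 1 + cmod (of_real r * (fst p * cnj (snd p)))"
      using norm_triangle_ineq4[of 1 "of_real r * (fst p * cnj (snd p))"] by simp
    ultimately show ?thesis using lt[OF that] by simp
  qed
  have "(\<integral>\<^sup>+p. ennreal (ln 2 - ln (cmod (1 - of_real r * (fst p * cnj (snd p))))) \<partial>(\<mu> \<Otimes>\<^sub>M \<mu>))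
    = (\<integral>\<^sup>+p. ennreal (ln 2 + (\<Sum>k. f k p)) \<partial>(\<mu> \<Otimes>\<^sub>M \<mu>))"
    by (rule nn_integral_cong) (simp add: fs)
  also have "\<dots> = ennreal (\<integral>p. ln 2 + (\<Sum>k. f k p) \<partial>(\<mu> \<Otimes>\<^sub>M \<mu>))"
    by (rule nn_integral_eq_integral) (use it nn in \<open>auto simp: fs intro!: AE_I2\<close>)
  also have "(\<integral>p. ln 2 + (\<Sum>k. f k p) \<partial>(\<mu> \<Otimes>\<^sub>M \<mu>)) = ln 2 + (\<Sum>k. r ^ k * ((cmod (moment \<mu> k))\<^sup>2 / real k))"
    using it sm by (simp add: pair.P.prob_space fval sums_iff)
  also have "ennreal \<dots> = ennreal (ln 2) + ennreal (\<Sum>k. r ^ k * ((cmod (moment \<mu> k))\<^sup>2 / real k))"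
    using sm r by (intro ennreal_plus suminf_nonneg) (auto simp: fval sums_iff)
  also have "ennreal (\<Sum>k. r ^ k * ((cmod (moment \<mu> k))\<^sup>2 / real k))
      = (\<Sum>k. ennreal (r ^ k * ((cmod (moment \<mu> k))\<^sup>2 / real k)))"
    using sm r by (intro suminf_ennreal2[symmetric]) (auto simp: fval sums_iff)
  finally show ?thesis .
qed

text \<open>Abel summation: \<open>r\<close> tends to 1 in the damped identity. The series side
  increases with \<open>r\<close>; the integral side is the one that needs care.\<close>

lemma nn_integral_log_kernel:
  "(\<integral>\<^sup>+p. (if fst p = snd p then \<infinity> else ennreal (ln 2 - ln (cmod (fst p - snd p)))) \<partial>(\<mu> \<Otimes>\<^sub>M \<mu>))
    = ennreal (ln 2) + (\<Sum>k. ennreal ((cmod (moment \<mu> k))\<^sup>2 / real k))" (is "integral\<^sup>N _ ?L = ?R")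
proof -
  note [measurable] = circle_pair_measurable
  define r where "r n = 1 - inverse (real (Suc n))" for n
  have r0: "0 \<le> r n" "r n < 1" for n by (auto simp: r_def field_simps)
  have rlim: "r \<longlonglongrightarrow> 1"
    using tendsto_diff[OF tendsto_const[of 1] LIMSEQ_inverse_real_of_nat] by (simp add: r_def[abs_def])
  have rmono: "r n \<le> r m" if "n \<le> m" for n m using that by (simp add: r_def field_simps)
  define u where "u n p = ennreal (ln 2 - ln (cmod (1 - of_real (r n) * (fst p * cnj (snd p)))))"
    for n and p :: "complex \<times> complex"
  have [measurable]: "u n \<in> borel_measurable (\<mu> \<Otimes>\<^sub>M \<mu>)" for n unfolding u_def by measurable
  have [measurable]: "?L \<in> borel_measurable (\<mu> \<Otimes>\<^sub>M \<mu>)" by measurable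
  have int_u: "integral\<^sup>N (\<mu> \<Otimes>\<^sub>M \<mu>) (u n) = ennreal (ln 2) + (\<Sum>k. ennreal (r n ^ k * ((cmod (moment \<mu> k))\<^sup>2 / real k)))" for n
    unfolding u_def by (rule nn_integral_log_smoothed[OF r0])
  have eqd: "cmod (1 - x * cnj y) = cmod (x - y)" if "x \<in> circle" "y \<in> circle" for x y
  proof -
    have "cmod (1 - x * cnj y) = cmod (y * (1 - x * cnj y))" using that by (simp add: norm_mult circle_iff)
    also have "y * (1 - x * cnj y) = y - x * (y * cnj y)" by (simp add: algebra_simps)
    finally show ?thesis using circle_cnj_mult[OF that(2)] by (simp add: norm_minus_commute)
  qed
  have lt: "cmod (of_real (r n) * (fst p * cnj (snd p))) = r n" if "p \<in> space (\<mu> \<Otimes>\<^sub>M \<mu>)" for p n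
    using that r0[of n] by (simp add: circle_pair_space circle_iff norm_mult)
  have pos: "0 < cmod (1 - of_real (r n) * (fst p * cnj (snd p)))" if "p \<in> space (\<mu> \<Otimes>\<^sub>M \<mu>)" for p n
    using lt[OF that, of n] r0[of n] by auto
  \<comment> \<open>Since \<open>1 - r <= |1 - r w|\<close>, the triangle inequality gives
    \<open>|1 - w| <= 2 |1 - r w|\<close>: damping costs at most \<open>ln 2\<close>, uniformly in
    \<open>n\<close>.\<close>
  have ub: "u n p \<le> ?L p + ennreal (ln 2)" if p: "p \<in> space (\<mu> \<Otimes>\<^sub>M \<mu>)" for n p
  proof (cases "fst p = snd p")
    case False
    let ?w = "fst p * cnj (snd p)"
    have w1: "cmod ?w = 1" using p by (simp add: circle_pair_space circle_iff norm_mult)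
    have "cmod (1 - ?w) \<le> cmod (1 - of_real (r n) * ?w) + cmod ((of_real (r n) - 1) * ?w)"
      using norm_triangle_ineq[of "1 - of_real (r n) * ?w" "(of_real (r n) - 1) * ?w"] by (simp add: algebra_simps)
    also have "cmod ((of_real (r n) - 1) * ?w) = 1 - r n"
    proof -
      have "cmod (of_real (r n) - 1) = \<bar>r n - 1\<bar>" by (metis norm_of_real of_real_1 of_real_diff)
      then show ?thesis using w1 r0[of n] by (simp add: norm_mult)
    qed
    also have "1 - r n \<le> cmod (1 - of_real (r n) * ?w)"
      using norm_triangle_ineq2[of 1 "of_real (r n) * ?w"] lt[OF p, of n] by simp
    finally have le: "cmod (fst p - snd p) \<le> 2 * cmod (1 - of_real (r n) * ?w)"
      using eqd[of "fst p" "snd p"] p by (simp add: circle_pair_space)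
    have d: "0 < cmod (fst p - snd p)" using False by simp
    have "ln (cmod (fst p - snd p)) \<le> ln (2 * cmod (1 - of_real (r n) * ?w))"
      using le d by (intro ln_mono) auto
    also have "\<dots> = ln 2 + ln (cmod (1 - of_real (r n) * ?w))"
      using pos[OF p, of n] by (simp add: ln_mult)
    finally have "ln 2 - ln (cmod (1 - of_real (r n) * ?w)) \<le> (ln 2 - ln (cmod (fst p - snd p))) + ln 2" by simp
    moreover have "0 \<le> ln 2 - ln (cmod (fst p - snd p))"
    proof -
      have "cmod (fst p - snd p) \<le> 2"
        using norm_triangle_ineq4[of "fst p" "snd p"] p by (simp add: circle_pair_space circle_iff)
      then show ?thesis using d by simp
    qed
    ultimately show ?thesis using False
      by (simp add: u_def ennreal_plus[symmetric] ennreal_leI del: ennreal_plus)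
  qed simp
  have lim: "(\<lambda>n. u n p) \<longlonglongrightarrow> ?L p" if p: "p \<in> space (\<mu> \<Otimes>\<^sub>M \<mu>)" for p
  proof -
    have c: "(\<lambda>n. cmod (1 - of_real (r n) * (fst p * cnj (snd p)))) \<longlonglongrightarrow> cmod (1 - of_real 1 * (fst p * cnj (snd p)))"
      by (intro tendsto_intros rlim)
    show ?thesis
    proof (cases "fst p = snd p")
      case False
      have e: "cmod (1 - of_real 1 * (fst p * cnj (snd p))) = cmod (fst p - snd p)"
        using eqd[of "fst p" "snd p"] p by (simp add: circle_pair_space)
      have "(\<lambda>n. ln 2 - ln (cmod (1 - of_real (r n) * (fst p * cnj (snd p))))) \<longlonglongrightarrow> ln 2 - ln (cmod (fst p - snd p))"
        by (rule tendsto_diff[OF tendsto_const tendsto_ln[OF c[unfolded e]]]) (use False in simp)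
      then show ?thesis using False by (auto simp: u_def intro!: tendsto_ennrealI)
    next
      case True
      have w: "fst p * cnj (snd p) = 1" using True p circle_cnj_mult by (auto simp: circle_pair_space)
      have "cmod (1 - of_real (r n)) = 1 - r n" for n
      proof -
        have "cmod (1 - of_real (r n)) = \<bar>1 - r n\<bar>" by (metis norm_of_real of_real_1 of_real_diff)
        then show ?thesis using r0[of n] by simp
      qed
      then have un: "u n p = ennreal (ln 2 + ln (real (Suc n)))" for n
        by (simp add: u_def w) (simp add: r_def ln_inverse)
      have "filterlim (\<lambda>n. ln 2 + ln (real (Suc n))) at_top sequentially"
        by (intro filterlim_tendsto_add_at_top[OF tendsto_const] filterlim_compose[OF ln_at_top]
             filterlim_compose[OF filterlim_real_sequentially] filterlim_Suc)
      then have "(\<lambda>n. ennreal (ln 2 + ln (real (Suc n)))) \<longlonglongrightarrow> top"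
        by (rule ennreal_tendsto_top_eq_at_top[THEN iffD2])
      then show ?thesis using True un by simp
    qed
  qed
  have l2: "?R = (SUP n. integral\<^sup>N (\<mu> \<Otimes>\<^sub>M \<mu>) (u n))" and inc: "incseq (\<lambda>n. integral\<^sup>N (\<mu> \<Otimes>\<^sub>M \<mu>) (u n))"
  proof -
    have mono: "incseq (\<lambda>n. ennreal (r n ^ k * ((cmod (moment \<mu> k))\<^sup>2 / real k)))" for k
    proof (rule incseq_SucI)
      fix n
      have "r n ^ k \<le> r (Suc n) ^ k" by (rule power_mono[OF rmono r0(1)]) simp
      then show "ennreal (r n ^ k * ((cmod (moment \<mu> k))\<^sup>2 / real k)) \<le> ennreal (r (Suc n) ^ k * ((cmod (moment \<mu> k))\<^sup>2 / real k))"
        by (intro ennreal_leI mult_right_mono) auto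
    qed

    show "incseq (\<lambda>n. integral\<^sup>N (\<mu> \<Otimes>\<^sub>M \<mu>) (u n))"
      unfolding int_u
      by (intro incseq_SucI add_left_mono suminf_le incseq_SucD[OF mono]) auto
    have "(\<Sum>k. ennreal ((cmod (moment \<mu> k))\<^sup>2 / real k))
        = (\<Sum>k. SUP n. ennreal (r n ^ k * ((cmod (moment \<mu> k))\<^sup>2 / real k)))"
    proof (rule arg_cong[where f=suminf], rule ext)
      fix k
      have "(\<lambda>n. ennreal (r n ^ k * ((cmod (moment \<mu> k))\<^sup>2 / real k))) \<longlonglongrightarrow> ennreal (1 ^ k * ((cmod (moment \<mu> k))\<^sup>2 / real k))"
        by (intro tendsto_ennrealI tendsto_intros rlim)
      from LIMSEQ_unique[OF this LIMSEQ_SUP[OF mono]]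
      show "ennreal ((cmod (moment \<mu> k))\<^sup>2 / real k) = (SUP n. ennreal (r n ^ k * ((cmod (moment \<mu> k))\<^sup>2 / real k)))"
        by simp
    qed
    also have "\<dots> = (SUP n. \<Sum>k. ennreal (r n ^ k * ((cmod (moment \<mu> k))\<^sup>2 / real k)))"
      by (rule ennreal_suminf_SUP_eq) (rule mono)
    finally have "?R = ennreal (ln 2) + (SUP n. \<Sum>k. ennreal (r n ^ k * ((cmod (moment \<mu> k))\<^sup>2 / real k)))"
      by (rule arg_cong)
    also have "\<dots> = (SUP n. ennreal (ln 2) + (\<Sum>k. ennreal (r n ^ k * ((cmod (moment \<mu> k))\<^sup>2 / real k))))"
      by (rule ennreal_SUP_add_right) auto
    finally show "?R = (SUP n. integral\<^sup>N (\<mu> \<Otimes>\<^sub>M \<mu>) (u n))"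
      unfolding int_u .
  qed
  have "(\<lambda>n. integral\<^sup>N (\<mu> \<Otimes>\<^sub>M \<mu>) (u n)) \<longlonglongrightarrow> ?R" unfolding l2 by (rule LIMSEQ_SUP[OF inc])
  moreover have "(\<lambda>n. integral\<^sup>N (\<mu> \<Otimes>\<^sub>M \<mu>) (u n)) \<longlonglongrightarrow> integral\<^sup>N (\<mu> \<Otimes>\<^sub>M \<mu>) ?L"
  \<comment> \<open>The functions \<open>u n\<close> need not be monotone in \<open>n\<close>.
    Dominated convergence treats a finite integral; if it is infinite, Fatou's lemma forces the
    series to be infinite as well.\<close>
  proof (cases "integral\<^sup>N (\<mu> \<Otimes>\<^sub>M \<mu>) ?L = \<infinity>")
    case False
    show ?thesis
    proof (rule nn_integral_dominated_convergence[where w="\<lambda>p. ?L p + ennreal (ln 2)"])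
      show "(\<integral>\<^sup>+ p. ?L p + ennreal (ln 2) \<partial>(\<mu> \<Otimes>\<^sub>M \<mu>)) < \<infinity>"
        using False by (subst nn_integral_add) (auto simp: pair.P.emeasure_space_1 less_top ennreal_mult_less_top)
    qed (use ub lim in auto)
  next
    case True
    have "integral\<^sup>N (\<mu> \<Otimes>\<^sub>M \<mu>) ?L = (\<integral>\<^sup>+p. liminf (\<lambda>n. u n p) \<partial>(\<mu> \<Otimes>\<^sub>M \<mu>))"
      by (rule nn_integral_cong) (rule lim_imp_Liminf[OF trivial_limit_sequentially lim, symmetric])
    also have "\<dots> \<le> liminf (\<lambda>n. integral\<^sup>N (\<mu> \<Otimes>\<^sub>M \<mu>) (u n))"
      by (rule nn_integral_liminf) measurable
    also have "\<dots> = ?R"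
      unfolding l2 by (rule lim_imp_Liminf[OF trivial_limit_sequentially LIMSEQ_SUP[OF inc]])
    finally have "?R = \<infinity>" using True by (simp add: top_unique)
    then show ?thesis using LIMSEQ_SUP[OF inc] unfolding l2[symmetric] True by simp
  qed
  ultimately show ?thesis using LIMSEQ_unique by blast
qed

text \<open>The series diverges exactly when the logarithmic energy is infinite; its term at 0 is 0 because of \<^term>\<open>x / 0 = (0::real)\<close>.\<close>

lemma energy_eq:
  "energy Q \<mu> = ereal (\<integral>x. Q x \<partial>\<mu>) + enn2ereal (\<Sum>k. ennreal ((cmod (moment \<mu> k))\<^sup>2 / real k))"
proof -
  note [measurable] = circle_pair_measurable
  define S where "S = (\<Sum>k. ennreal ((cmod (moment \<mu> k))\<^sup>2 / real k))"
  define K where "K p = log_kernel (fst p) (snd p)" for p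
  define L :: "complex \<times> complex \<Rightarrow> ennreal"
    where "L p = (if fst p = snd p then \<infinity> else ennreal (ln 2 - ln (cmod (fst p - snd p))))" for p
  have [measurable]: "K \<in> borel_measurable (\<mu> \<Otimes>\<^sub>M \<mu>)" unfolding K_def log_kernel_def by measurable
  have [measurable]: "L \<in> borel_measurable (\<mu> \<Otimes>\<^sub>M \<mu>)" unfolding L_def by measurable
  define A where "A = (\<integral>\<^sup>+p. e2ennreal (K p) \<partial>(\<mu> \<Otimes>\<^sub>M \<mu>))"
  define B where "B = (\<integral>\<^sup>+p. e2ennreal (- K p) \<partial>(\<mu> \<Otimes>\<^sub>M \<mu>))"
  have dist2: "ln (cmod (fst p - snd p)) \<le> ln 2" if "fst p \<noteq> snd p" "p \<in> space (\<mu> \<Otimes>\<^sub>M \<mu>)" for p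
  proof -
    have "cmod (fst p - snd p) \<le> 2"
      using norm_triangle_ineq4[of "fst p" "snd p"] that by (simp add: circle_pair_space circle_iff)
    then show ?thesis using that by simp
  qed
  \<comment> \<open>This is \<open>L = ln 2 - K\<close> with the parts of \<open>K\<close>
    distributed so that no subtraction occurs; on the diagonal both sides are infinite.\<close>
  have pw: "e2ennreal (K p) + L p = e2ennreal (- K p) + ennreal (ln 2)" if p: "p \<in> space (\<mu> \<Otimes>\<^sub>M \<mu>)" for p
  proof (cases "fst p = snd p")
    case True
    then show ?thesis by (simp add: K_def L_def log_kernel_def e2ennreal_infty)
  next
    case False
    let ?t = "ln (cmod (fst p - snd p))"
    have "ennreal ?t + ennreal (ln 2 - ?t) = ennreal (- ?t) + ennreal (ln 2)"
      using dist2[OF False p] by (cases "0 \<le> ?t") (auto simp: ennreal_neg simp flip: ennreal_plus)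
    then show ?thesis using False by (simp add: K_def L_def log_kernel_def e2ennreal_ereal)
  qed
  have "A + integral\<^sup>N (\<mu> \<Otimes>\<^sub>M \<mu>) L = B + ennreal (ln 2)"
  proof -
    have "A + integral\<^sup>N (\<mu> \<Otimes>\<^sub>M \<mu>) L = (\<integral>\<^sup>+p. e2ennreal (K p) + L p \<partial>(\<mu> \<Otimes>\<^sub>M \<mu>))"
      unfolding A_def by (rule nn_integral_add[symmetric]) measurable
    also have "\<dots> = (\<integral>\<^sup>+p. e2ennreal (- K p) + ennreal (ln 2) \<partial>(\<mu> \<Otimes>\<^sub>M \<mu>))"
      by (rule nn_integral_cong) (rule pw)
    also have "\<dots> = B + ennreal (ln 2)"
      unfolding B_def by (subst nn_integral_add) (auto simp: pair.P.emeasure_space_1)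
    finally show ?thesis .
  qed
  then have "ennreal (ln 2) + (A + S) = ennreal (ln 2) + B"
    unfolding L_def nn_integral_log_kernel S_def by (simp add: ac_simps)
  then have AB: "A + S = B" by (simp add: ennreal_add_left_cancel)
  \<comment> \<open>Finiteness of the positive part \<open>A\<close> allows the extended difference
    \<open>A - B\<close> to be evaluated even when \<open>B\<close> is infinite.\<close>
  have "A \<le> (\<integral>\<^sup>+p. ennreal (ln 2) \<partial>(\<mu> \<Otimes>\<^sub>M \<mu>))"
    unfolding A_def
  proof (rule nn_integral_mono)
    fix p assume "p \<in> space (\<mu> \<Otimes>\<^sub>M \<mu>)"
    then show "e2ennreal (K p) \<le> ennreal (ln 2)"
      using dist2[of p] by (cases "fst p = snd p") (auto simp: K_def log_kernel_def e2ennreal_ereal e2ennreal_neg intro!: ennreal_leI)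
  qed
  then have "A < \<infinity>" by (auto simp: pair.P.emeasure_space_1 intro: le_less_trans)
  then obtain a where a: "A = ennreal a" "0 \<le> a" by (cases A) auto
  have "ereal_integral (\<mu> \<Otimes>\<^sub>M \<mu>) (\<lambda>(x, y). log_kernel x y) = enn2ereal A - enn2ereal B"
    by (simp add: ereal_integral_def A_def B_def K_def split_beta)
  also have "\<dots> = - enn2ereal S"
    unfolding AB[symmetric] a(1) using a(2)
    by (cases S) (auto simp: plus_ennreal.rep_eq enn2ereal_ennreal)
  finally show ?thesis unfolding energy_def S_def by simp
qed

end

section \<open>Cuts of measures and transport\<close>


text \<open>For \<open>z\<close> on the circle this is the unique argument in
  \<open>[u, u + 2 * pi)\<close>, the inverse of \<open>cis\<close> on the window of a cut.\<close>

definition lift_from :: "real \<Rightarrow> complex \<Rightarrow> real"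
  where "lift_from u z = u + Arg2pi (z * cis (- u))"

lemma cis_lift_from:
  assumes "z \<in> circle" shows "cis (lift_from u z) = z"
proof -
  have "z * cis (- u) = of_real (cmod (z * cis (- u))) * cis (Arg2pi (z * cis (- u)))"
    by (subst Arg2pi_eq) (simp add: cis_conv_exp)
  then have "cis (Arg2pi (z * cis (- u))) = z * cis (- u)" using assms by (simp add: circle_iff norm_mult)
  then have "cis (lift_from u z) = cis u * (z * cis (- u))" by (simp add: lift_from_def flip: cis_mult)
  also have "\<dots> = z * cis (u + - u)" unfolding cis_mult[symmetric] by (simp only: mult_ac)
  finally show ?thesis by simp
qed

lemma lift_from_range: "u \<le> lift_from u z" "lift_from u z < u + 2 * pi"
  using Arg2pi_ge_0 Arg2pi_lt_2pi by (auto simp: lift_from_def)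

lemma lift_from_cis:
  assumes "u \<le> t" "t < u + 2 * pi" shows "lift_from u (cis t) = t"
proof -
  have "Arg2pi (cis (t - u)) = t - u"
    by (rule Arg2pi_unique[of 1]) (use assms in \<open>auto simp: cis_conv_exp\<close>)
  then show ?thesis by (simp add: lift_from_def cis_mult)
qed

lemma borel_measurable_Arg2pi [measurable]: "Arg2pi \<in> borel_measurable borel"
  unfolding borel_measurable_iff_le using closed_Arg2pi2pi_le by (auto intro!: borel_closed)

lemma borel_measurable_lift_from [measurable]: "lift_from u \<in> borel_measurable circle_borel"
  unfolding lift_from_def by measurable

lemma cis_image_eq:
  "cis ` (A \<inter> {u..<u + 2 * pi}) = lift_from u -` A \<inter> circle"
proof (intro equalityI subsetI)
  fix z assume "z \<in> lift_from u -` A \<inter> circle"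
  then show "z \<in> cis ` (A \<inter> {u..<u + 2 * pi})"
    using cis_lift_from[of z u] lift_from_range[of u z] by (intro image_eqI[of _ _ "lift_from u z"]) auto
qed (auto simp: lift_from_cis)

lemma sets_circle_lift [simp, measurable_cong]: "sets (circle_lift \<mu>) = sets borel"
  unfolding circle_lift_def using sets.sigma_sets_eq[of borel] by (simp add: sets_measure_of_conv)

context
  fixes \<mu> :: "complex measure"
  assumes \<mu>: "circle_prob \<mu>"
begin

interpretation prob_space \<mu> using \<mu> by (simp add: circle_prob_def)

lemma circle_prob_measurable_lift_from [measurable]: "lift_from u \<in> borel_measurable \<mu>"
  using measurable_cong_sets[OF circle_prob_sets[OF \<mu>] refl] borel_measurable_lift_from by blast

lemma cis_image_sets:
  assumes "A \<in> sets borel" shows "cis ` (A \<inter> {u..<u + 2 * pi}) \<in> sets \<mu>"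
  unfolding cis_image_eq circle_prob_space[OF \<mu>, symmetric]
  using assms by measurable

lemma emeasure_cis_image:
  assumes "A \<in> sets borel"
  shows "emeasure \<mu> (cis ` (A \<inter> {u..<u + 2 * pi})) = emeasure (distr \<mu> borel (lift_from u)) A"
  using assms by (subst emeasure_distr) (auto simp: cis_image_eq circle_prob_space[OF \<mu>])

text \<open>A set function that is not a measure would make \<open>measure_of\<close> collapse to
  the zero measure. Additivity holds because each summand is the push-forward of
  \<open>\<mu>\<close> under the lift to one window.\<close>

lemma emeasure_circle_lift:
  assumes "A \<in> sets borel"
  shows "emeasure (circle_lift \<mu>) A
    = (\<integral>\<^sup>+ n. emeasure \<mu> (cis ` (A \<inter> {2 * real_of_int n * pi..<2 * real_of_int n * pi + 2 * pi})) \<partial>count_space UNIV)"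
proof -
  have int_eq: "2 * (real_of_int n + 1) * pi = 2 * real_of_int n * pi + 2 * pi" for n
    by (simp add: algebra_simps)
  let ?D = "\<lambda>n. distr \<mu> borel (lift_from (2 * real_of_int n * pi))"
  let ?f = "\<lambda>A. \<integral>\<^sup>+ n. emeasure \<mu> (cis ` (A \<inter> {2 * real_of_int n * pi..<2 * real_of_int n * pi + 2 * pi}))
    \<partial>count_space (UNIV :: int set)"
  have f: "?f A = (\<integral>\<^sup>+ n. emeasure (?D n) A \<partial>count_space UNIV)" if "A \<in> sets borel" for A
    by (simp add: emeasure_cis_image[OF that])
  show ?thesis
  proof (rule emeasure_measure_of[where \<Omega>=UNIV and A="sets borel"])
    show "circle_lift \<mu> = measure_of UNIV (sets borel) ?f"
      unfolding circle_lift_def int_eq ..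
    show "positive (sets (circle_lift \<mu>)) ?f" by (simp add: positive_def)
    show "countably_additive (sets (circle_lift \<mu>)) ?f"
    proof (rule countably_additiveI)
      fix A :: "nat \<Rightarrow> real set"
      assume A: "range A \<subseteq> sets (circle_lift \<mu>)" "disjoint_family A"
      then have Ai: "A i \<in> sets borel" for i by auto
      have "(\<Sum>i. ?f (A i)) = (\<Sum>i. \<integral>\<^sup>+ n. emeasure (?D n) (A i) \<partial>count_space UNIV)"
        by (simp only: f[OF Ai])
      also have "\<dots> = (\<integral>\<^sup>+ n. (\<Sum>i. emeasure (?D n) (A i)) \<partial>count_space UNIV)"
        by (rule nn_integral_suminf[symmetric]) auto
      also have "\<dots> = (\<integral>\<^sup>+ n. emeasure (?D n) (\<Union>i. A i) \<partial>count_space UNIV)"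
        using A Ai by (intro nn_integral_cong suminf_emeasure) auto
      also have "\<dots> = ?f (\<Union>i. A i)" using Ai by (subst f) auto
      finally show "(\<Sum>i. ?f (A i)) = ?f (\<Union>i. A i)" .
    qed
  qed (use assms in auto)
qed

text \<open>A cut generally straddles two of the windows that define \<open>circle_lift\<close>. The
  images of its pieces on the circle are disjoint and fill it, so a single lift starting at
  \<open>u\<close> describes the cut; integrals over cuts thereby become integrals over
  \<open>\<mu>\<close>.\<close>

lemma circle_cut_eq_distr: "circle_cut \<mu> u = distr \<mu> borel (lift_from u)"
proof (rule measure_eqI)
  fix A assume "A \<in> sets (circle_cut \<mu> u)"
  then have A [measurable]: "A \<in> sets borel" by (simp add: circle_cut_def)
  let ?B = "A \<inter> {u..<u + 2 * pi}"
  let ?I = "\<lambda>n. {2 * real_of_int n * pi..<2 * real_of_int n * pi + 2 * pi}"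
  have "emeasure (circle_cut \<mu> u) A = (\<integral>\<^sup>+x. indicator ?B x \<partial>circle_lift \<mu>)"
    unfolding circle_cut_def
    by (subst emeasure_density)
      (auto intro!: nn_integral_cong simp: indicator_inter_arith mult.commute simp del: nn_integral_indicator)
  also have "\<dots> = emeasure (circle_lift \<mu>) ?B" by (rule nn_integral_indicator) simp
  also have "\<dots> = (\<integral>\<^sup>+ n. emeasure \<mu> (cis ` (?B \<inter> ?I n)) \<partial>count_space UNIV)"
    by (rule emeasure_circle_lift) simp
  also have "\<dots> = emeasure \<mu> (\<Union>n. cis ` (?B \<inter> ?I n))"
  proof (rule emeasure_UN_countable[symmetric])
    show "cis ` (?B \<inter> ?I n) \<in> sets \<mu>" for n by (rule cis_image_sets) simp
    show "disjoint_family (\<lambda>n. cis ` (?B \<inter> ?I n))"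
      unfolding disjoint_family_on_def
    proof (intro ballI impI)
      fix m n :: int assume "m \<noteq> n"
      \<comment> \<open>\<open>cis\<close> is injective on the half-open period \<open>?B\<close>,
        so a common image means the same real number, which lies in one window only.\<close>
      have False if s: "s \<in> ?B" "s \<in> ?I m" and t: "t \<in> ?B" "t \<in> ?I n" and e: "cis s = cis t" for s t
      proof -
        have "lift_from u (cis s) = s" "lift_from u (cis t) = t"
          by (rule lift_from_cis; use s t in simp)+
        then have "s = t" using e by metis
        then have "2 * real_of_int m * pi < 2 * real_of_int n * pi + 2 * pi"
            "2 * real_of_int n * pi < 2 * real_of_int m * pi + 2 * pi"
          using s(2) t(2) unfolding atLeastLessThan_iff by linarith+
        then have "real_of_int m * (2 * pi) < (real_of_int n + 1) * (2 * pi)"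
            "real_of_int n * (2 * pi) < (real_of_int m + 1) * (2 * pi)"
          unfolding distrib_right by (simp_all only: mult_ac mult_1_left)
        then have "real_of_int m < real_of_int n + 1" "real_of_int n < real_of_int m + 1"
          by (metis mult_less_cancel_right_pos pi_gt_zero mult_pos_pos zero_less_numeral)+
        then show False using \<open>m \<noteq> n\<close> by linarith
      qed
      then show "cis ` (?B \<inter> ?I m) \<inter> cis ` (?B \<inter> ?I n) = {}" by blast
    qed
  qed auto
  also have "(\<Union>n. cis ` (?B \<inter> ?I n)) = cis ` ?B"
  proof -
    have "\<exists>n. t \<in> ?I n" for t :: real
    proof -
      have "real_of_int \<lfloor>t / (2 * pi)\<rfloor> \<le> t / (2 * pi)" "t / (2 * pi) < real_of_int \<lfloor>t / (2 * pi)\<rfloor> + 1" by linarith+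
      then have "real_of_int \<lfloor>t / (2 * pi)\<rfloor> * (2 * pi) \<le> t" "t < (real_of_int \<lfloor>t / (2 * pi)\<rfloor> + 1) * (2 * pi)"
        by (simp_all only: pos_le_divide_eq pos_divide_less_eq mult_pos_pos pi_gt_zero zero_less_numeral)
      then have "t \<in> ?I \<lfloor>t / (2 * pi)\<rfloor>"
        unfolding atLeastLessThan_iff distrib_right by (simp only: mult_ac mult_1_left simp_thms)
      then show ?thesis ..
    qed
    then show ?thesis by blast
  qed
  also have "emeasure \<mu> (cis ` ?B) = emeasure (distr \<mu> borel (lift_from u)) A"
    by (rule emeasure_cis_image) simp
  finally show "emeasure (circle_cut \<mu> u) A = emeasure (distr \<mu> borel (lift_from u)) A" .
qed (simp add: circle_cut_def)

lemma integrable_lift_from: "integrable \<mu> (lift_from u)"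
proof (rule integrable_const_bound[of _ "\<bar>u\<bar> + 2 * pi"], rule AE_I2)
  fix z show "norm (lift_from u z) \<le> \<bar>u\<bar> + 2 * pi"
    using lift_from_range[of u z] pi_gt_zero by (auto simp: abs_if)
qed measurable

lemma mean_circle_cut: "(\<integral>x. x \<partial>circle_cut \<mu> u) = (\<integral>z. lift_from u z \<partial>\<mu>)"
  unfolding circle_cut_eq_distr by (rule integral_distr) auto

text \<open>Moving the cut past a point changes its lift by a whole period, so the lift is
  discontinuous in \<open>u\<close> only for \<open>z = cis u\<close>, a null set. Dominated
  convergence then applies.\<close>

lemma continuous_mean_circle_cut:
  assumes na: "\<And>z. emeasure \<mu> {z} = 0"
  shows "continuous_on A (\<lambda>u. \<integral>z. lift_from u z \<partial>\<mu>)"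
proof (rule continuous_at_imp_continuous_on, rule ballI)
  fix u :: real
  show "isCont (\<lambda>u. \<integral>z. lift_from u z \<partial>\<mu>) u"
    unfolding continuous_at_sequentially o_def
  proof (intro allI impI)
    fix s :: "nat \<Rightarrow> real" assume s: "s \<longlonglongrightarrow> u"
    then have "Bseq s" by (intro convergent_imp_Bseq convergentI)
    then obtain K where K: "\<And>n. \<bar>s n\<bar> \<le> K" by (auto simp: Bseq_def)
    show "(\<lambda>n. \<integral>z. lift_from (s n) z \<partial>\<mu>) \<longlonglongrightarrow> (\<integral>z. lift_from u z \<partial>\<mu>)"
    proof (rule integral_dominated_convergence[where w="\<lambda>_. K + 2 * pi"])
      show "AE z in \<mu>. norm (lift_from (s n) z) \<le> K + 2 * pi" for n
      proof (rule AE_I2)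
        fix z show "norm (lift_from (s n) z) \<le> K + 2 * pi"
          using lift_from_range[of "s n" z] K[of n] pi_gt_zero by (simp add: abs_le_iff)
      qed
      have "AE z in \<mu>. z \<noteq> cis u"
      proof (rule AE_I)
        show "emeasure \<mu> {cis u} = 0" by (rule na)
        have "cis ` ({u} \<inter> {u..<u + 2 * pi}) \<in> sets \<mu>" by (rule cis_image_sets) simp
        then show "{cis u} \<in> sets \<mu>" by simp
      qed auto
      then show "AE z in \<mu>. (\<lambda>n. lift_from (s n) z) \<longlonglongrightarrow> lift_from u z"
      proof (rule AE_mp, intro AE_I2 impI)
        fix z assume z: "z \<in> space \<mu>" "z \<noteq> cis u"
        have nz: "z * cis (- u) \<notin> \<real>\<^sub>\<ge>\<^sub>0"
        proof
          assume "z * cis (- u) \<in> \<real>\<^sub>\<ge>\<^sub>0"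
          then obtain r where r: "z * cis (- u) = of_real r" "0 \<le> r" by (auto elim!: nonneg_Reals_cases)
          have "cmod (z * cis (- u)) = 1" using z by (simp add: circle_prob_space[OF \<mu>] circle_iff norm_mult)
          then have "z * cis (- u) = 1" using r by simp
          then have "z * (cis (- u) * cis u) = cis u" by (simp add: mult.assoc[symmetric])
          then show False using z by (simp add: cis_mult)
        qed
        have "(\<lambda>n. z * cis (- s n)) \<longlonglongrightarrow> z * cis (- u)"
          by (intro tendsto_intros s)
        then show "(\<lambda>n. lift_from (s n) z) \<longlonglongrightarrow> lift_from u z"
          unfolding lift_from_def
          by (intro tendsto_add s isCont_tendsto_compose[OF continuous_at_Arg2pi[OF nz]])
      qed
    qed auto
  qed
qed

end

section \<open>Admissible pairs of cuts and finiteness of the distance\<close>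

text \<open>The cut at \<open>2 * pi\<close> has mean at least \<open>2 * pi\<close>, which bounds
  the mean of any cut at 0. The intermediate value theorem finds the matching cut in
  between.\<close>

lemma circle_cut_means_meet:
  assumes \<mu>: "circle_prob \<mu>" "\<And>z. emeasure \<mu> {z} = 0" and \<nu>: "circle_prob \<nu>"
    and le: "(\<integral>z. lift_from 0 z \<partial>\<mu>) \<le> (\<integral>z. lift_from 0 z \<partial>\<nu>)"
  shows "\<exists>u\<in>{0..2 * pi}. (\<integral>z. lift_from u z \<partial>\<mu>) = (\<integral>z. lift_from 0 z \<partial>\<nu>)"
proof -
  interpret \<mu>: prob_space \<mu> using \<mu> by (simp add: circle_prob_def)
  interpret \<nu>: prob_space \<nu> using \<nu> by (simp add: circle_prob_def)
  have "(\<integral>z. lift_from 0 z \<partial>\<nu>) \<le> (\<integral>z. 2 * pi \<partial>\<nu>)"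
    by (rule integral_mono) (use lift_from_range[of 0] integrable_lift_from[OF \<nu>] in \<open>auto intro: less_imp_le\<close>)
  also have "\<dots> = (\<integral>z. 2 * pi \<partial>\<mu>)" by (simp add: \<mu>.prob_space \<nu>.prob_space)
  also have "\<dots> \<le> (\<integral>z. lift_from (2 * pi) z \<partial>\<mu>)"
    by (rule integral_mono) (use lift_from_range[of "2 * pi"] integrable_lift_from[OF \<mu>(1)] in auto)
  finally have "(\<integral>z. lift_from 0 z \<partial>\<nu>) \<le> (\<integral>z. lift_from (2 * pi) z \<partial>\<mu>)" .
  then show ?thesis
    using IVT'[of "\<lambda>u. \<integral>z. lift_from u z \<partial>\<mu>" 0 "\<integral>z. lift_from 0 z \<partial>\<nu>" "2 * pi"] le
      continuous_mean_circle_cut[OF \<mu>] by (auto simp: Bex_def)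
qed

text \<open>The product measure is a coupling, and both cuts live in \<open>[0, 4 * pi)\<close>. The
  bound is crude; its purpose is only finiteness.\<close>

lemma wasserstein_circle_cut_le:
  assumes \<mu>: "circle_prob \<mu>" and \<nu>: "circle_prob \<nu>" and u: "u \<in> {0..2 * pi}" and v: "v \<in> {0..2 * pi}"
  shows "wasserstein 2 (circle_cut \<mu> u) (circle_cut \<nu> v) \<le> ennreal (((4 * pi) powr 2) powr (1 / 2))"
proof -
  interpret \<mu>: prob_space \<mu> using \<mu> by (simp add: circle_prob_def)
  interpret \<nu>: prob_space \<nu> using \<nu> by (simp add: circle_prob_def)
  note [measurable] = circle_prob_measurable_lift_from[OF \<mu>] circle_prob_measurable_lift_from[OF \<nu>]
  define a where "a = distr \<mu> borel (lift_from u)"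
  define b where "b = distr \<nu> borel (lift_from v)"
  interpret a: prob_space a unfolding a_def by (rule \<mu>.prob_space_distr) measurable
  interpret b: prob_space b unfolding b_def by (rule \<nu>.prob_space_distr) measurable
  interpret ab: pair_prob_space a b ..
  have sa [simp, measurable_cong]: "sets a = sets borel" "sets b = sets borel" by (simp_all add: a_def b_def)
  have sp [simp]: "space a = UNIV" "space b = UNIV" by (simp_all add: a_def b_def)
  have sab: "sets (a \<Otimes>\<^sub>M b) = sets (borel \<Otimes>\<^sub>M borel)" by (rule sets_pair_measure_cong) auto
  have AEa: "AE x in a. x \<in> {u..<u + 2 * pi}" and AEb: "AE x in b. x \<in> {v..<v + 2 * pi}"
    unfolding a_def b_def using lift_from_range by (auto simp: AE_distr_iff)
  have 1: "a \<Otimes>\<^sub>M b \<in> couplings a b"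
    unfolding couplings_def
  proof (intro CollectI conjI sab)
    show "distr (a \<Otimes>\<^sub>M b) borel fst = a"
    proof (rule measure_eqI)
      fix A assume "A \<in> sets (distr (a \<Otimes>\<^sub>M b) borel fst)"
      then have A: "A \<in> sets borel" by simp
      have "emeasure (distr (a \<Otimes>\<^sub>M b) borel fst) A = emeasure (a \<Otimes>\<^sub>M b) (A \<times> UNIV)"
        using A by (subst emeasure_distr) (auto simp: space_pair_measure intro!: arg_cong[where f="emeasure (a \<Otimes>\<^sub>M b)"])
      also have "\<dots> = emeasure a A * emeasure b UNIV"
        using A by (intro b.emeasure_pair_measure_Times) auto
      finally show "emeasure (distr (a \<Otimes>\<^sub>M b) borel fst) A = emeasure a A"
        using b.emeasure_space_1 by simp
    qed simp
    show "distr (a \<Otimes>\<^sub>M b) borel snd = b"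
    proof (rule measure_eqI)
      fix A assume "A \<in> sets (distr (a \<Otimes>\<^sub>M b) borel snd)"
      then have A: "A \<in> sets borel" by simp
      have "emeasure (distr (a \<Otimes>\<^sub>M b) borel snd) A = emeasure (a \<Otimes>\<^sub>M b) (UNIV \<times> A)"
        using A by (subst emeasure_distr) (auto simp: space_pair_measure intro!: arg_cong[where f="emeasure (a \<Otimes>\<^sub>M b)"])
      also have "\<dots> = emeasure a UNIV * emeasure b A"
        using A by (intro b.emeasure_pair_measure_Times) auto
      finally show "emeasure (distr (a \<Otimes>\<^sub>M b) borel snd) A = emeasure b A"
        using a.emeasure_space_1 by simp
    qed simp
  qed
  have "(\<integral>\<^sup>+ (x, y). ennreal (\<bar>x - y\<bar> powr 2) \<partial>(a \<Otimes>\<^sub>M b)) = (\<integral>\<^sup>+ x. \<integral>\<^sup>+ y. ennreal (\<bar>x - y\<bar> powr 2) \<partial>b \<partial>a)"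
    by (subst b.nn_integral_fst[symmetric]) (auto simp: split_beta)
  also have "\<dots> \<le> (\<integral>\<^sup>+ x. \<integral>\<^sup>+ y. ennreal ((4 * pi) powr 2) \<partial>b \<partial>a)"
  proof (rule nn_integral_mono_AE, rule AE_mp[OF AEa], intro AE_I2 impI)
    fix x assume x: "x \<in> {u..<u + 2 * pi}"
    show "(\<integral>\<^sup>+ y. ennreal (\<bar>x - y\<bar> powr 2) \<partial>b) \<le> (\<integral>\<^sup>+ y. ennreal ((4 * pi) powr 2) \<partial>b)"
    proof (rule nn_integral_mono_AE, rule AE_mp[OF AEb], intro AE_I2 impI)
      fix y assume y: "y \<in> {v..<v + 2 * pi}"
      have "\<bar>x - y\<bar> \<le> 4 * pi" using x y u v by (auto simp: abs_le_iff)
      then show "ennreal (\<bar>x - y\<bar> powr 2) \<le> ennreal ((4 * pi) powr 2)"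
        by (intro ennreal_leI powr_mono2) auto
    qed
  qed
  also have "\<dots> = ennreal ((4 * pi) powr 2)"
    using a.emeasure_space_1 b.emeasure_space_1 by simp
  finally have "(INF \<gamma>\<in>couplings a b. \<integral>\<^sup>+ (x, y). ennreal (\<bar>x - y\<bar> powr 2) \<partial>\<gamma>) \<le> ennreal ((4 * pi) powr 2)"
    by (rule INF_lower2[OF 1])
  then obtain c where c: "(INF \<gamma>\<in>couplings a b. \<integral>\<^sup>+ (x, y). ennreal (\<bar>x - y\<bar> powr 2) \<partial>\<gamma>) = ennreal c"
      "0 \<le> c" "c \<le> (4 * pi) powr 2"
    unfolding le_ennreal_iff[OF powr_ge_zero] by blast
  have "c powr (1/2) \<le> ((4 * pi) powr 2) powr (1/2)" using c by (intro powr_mono2) auto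
  then show ?thesis
    unfolding wasserstein_def circle_cut_eq_distr[OF \<mu>] circle_cut_eq_distr[OF \<nu>] a_def[symmetric] b_def[symmetric] c(1)
    using c(2) by (auto simp: ennreal_powr_def intro!: ennreal_leI)
qed

text \<open>Without an admissible pair of cuts the distance is infinite by definition. The measure
  with the smaller mean at 0 is the one whose cut moves, so atomlessness is asked of both.\<close>

lemma circle_wasserstein_finite:
  assumes \<mu>: "circle_prob \<mu>" "\<And>z. emeasure \<mu> {z} = 0" and \<nu>: "circle_prob \<nu>" "\<And>z. emeasure \<nu> {z} = 0"
  shows "circle_wasserstein 2 \<mu> \<nu> \<noteq> \<infinity>"
proof -
  define S where "S = {wasserstein 2 (circle_cut \<mu> u) (circle_cut \<nu> v) | u v.
                u \<in> {0..2 * pi} \<and> v \<in> {0..2 * pi} \<and>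
                (\<integral>x. x \<partial>circle_cut \<mu> u) = (\<integral>x. x \<partial>circle_cut \<nu> v)}"
  have "\<exists>u\<in>{0..2 * pi}. \<exists>v\<in>{0..2*pi}. (\<integral>z. lift_from u z \<partial>\<mu>) = (\<integral>z. lift_from v z \<partial>\<nu>)"
  proof (cases "(\<integral>z. lift_from 0 z \<partial>\<mu>) \<le> (\<integral>z. lift_from 0 z \<partial>\<nu>)")
    case True
    then show ?thesis using circle_cut_means_meet[OF \<mu> \<nu>(1)] by force
  next
    case False
    then obtain v where "v \<in> {0..2*pi}" "(\<integral>z. lift_from v z \<partial>\<nu>) = (\<integral>z. lift_from 0 z \<partial>\<mu>)"
      using circle_cut_means_meet[OF \<nu> \<mu>(1)] by auto
    then show ?thesis by (intro bexI[of _ 0] bexI[of _ v]) auto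
  qed
  then have "S \<noteq> {}" unfolding S_def mean_circle_cut[OF \<mu>(1)] mean_circle_cut[OF \<nu>(1)] by blast
  moreover have "Sup S \<le> ennreal (((4 * pi) powr 2) powr (1 / 2))"
    by (rule Sup_least) (use wasserstein_circle_cut_le[OF \<mu>(1) \<nu>(1)] in \<open>auto simp: S_def\<close>)
  then have "Sup S \<noteq> \<infinity>" using ennreal_neq_top neq_top_trans unfolding infinity_ennreal_def by blast
  ultimately show ?thesis unfolding circle_wasserstein_def S_def[symmetric] by simp
qed

section \<open>Transport bounds for increments of integrals\<close>

text \<open>Since the two cuts have equal means, \<open>c * (x - y)\<close> integrates to 0 for
  every constant \<open>c\<close>. Removing the mean \<open>c\<close> of \<open>f'\<close> from the
  slope is therefore free, and the second moment of \<open>f'\<close> becomes its variance.\<close>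

lemma coupling_bound:
  fixes f f' :: "complex \<Rightarrow> real"
  assumes \<mu>: "circle_prob \<mu>" and \<nu>: "circle_prob \<nu>"
    and \<gamma>: "\<gamma> \<in> couplings (circle_cut \<mu> u) (circle_cut \<nu> v)"
    and mean: "(\<integral>x. x \<partial>circle_cut \<mu> u) = (\<integral>x. x \<partial>circle_cut \<nu> v)"
    and f: "continuous_on circle f" "continuous_on circle f'"
    and taylor: "\<And>x y. f (cis x) - f (cis y) \<le> f' (cis y) * (x - y) + L / 2 * (x - y)\<^sup>2"
    and L: "0 \<le> L" and \<theta>: "0 < \<theta>" and w: "0 \<le> w"
    and cost: "(\<integral>\<^sup>+ (x, y). ennreal (\<bar>x - y\<bar> powr 2) \<partial>\<gamma>) \<le> ennreal w"
  shows "(\<integral>z. f z \<partial>\<mu>) - (\<integral>z. f z \<partial>\<nu>)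
    \<le> \<theta> / 2 * ((\<integral>z. (f' z)\<^sup>2 \<partial>\<nu>) - (\<integral>z. f' z \<partial>\<nu>)\<^sup>2) + (1 / (2 * \<theta>) + L / 2) * w"
proof -
  interpret \<mu>: prob_space \<mu> using \<mu> by (simp add: circle_prob_def)
  interpret \<nu>: prob_space \<nu> using \<nu> by (simp add: circle_prob_def)
  note [measurable] = circle_prob_measurable_lift_from[OF \<mu>] circle_prob_measurable_lift_from[OF \<nu>]
  have [measurable_cong]: "sets \<gamma> = sets (borel \<Otimes>\<^sub>M borel)"
    and d1: "distr \<gamma> borel fst = distr \<mu> borel (lift_from u)"
    and d2: "distr \<gamma> borel snd = distr \<nu> borel (lift_from v)"
    using \<gamma> unfolding couplings_def circle_cut_eq_distr[OF \<mu>] circle_cut_eq_distr[OF \<nu>] by auto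
  have [measurable]: "fst \<in> borel_measurable \<gamma>" "snd \<in> borel_measurable \<gamma>" by measurable
  \<comment> \<open>The total mass of a coupling is read off from its first marginal.\<close>
  interpret prob_space \<gamma>
  proof (rule prob_spaceI)
    have "emeasure \<gamma> (space \<gamma>) = emeasure (distr \<gamma> borel fst) UNIV" by (subst emeasure_distr) auto
    also have "\<dots> = emeasure \<mu> (space \<mu>)" unfolding d1 by (subst emeasure_distr) auto
    finally show "emeasure \<gamma> (space \<gamma>) = 1" by (simp add: \<mu>.emeasure_space_1)
  qed
  have i1: "integrable \<gamma> (\<lambda>p. g (fst p))" "(\<integral>p. g (fst p) \<partial>\<gamma>) = (\<integral>z. g (lift_from u z) \<partial>\<mu>)"
    if [measurable]: "g \<in> borel_measurable borel" and i: "integrable \<mu> (\<lambda>z. g (lift_from u z))" for g :: "real \<Rightarrow> real"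
  proof -
    have "integrable (distr \<gamma> borel fst) g" unfolding d1 using i by (subst integrable_distr_eq) auto
    then show "integrable \<gamma> (\<lambda>p. g (fst p))" by (subst (asm) integrable_distr_eq) auto
    have "(\<integral>p. g (fst p) \<partial>\<gamma>) = (\<integral>x. g x \<partial>distr \<gamma> borel fst)" by (rule integral_distr[symmetric]) auto
    also have "\<dots> = (\<integral>z. g (lift_from u z) \<partial>\<mu>)" unfolding d1 by (rule integral_distr) auto
    finally show "(\<integral>p. g (fst p) \<partial>\<gamma>) = (\<integral>z. g (lift_from u z) \<partial>\<mu>)" .
  qed
  have i2: "integrable \<gamma> (\<lambda>p. g (snd p))" "(\<integral>p. g (snd p) \<partial>\<gamma>) = (\<integral>z. g (lift_from v z) \<partial>\<nu>)"
    if [measurable]: "g \<in> borel_measurable borel" and i: "integrable \<nu> (\<lambda>z. g (lift_from v z))" for g :: "real \<Rightarrow> real"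
  proof -
    have "integrable (distr \<gamma> borel snd) g" unfolding d2 using i by (subst integrable_distr_eq) auto
    then show "integrable \<gamma> (\<lambda>p. g (snd p))" by (subst (asm) integrable_distr_eq) auto
    have "(\<integral>p. g (snd p) \<partial>\<gamma>) = (\<integral>x. g x \<partial>distr \<gamma> borel snd)" by (rule integral_distr[symmetric]) auto
    also have "\<dots> = (\<integral>z. g (lift_from v z) \<partial>\<nu>)" unfolding d2 by (rule integral_distr) auto
    finally show "(\<integral>p. g (snd p) \<partial>\<gamma>) = (\<integral>z. g (lift_from v z) \<partial>\<nu>)" .
  qed
  have cc: "continuous_on UNIV (\<lambda>t. h (cis t))" if "continuous_on circle h" for h :: "complex \<Rightarrow> real"
    by (rule continuous_on_compose2[OF that]) (auto intro!: continuous_intros)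
  have cm: "(\<lambda>t. h (cis t)) \<in> borel_measurable borel" if "continuous_on circle h" for h :: "complex \<Rightarrow> real"
    by (rule borel_measurable_continuous_onI[OF cc[OF that]])
  have j1: "integrable \<gamma> (\<lambda>p. h (cis (fst p)))" "(\<integral>p. h (cis (fst p)) \<partial>\<gamma>) = (\<integral>z. h z \<partial>\<mu>)"
    if h: "continuous_on circle h" for h :: "complex \<Rightarrow> real"
  proof -
    have e: "h (cis (lift_from u z)) = h z" if "z \<in> space \<mu>" for z
      using that by (simp add: cis_lift_from circle_prob_space[OF \<mu>])
    have "integrable \<mu> (\<lambda>z. h (cis (lift_from u z)))"
      using circle_prob_integrable[OF \<mu> h] by (subst Bochner_Integration.integrable_cong[OF refl e])
    from i1[OF cm[OF h] this] show "integrable \<gamma> (\<lambda>p. h (cis (fst p)))" "(\<integral>p. h (cis (fst p)) \<partial>\<gamma>) = (\<integral>z. h z \<partial>\<mu>)"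
      using Bochner_Integration.integral_cong[OF refl e, of \<mu>] by simp_all
  qed
  have j2: "integrable \<gamma> (\<lambda>p. h (cis (snd p)))" "(\<integral>p. h (cis (snd p)) \<partial>\<gamma>) = (\<integral>z. h z \<partial>\<nu>)"
    if h: "continuous_on circle h" for h :: "complex \<Rightarrow> real"
  proof -
    have e: "h (cis (lift_from v z)) = h z" if "z \<in> space \<nu>" for z
      using that by (simp add: cis_lift_from circle_prob_space[OF \<nu>])
    have "integrable \<nu> (\<lambda>z. h (cis (lift_from v z)))"
      using circle_prob_integrable[OF \<nu> h] by (subst Bochner_Integration.integrable_cong[OF refl e])
    from i2[OF cm[OF h] this] show "integrable \<gamma> (\<lambda>p. h (cis (snd p)))" "(\<integral>p. h (cis (snd p)) \<partial>\<gamma>) = (\<integral>z. h z \<partial>\<nu>)"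
      using Bochner_Integration.integral_cong[OF refl e, of \<nu>] by simp_all
  qed
  have k1: "integrable \<gamma> (\<lambda>p. fst p)" "(\<integral>p. fst p \<partial>\<gamma>) = (\<integral>z. lift_from u z \<partial>\<mu>)"
    using i1[of "\<lambda>x. x"] integrable_lift_from[OF \<mu>] by auto
  have k2: "integrable \<gamma> (\<lambda>p. snd p)" "(\<integral>p. snd p \<partial>\<gamma>) = (\<integral>z. lift_from v z \<partial>\<nu>)"
    using i2[of "\<lambda>x. x"] integrable_lift_from[OF \<nu>] by auto
  have fin: "(\<integral>\<^sup>+ p. ennreal ((fst p - snd p)\<^sup>2) \<partial>\<gamma>) \<le> ennreal w"
  proof -
    have "\<bar>x - y\<bar> powr 2 = (x - y)\<^sup>2" for x y :: real
      by (cases "x = y") (simp_all add: powr_realpow)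
    then show ?thesis using cost unfolding split_beta by simp
  qed
  have sq: "integrable \<gamma> (\<lambda>p. (fst p - snd p)\<^sup>2)"
    by (rule integrableI_nonneg) (use fin in \<open>auto intro: le_less_trans\<close>)
  have sqw: "(\<integral>p. (fst p - snd p)\<^sup>2 \<partial>\<gamma>) \<le> w"
    by (rule integral_real_bounded[OF w fin])
  define c where "c = (\<integral>z. f' z \<partial>\<nu>)"
  define g where "g z = (f' z - c)\<^sup>2" for z
  have gc: "continuous_on circle g" unfolding g_def by (intro continuous_intros f)
  \<comment> \<open>Young's inequality with weight \<open>\<theta>\<close> for the centred slope
    times \<open>x - y\<close>.\<close>
  have ineq: "f (cis x) - f (cis y) \<le> \<theta> / 2 * g (cis y) + (1 / (2 * \<theta>) + L / 2) * (x - y)\<^sup>2 + c * (x - y)" for x y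
  proof -
    let ?A = "f' (cis y) - c" and ?B = "x - y"
    have "0 \<le> (\<theta> * ?A - ?B)\<^sup>2 / (2 * \<theta>)" using \<theta> by simp
    also have "(\<theta> * ?A - ?B)\<^sup>2 / (2 * \<theta>) = \<theta> / 2 * ?A\<^sup>2 + 1 / (2 * \<theta>) * ?B\<^sup>2 - ?A * ?B"
      using \<theta> by (simp add: power2_eq_square field_simps)
    finally have "?A * ?B \<le> \<theta> / 2 * ?A\<^sup>2 + 1 / (2 * \<theta>) * ?B\<^sup>2" by simp
    then show ?thesis using taylor[of x y] by (simp add: g_def algebra_simps)
  qed
  have "(\<integral>p. f (cis (fst p)) - f (cis (snd p)) \<partial>\<gamma>)
     \<le> (\<integral>p. \<theta> / 2 * g (cis (snd p)) + (1 / (2 * \<theta>) + L / 2) * (fst p - snd p)\<^sup>2 + c * (fst p - snd p) \<partial>\<gamma>)"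
    by (intro integral_mono ineq Bochner_Integration.integrable_add Bochner_Integration.integrable_diff
        integrable_mult_right j1(1) j2(1) f gc sq k1(1) k2(1))
  also have "\<dots> = \<theta> / 2 * (\<integral>z. g z \<partial>\<nu>) + (1 / (2 * \<theta>) + L / 2) * (\<integral>p. (fst p - snd p)\<^sup>2 \<partial>\<gamma>)
      + c * ((\<integral>z. lift_from u z \<partial>\<mu>) - (\<integral>z. lift_from v z \<partial>\<nu>))"
    using j2[OF gc] sq k1 k2 by simp
  also have "\<dots> \<le> \<theta> / 2 * (\<integral>z. g z \<partial>\<nu>) + (1 / (2 * \<theta>) + L / 2) * w"
    using sqw L \<theta> mean unfolding mean_circle_cut[OF \<mu>] mean_circle_cut[OF \<nu>]
    by (auto intro!: mult_left_mono)
  also have "(\<integral>z. g z \<partial>\<nu>) = (\<integral>z. (f' z)\<^sup>2 \<partial>\<nu>) - (\<integral>z. f' z \<partial>\<nu>)\<^sup>2"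
    unfolding g_def c_def
    by (rule \<nu>.variance_eq) (auto intro!: circle_prob_integrable \<nu> f continuous_intros)
  also have "(\<integral>p. f (cis (fst p)) - f (cis (snd p)) \<partial>\<gamma>) = (\<integral>z. f z \<partial>\<mu>) - (\<integral>z. f z \<partial>\<nu>)"
    using j1[OF f(1)] j2[OF f(1)] by simp
  finally show ?thesis .
qed

text \<open>As the distance is a supremum over pairs of cuts, any one pair is controlled by it, and
  its finiteness guarantees that a pair exists.\<close>

lemma circle_wasserstein_bound:
  fixes f f' :: "complex \<Rightarrow> real"
  assumes \<mu>: "circle_prob \<mu>" and \<nu>: "circle_prob \<nu>"
    and W: "circle_wasserstein 2 \<mu> \<nu> = ennreal W" "0 \<le> W"
    and f: "continuous_on circle f" "continuous_on circle f'"
    and taylor: "\<And>x y. f (cis x) - f (cis y) \<le> f' (cis y) * (x - y) + L / 2 * (x - y)\<^sup>2"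
    and L: "0 \<le> L" and \<theta>: "0 < \<theta>"
  shows "(\<integral>z. f z \<partial>\<mu>) - (\<integral>z. f z \<partial>\<nu>)
    \<le> \<theta> / 2 * ((\<integral>z. (f' z)\<^sup>2 \<partial>\<nu>) - (\<integral>z. f' z \<partial>\<nu>)\<^sup>2) + (1 / (2 * \<theta>) + L / 2) * W\<^sup>2"
proof -
  define S where "S = {wasserstein 2 (circle_cut \<mu> u) (circle_cut \<nu> v) | u v.
                u \<in> {0..2 * pi} \<and> v \<in> {0..2 * pi} \<and>
                (\<integral>x. x \<partial>circle_cut \<mu> u) = (\<integral>x. x \<partial>circle_cut \<nu> v)}"
  have WS: "S \<noteq> {}" "Sup S = ennreal W"
    using W unfolding circle_wasserstein_def S_def[symmetric] by (auto split: if_splits)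
  then obtain u v where mean: "(\<integral>x. x \<partial>circle_cut \<mu> u) = (\<integral>x. x \<partial>circle_cut \<nu> v)"
    and in_S: "wasserstein 2 (circle_cut \<mu> u) (circle_cut \<nu> v) \<in> S" unfolding S_def by auto
  define I where "I = (INF \<gamma>\<in>couplings (circle_cut \<mu> u) (circle_cut \<nu> v). \<integral>\<^sup>+ (x, y). ennreal (\<bar>x - y\<bar> powr 2) \<partial>\<gamma>)"
  have le: "ennreal_powr I (1 / 2) \<le> ennreal W"
    using Sup_upper[OF in_S] WS by (simp add: wasserstein_def I_def)
  then obtain c where c: "I = ennreal c" "0 \<le> c"
    by (cases I) (auto simp: ennreal_powr_def top_unique)
  have "c powr (1/2) \<le> W" using le c W by (simp add: ennreal_powr_def)
  then have "(c powr (1/2))\<^sup>2 \<le> W\<^sup>2" by (intro power_mono) auto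
  moreover have "(c powr (1/2))\<^sup>2 = c" using c by (simp add: powr_half_sqrt)
  ultimately have cW: "c \<le> W\<^sup>2" by simp
  have k: "0 < 1 / (2 * \<theta>) + L / 2" using \<theta> L by (simp add: add_pos_nonneg)
  show ?thesis
  proof (rule field_le_epsilon)
    fix e :: real assume e: "0 < e"
    \<comment> \<open>The infimum over couplings may not be attained; \<open>\<eta>\<close> is the
      slack in the cost that changes the bound by exactly \<open>e\<close>.\<close>
    define \<eta> where "\<eta> = e / (1 / (2 * \<theta>) + L / 2)"
    have \<eta>: "0 < \<eta>" using e k by (simp add: \<eta>_def)
    have "I < ennreal (W\<^sup>2 + \<eta>)" using c cW \<eta> by (simp add: ennreal_less_iff del: ennreal_plus)
    then obtain \<gamma> where \<gamma>: "\<gamma> \<in> couplings (circle_cut \<mu> u) (circle_cut \<nu> v)"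
      "(\<integral>\<^sup>+ (x, y). ennreal (\<bar>x - y\<bar> powr 2) \<partial>\<gamma>) < ennreal (W\<^sup>2 + \<eta>)"
      unfolding I_def INF_less_iff by blast
    have "0 \<le> W\<^sup>2 + \<eta>" using \<eta> by simp
    from coupling_bound[OF \<mu> \<nu> \<gamma>(1) mean f taylor L \<theta> this less_imp_le[OF \<gamma>(2)]]
    have "(\<integral>z. f z \<partial>\<mu>) - (\<integral>z. f z \<partial>\<nu>)
      \<le> \<theta> / 2 * ((\<integral>z. (f' z)\<^sup>2 \<partial>\<nu>) - (\<integral>z. f' z \<partial>\<nu>)\<^sup>2) + (1 / (2 * \<theta>) + L / 2) * (W\<^sup>2 + \<eta>)" .
    also have "(1 / (2 * \<theta>) + L / 2) * (W\<^sup>2 + \<eta>) = (1 / (2 * \<theta>) + L / 2) * W\<^sup>2 + e"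
      using k by (simp add: \<eta>_def distrib_left)
    finally show "(\<integral>z. f z \<partial>\<mu>) - (\<integral>z. f z \<partial>\<nu>)
      \<le> \<theta> / 2 * ((\<integral>z. (f' z)\<^sup>2 \<partial>\<nu>) - (\<integral>z. f' z \<partial>\<nu>)\<^sup>2) + (1 / (2 * \<theta>) + L / 2) * W\<^sup>2 + e" by simp
  qed
qed

section \<open>Trigonometric polynomials and Fejer means\<close>


text \<open>The operator \<open>\<i> z d/dz\<close>, i.e. the derivative of
  \<open>p (z * cis t)\<close> in \<open>t\<close>.\<close>

definition rot_deriv :: "complex poly \<Rightarrow> complex poly"
  where "rot_deriv p = smult \<i> (pCons 0 (pderiv p))"

lemma coeff_rot_deriv: "coeff (rot_deriv p) k = \<i> * of_nat k * coeff p k"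
  by (cases k) (auto simp: rot_deriv_def coeff_pderiv)

lemma degree_rot_deriv_le: "degree (rot_deriv p) \<le> degree p"
  by (rule degree_le) (auto simp: coeff_rot_deriv coeff_eq_0)

lemma poly_cis_vector_derivative:
  "((\<lambda>t. poly p (z * cis t)) has_vector_derivative poly (rot_deriv p) (z * cis t)) (at t)"
proof -
  have "((\<lambda>t. z * cis t) has_vector_derivative z * (\<i> * cis t)) (at t)"
    unfolding has_vector_derivative_def
    by (auto intro!: derivative_eq_intros simp: algebra_simps)
  from field_vector_diff_chain_at[OF this poly_DERIV[of p "z * cis t"]]
  show ?thesis by (simp add: o_def rot_deriv_def mult_ac)
qed

lemma Re_poly_cis_vector_derivative:
  "((\<lambda>t. Re (poly p (z * cis t))) has_vector_derivative Re (poly (rot_deriv p) (z * cis t))) (at t)"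
  by (rule bounded_linear.has_vector_derivative[OF bounded_linear_Re poly_cis_vector_derivative])

lemma circle_deriv_Re_poly: "circle_deriv (\<lambda>z. Re (poly p z)) = (\<lambda>z. Re (poly (rot_deriv p) z))"
proof
  fix z
  show "circle_deriv (\<lambda>z. Re (poly p z)) z = Re (poly (rot_deriv p) z)"
    unfolding circle_deriv_def
    using vector_derivative_at[OF Re_poly_cis_vector_derivative[of p z 0]] by simp
qed

lemma circle_smooth_Re_poly: "circle_smooth (\<lambda>z. Re (poly p z))"
proof -
  have "circle_Ck k (\<lambda>z. Re (poly p z))" for k
  proof (induction k arbitrary: p)
    case 0
    then show ?case by (auto intro!: continuous_intros)
  next
    case (Suc k)
    have "(\<lambda>t. Re (poly p (z * cis t))) differentiable at 0" for z
      using Re_poly_cis_vector_derivative[of p z 0]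
      by (auto simp: has_vector_derivative_def intro: differentiableI)
    then show ?case using Suc by (simp add: circle_deriv_Re_poly)
  qed
  then show ?thesis by (simp add: circle_smooth_def)
qed

text \<open>Real trigonometric polynomials are represented as real parts of complex polynomials; closure under
  products uses \<open>2 Re a Re b = Re (a b) + Re (a b\<^sup>*)\<close> and \<open>z\<^sup>* = 1/z\<close> on the circle.\<close>

lemma Re_poly_mult_cnj:
  obtains r where "\<And>z. z \<in> circle \<Longrightarrow> Re (poly p z * cnj (poly q z)) = Re (poly r z)"
proof -
  \<comment> \<open>A negative power of \<open>z\<close> is replaced by its conjugate, a positive
    power with the same real part.\<close>
  define t where "t j k = (if k \<le> j then monom (coeff p j * cnj (coeff q k)) (j - k)
      else monom (cnj (coeff p j * cnj (coeff q k))) (k - j))" for j k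
  have pw: "z ^ j * cnj z ^ k = z ^ (j - k)" if "z \<in> circle" "k \<le> j" for z j k
  proof -
    have "z ^ j = z ^ (j - k) * z ^ k" using that by (simp flip: power_add)
    then have "z ^ j * cnj z ^ k = z ^ (j - k) * (z * cnj z) ^ k" by (simp add: power_mult_distrib)
    then show ?thesis using circle_cnj_mult[OF that(1)] by simp
  qed
  have tt: "Re (poly (t j k) z) = Re (coeff p j * cnj (coeff q k) * (z ^ j * cnj z ^ k))" if z: "z \<in> circle" for j k z
  proof (cases "k \<le> j")
    case True
    then show ?thesis by (simp add: t_def poly_monom pw[OF z])
  next
    case False
    then have "z ^ k * cnj z ^ j = z ^ (k - j)" by (intro pw z) simp
    then have "cnj (z ^ j * cnj z ^ k) = z ^ (k - j)" by (simp add: mult.commute)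
    then have "poly (t j k) z = cnj (coeff p j * cnj (coeff q k) * (z ^ j * cnj z ^ k))"
      using False unfolding t_def by (simp only: poly_monom if_False complex_cnj_mult[of "coeff p j * cnj (coeff q k)"])
    then show ?thesis by (simp only: cnj.simps(1))
  qed
  show thesis
  proof (rule that[of "\<Sum>j\<le>degree p. \<Sum>k\<le>degree q. t j k"])
    fix z assume z: "z \<in> circle"
    have "poly p z * cnj (poly q z)
      = (\<Sum>j\<le>degree p. \<Sum>k\<le>degree q. coeff p j * cnj (coeff q k) * (z ^ j * cnj z ^ k))"
      by (simp add: poly_altdef sum_product mult_ac)
    then show "Re (poly p z * cnj (poly q z)) = Re (poly (\<Sum>j\<le>degree p. \<Sum>k\<le>degree q. t j k) z)"
      by (simp only: poly_sum Re_sum tt[OF z])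
  qed
qed

text \<open>Real parts of polynomials form an algebra on the circle; the polynomials
  \<open>z\<close> and \<open>- \<i> z\<close> supply the two coordinates, which separate
  points.\<close>

lemma circle_Stone_Weierstrass:
  fixes f :: "complex \<Rightarrow> real"
  assumes f: "continuous_on circle f" and e: "0 < e"
  obtains p where "\<And>z. z \<in> circle \<Longrightarrow> \<bar>f z - Re (poly p z)\<bar> < e"
proof -
  define P where "P g \<longleftrightarrow> (\<exists>p. \<forall>z\<in>circle. g z = Re (poly p z))" for g :: "complex \<Rightarrow> real"
  have "\<exists>g. P g \<and> (\<forall>x\<in>circle. \<bar>f x - g x\<bar> < e)"
  proof (rule Stone_Weierstrass_HOL[OF compact_circle])
    show "P (\<lambda>x. c)" for c unfolding P_def by (rule exI[of _ "[:of_real c:]"]) simp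
    show "continuous_on circle g" if g: "P g" for g
    proof -
      obtain p where "\<forall>z\<in>circle. g z = Re (poly p z)" using g unfolding P_def by blast
      then show ?thesis by (subst continuous_on_cong[OF refl]) (auto intro!: continuous_intros)
    qed
    show "P (\<lambda>x. g x + h x)" if gh: "P g \<and> P h" for g h
    proof -
      obtain p q where "\<forall>z\<in>circle. g z = Re (poly p z)" "\<forall>z\<in>circle. h z = Re (poly q z)"
        using gh unfolding P_def by blast
      then show ?thesis unfolding P_def by (intro exI[of _ "p + q"]) simp
    qed
    show "P (\<lambda>x. g x * h x)" if gh: "P g \<and> P h" for g h
    proof -
      obtain p q where pq: "\<And>z. z \<in> circle \<Longrightarrow> g z = Re (poly p z)" "\<And>z. z \<in> circle \<Longrightarrow> h z = Re (poly q z)"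
        using gh unfolding P_def by blast
      obtain r where r: "\<And>z. z \<in> circle \<Longrightarrow> Re (poly p z * cnj (poly q z)) = Re (poly r z)"
        using Re_poly_mult_cnj by blast
      have "g z * h z = Re (poly (smult (1/2) (p * q + r)) z)" if z: "z \<in> circle" for z
        using pq[OF z] r[OF z, symmetric] by (simp add: field_simps)
      then show ?thesis unfolding P_def by blast
    qed
    show "\<exists>f. P f \<and> f x \<noteq> f y" if "x \<in> circle \<and> y \<in> circle \<and> x \<noteq> y" for x y
    proof (cases "Re x = Re y")
      case False
      then show ?thesis unfolding P_def by (intro exI[of _ Re] conjI exI[of _ "[:0, 1:]"]) auto
    next
      case True
      then have "Im x \<noteq> Im y" using that by (auto simp: complex_eq_iff)
      then show ?thesis unfolding P_def by (intro exI[of _ Im] conjI exI[of _ "[:0, -\<i>:]"]) auto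
    qed
  qed (use f e in auto)
  then show thesis using that unfolding P_def by metis
qed

section \<open>Probability measures with polynomial densities\<close>

definition poly_measure :: "complex poly \<Rightarrow> complex measure"
  where "poly_measure a = density haar (\<lambda>z. ennreal (Re (poly a z)))"

lemma measurable_haar_Re_poly [measurable]: "(\<lambda>z. Re (poly a z)) \<in> borel_measurable haar"
  by (intro circle_prob_measurable_continuous circle_prob_haar continuous_intros)

text \<open>For these smooth measures the moments, the energy and later the Hilbert transform are
  explicit in finitely many coefficients.\<close>

locale poly_density =
  fixes a :: "complex poly"
  assumes nonneg: "\<And>z. z \<in> circle \<Longrightarrow> 0 \<le> Re (poly a z)" and mass: "Re (coeff a 0) = 1"
begin

lemma integral_poly_measure:
  fixes f :: "complex \<Rightarrow> 'a::{banach, second_countable_topology}"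
  assumes "continuous_on circle f"
  shows "(\<integral>z. f z \<partial>poly_measure a) = (\<integral>z. Re (poly a z) *\<^sub>R f z \<partial>haar)"
  unfolding poly_measure_def
  by (rule integral_density)
    (auto simp: nonneg intro!: AE_I2 circle_prob_measurable_continuous[OF circle_prob_haar assms])

lemma smooth_poly_measure: "is_smooth_density (poly_measure a) (\<lambda>z. Re (poly a z))"
  by (simp add: is_smooth_density_def circle_smooth_Re_poly nonneg poly_measure_def)

lemma circle_prob_poly_measure: "circle_prob (poly_measure a)"
proof -
  have "emeasure (poly_measure a) (space (poly_measure a)) = (\<integral>\<^sup>+z. ennreal (Re (poly a z)) \<partial>haar)"
    unfolding poly_measure_def
    using sets.top[of haar] by (subst emeasure_density) (auto intro!: nn_integral_cong)
  also have "\<dots> = ennreal (\<integral>z. Re (poly a z) \<partial>haar)"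
    by (rule nn_integral_eq_integral)
      (auto simp: nonneg intro!: AE_I2 circle_prob_integrable circle_prob_haar continuous_intros)
  also have "(\<integral>z. Re (poly a z) \<partial>haar) = Re (\<integral>z. poly a z \<partial>haar)"
    by (rule integral_Re) (intro circle_prob_integrable circle_prob_haar continuous_intros)
  finally have "prob_space (poly_measure a)"
    by (intro prob_spaceI) (simp add: integral_haar_poly mass)
  then show ?thesis by (simp add: circle_prob_def poly_measure_def)
qed

lemma smooth_prob_poly_measure: "smooth_prob (poly_measure a)"
  using circle_prob_poly_measure smooth_poly_measure by (auto simp: smooth_prob_def)

lemma emeasure_poly_measure_singleton: "emeasure (poly_measure a) {z} = 0"
proof (cases "{z} \<in> sets haar")
  case True
  then have [measurable]: "{z} \<in> sets haar" .
  have "AE w in haar. ennreal (Re (poly a w)) * indicator {z} w = 0"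
    using circle_AE_neq[of z] by (rule eventually_mono) auto
  moreover have "(\<lambda>w. ennreal (Re (poly a w)) * indicator {z} w) \<in> borel_measurable haar" by measurable
  ultimately have "(\<integral>\<^sup>+w. ennreal (Re (poly a w)) * indicator {z} w \<partial>haar) = 0"
    by (simp only: nn_integral_0_iff_AE)
  then show ?thesis unfolding poly_measure_def
    using True by (subst emeasure_density) auto
next
  case False
  then show ?thesis by (intro emeasure_notin_sets) (simp add: poly_measure_def)
qed

lemma moment_poly_measure: "0 < k \<Longrightarrow> moment (poly_measure a) k = cnj (coeff a k) / 2"
  unfolding moment_def
  by (subst integral_poly_measure)
    (auto intro!: continuous_intros simp: integral_haar_power_Re_poly[symmetric] scaleR_conv_of_real mult.commute)

text \<open>The 4 is the square of the 2 in \<open>moment_poly_measure\<close>. A free bound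
  \<open>K\<close> on the degree lets the energies of two polynomials be compared over one index
  set.\<close>

lemma energy_poly_measure:
  assumes "degree a \<le> K"
  shows "energy Q (poly_measure a)
    = ereal ((\<integral>x. Q x \<partial>poly_measure a) + (\<Sum>k\<le>K. (cmod (coeff a k))\<^sup>2 / (4 * real k)))"
proof -
  have e: "(cmod (moment (poly_measure a) k))\<^sup>2 / real k = (cmod (coeff a k))\<^sup>2 / (4 * real k)" for k
    by (cases "k = 0") (auto simp: moment_poly_measure norm_divide power_divide)
  have "(\<Sum>k. ennreal ((cmod (coeff a k))\<^sup>2 / (4 * real k))) = (\<Sum>k\<le>K. ennreal ((cmod (coeff a k))\<^sup>2 / (4 * real k)))"
    by (rule suminf_finite) (use assms in \<open>auto simp: coeff_eq_0\<close>)
  also have "\<dots> = ennreal (\<Sum>k\<le>K. (cmod (coeff a k))\<^sup>2 / (4 * real k))"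
    by (rule sum_ennreal) auto
  finally show ?thesis
    unfolding energy_eq[OF circle_prob_poly_measure] e
    by (simp add: sum_nonneg)
qed

end

section \<open>Fejer kernel and Fejer's theorem\<close>

text \<open>The usual weight \<open>1 - k / (N + 1)\<close>, doubled for \<open>k > 0\<close>
  because one term of a real part stands for the frequencies \<open>k\<close> and
  \<open>-k\<close>.\<close>

definition fejer_factor :: "nat \<Rightarrow> nat \<Rightarrow> real"
  where "fejer_factor N k = (if k = 0 then 1 else 2 * (1 - real k / real (Suc N)))"

text \<open>The square form shows nonnegativity, the coefficient form gives the action on
  moments.\<close>

lemma fejer_kernel:
  assumes z: "z \<in> circle"
  shows "(cmod (\<Sum>k\<le>N. z ^ k))\<^sup>2 / real (Suc N) = Re (\<Sum>k\<le>N. of_real (fejer_factor N k) * z ^ k)"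
proof -
  \<comment> \<open>In the expanded square, the difference \<open>k\<close> of two exponents occurs
    \<open>N + 1 - k\<close> times.\<close>
  have key: "(cmod (\<Sum>k\<le>N. z ^ k))\<^sup>2 = real (Suc N) + 2 * (\<Sum>k=1..N. (real (Suc N) - real k) * Re (z ^ k))" for N
  proof (induction N)
    case (Suc N)
    let ?S = "\<Sum>k\<le>N. z ^ k"
    have c: "z ^ Suc N * cnj ?S = (\<Sum>k=1..Suc N. z ^ k)"
    proof -
      have "z ^ Suc N * cnj ?S = (\<Sum>j\<le>N. z ^ Suc N * cnj (z ^ j))"
        by (simp add: sum_distrib_left)
      also have "\<dots> = (\<Sum>j\<le>N. z ^ (Suc N - j))"
      proof (rule sum.cong[OF refl])
        fix j assume "j \<in> {..N}"
        then have "z ^ Suc N = z ^ (Suc N - j) * z ^ j" by (simp flip: power_add power_Suc)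
        then have "z ^ Suc N * cnj (z ^ j) = z ^ (Suc N - j) * (z * cnj z) ^ j"
          by (simp add: power_mult_distrib)
        then show "z ^ Suc N * cnj (z ^ j) = z ^ (Suc N - j)" using circle_cnj_mult[OF z] by simp
      qed
      also have "\<dots> = (\<Sum>k=1..Suc N. z ^ k)"
        by (rule sum.reindex_bij_witness[of _ "\<lambda>k. Suc N - k" "\<lambda>j. Suc N - j"]) auto
      finally show ?thesis .
    qed
    have "(cmod (?S + z ^ Suc N))\<^sup>2 = (cmod ?S)\<^sup>2 + (cmod (z ^ Suc N))\<^sup>2 + 2 * Re (z ^ Suc N * cnj ?S)"
    proof -
      have "(cmod (x + y))\<^sup>2 = (cmod x)\<^sup>2 + (cmod y)\<^sup>2 + 2 * Re (y * cnj x)" for x y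
        unfolding cmod_power2 by (simp add: power2_eq_square algebra_simps)
      then show ?thesis .
    qed
    also have "(cmod (z ^ Suc N))\<^sup>2 = 1" using z by (simp add: circle_iff norm_power del: power_Suc)
    finally have "(cmod (\<Sum>k\<le>Suc N. z ^ k))\<^sup>2
      = real (Suc N) + 2 * (\<Sum>k=1..N. (real (Suc N) - real k) * Re (z ^ k)) + 1 + 2 * (\<Sum>k=1..Suc N. Re (z ^ k))"
      unfolding c Suc.IH by simp
    \<comment> \<open>The added term at \<open>Suc N\<close> has coefficient 0; both sums then share
      one index range.\<close>
    also have "(\<Sum>k=1..N. (real (Suc N) - real k) * Re (z ^ k)) = (\<Sum>k=1..Suc N. (real (Suc N) - real k) * Re (z ^ k))"
      by (simp del: power_Suc)
    also have "real (Suc N) + 2 * (\<Sum>k=1..Suc N. (real (Suc N) - real k) * Re (z ^ k)) + 1 + 2 * (\<Sum>k=1..Suc N. Re (z ^ k))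
      = real (Suc (Suc N)) + 2 * (\<Sum>k=1..Suc N. (real (Suc N) - real k) * Re (z ^ k) + Re (z ^ k))"
      by (simp only: sum.distrib) (simp del: sum.cl_ivl_Suc power_Suc)
    also have "(\<Sum>k=1..Suc N. (real (Suc N) - real k) * Re (z ^ k) + Re (z ^ k))
      = (\<Sum>k=1..Suc N. (real (Suc (Suc N)) - real k) * Re (z ^ k))"
      by (rule sum.cong) (auto simp: algebra_simps)
    finally show ?case .
  qed simp
  have "Re (\<Sum>k\<le>N. of_real (fejer_factor N k) * z ^ k) = (\<Sum>k\<in>insert 0 {1..N}. fejer_factor N k * Re (z ^ k))"
  proof -
    have "{..N} = insert 0 {1..N}" by auto
    then show ?thesis by (simp only: Re_sum times_complex.sel Re_complex_of_real Im_complex_of_real) simp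
  qed
  also have "\<dots> = 1 + (\<Sum>k=1..N. fejer_factor N k * Re (z ^ k))"
    by (subst sum.insert) (auto simp: fejer_factor_def)
  also have "(\<Sum>k=1..N. fejer_factor N k * Re (z ^ k))
      = (\<Sum>k=1..N. 2 / real (Suc N) * ((real (Suc N) - real k) * Re (z ^ k)))"
    by (rule sum.cong) (auto simp: fejer_factor_def field_simps)
  also have "\<dots> = 2 / real (Suc N) * (\<Sum>k=1..N. (real (Suc N) - real k) * Re (z ^ k))"
    by (rule sum_distrib_left[symmetric])
  finally show ?thesis unfolding key by (simp only: add_divide_distrib) simp
qed

text \<open>To be applied to moments \<open>\<integral> z^k\<close>: the conjugate makes them
  Fourier coefficients, so that the real part on the circle is the Fejer mean.\<close>

definition fejer :: "nat \<Rightarrow> (nat \<Rightarrow> complex) \<Rightarrow> complex poly"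
  where "fejer N m = (\<Sum>k\<le>N. monom (of_real (fejer_factor N k) * cnj (m k)) k)"

lemma coeff_fejer: "coeff (fejer N m) k = (if k \<le> N then of_real (fejer_factor N k) * cnj (m k) else 0)"
  unfolding fejer_def coeff_sum by (auto simp: if_distrib cong: if_cong)

lemma degree_fejer_le: "degree (fejer N m) \<le> N"
  by (rule degree_le) (simp add: coeff_fejer)

lemma fejer_factor_tendsto: "0 < k \<Longrightarrow> (\<lambda>N. fejer_factor N k) \<longlonglongrightarrow> 2"
proof -
  assume "0 < k"
  then have "(\<lambda>N. fejer_factor N k) = (\<lambda>N. 2 * (1 - real k * inverse (real (Suc N))))"
    by (simp add: fejer_factor_def fun_eq_iff divide_inverse)
  moreover have "(\<lambda>N. 2 * (1 - real k * inverse (real (Suc N)))) \<longlonglongrightarrow> 2 * (1 - real k * 0)"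
    by (intro tendsto_intros LIMSEQ_inverse_real_of_nat)
  ultimately show ?thesis by simp
qed

lemma coeff_fejer_tendsto:
  assumes "0 < k" shows "(\<lambda>N. coeff (fejer N m) k) \<longlonglongrightarrow> 2 * cnj (m k)"
proof -
  have "(\<lambda>N. complex_of_real (fejer_factor N k) * cnj (m k)) \<longlonglongrightarrow> of_real 2 * cnj (m k)"
    by (intro tendsto_intros fejer_factor_tendsto assms)
  moreover have "eventually (\<lambda>N. complex_of_real (fejer_factor N k) * cnj (m k) = coeff (fejer N m) k) sequentially"
    using eventually_ge_at_top[of k] by (rule eventually_mono) (simp add: coeff_fejer)
  ultimately show ?thesis using Lim_transform_eventually by fastforce
qed

text \<open>Convolution with the Fejer kernel, stated for \<open>\<phi> d\<nu>\<close> so that it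
  serves both measures (\<open>\<phi> = 1\<close>) and functions
  (\<open>\<nu> = haar\<close>).\<close>

lemma fejer_integral:
  fixes \<phi> :: "complex \<Rightarrow> real"
  assumes \<nu>: "circle_prob \<nu>" and \<phi>: "continuous_on circle \<phi>" and w: "w \<in> circle"
  shows "Re (poly (fejer N (\<lambda>k. \<integral>z. \<phi> z * z ^ k \<partial>\<nu>)) w)
    = (\<integral>z. (cmod (\<Sum>k\<le>N. (z * cnj w) ^ k))\<^sup>2 / real (Suc N) * \<phi> z \<partial>\<nu>)"
proof -
  have "(\<integral>z. (cmod (\<Sum>k\<le>N. (z * cnj w) ^ k))\<^sup>2 / real (Suc N) * \<phi> z \<partial>\<nu>)
    = (\<integral>z. Re (\<Sum>k\<le>N. of_real (fejer_factor N k) * cnj w ^ k * (\<phi> z * z ^ k)) \<partial>\<nu>)"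
  proof (rule Bochner_Integration.integral_cong[OF refl])
    fix z assume "z \<in> space \<nu>"
    then have zw: "z * cnj w \<in> circle" using w by (auto simp: circle_prob_space[OF \<nu>] intro: mult_in_circle)
    have "Re (\<Sum>k\<le>N. of_real (fejer_factor N k) * (z * cnj w) ^ k) * \<phi> z
      = Re ((\<Sum>k\<le>N. of_real (fejer_factor N k) * (z * cnj w) ^ k) * of_real (\<phi> z))" by simp
    also have "(\<Sum>k\<le>N. of_real (fejer_factor N k) * (z * cnj w) ^ k) * of_real (\<phi> z)
      = (\<Sum>k\<le>N. of_real (fejer_factor N k) * cnj w ^ k * (\<phi> z * z ^ k))"
      unfolding sum_distrib_right power_mult_distrib by (simp only: mult_ac)
    finally show "(cmod (\<Sum>k\<le>N. (z * cnj w) ^ k))\<^sup>2 / real (Suc N) * \<phi> z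
      = Re (\<Sum>k\<le>N. of_real (fejer_factor N k) * cnj w ^ k * (\<phi> z * z ^ k))"
      by (simp only: fejer_kernel[OF zw])
  qed
  also have "\<dots> = Re (\<integral>z. (\<Sum>k\<le>N. of_real (fejer_factor N k) * cnj w ^ k * (\<phi> z * z ^ k)) \<partial>\<nu>)"
    by (rule integral_Re) (intro circle_prob_integrable \<nu> continuous_intros \<phi>)
  also have "(\<integral>z. (\<Sum>k\<le>N. of_real (fejer_factor N k) * cnj w ^ k * (\<phi> z * z ^ k)) \<partial>\<nu>)
    = (\<Sum>k\<le>N. of_real (fejer_factor N k) * cnj w ^ k * (\<integral>z. \<phi> z * z ^ k \<partial>\<nu>))"
    by (subst Bochner_Integration.integral_sum)
      (auto intro!: circle_prob_integrable \<nu> continuous_intros \<phi>)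
  also have "\<dots> = cnj (poly (fejer N (\<lambda>k. \<integral>z. \<phi> z * z ^ k \<partial>\<nu>)) w)"
    by (simp add: fejer_def poly_sum poly_monom mult_ac)
  finally show ?thesis by simp
qed

lemma integral_fejer_kernel:
  assumes w: "w \<in> circle"
  shows "(\<integral>z. (cmod (\<Sum>k\<le>N. (z * cnj w) ^ k))\<^sup>2 / real (Suc N) \<partial>haar) = 1"
proof -
  have "(\<integral>z. (cmod (\<Sum>k\<le>N. (z * cnj w) ^ k))\<^sup>2 / real (Suc N) \<partial>haar)
    = Re (poly (fejer N (\<lambda>k. \<integral>z. z ^ k \<partial>haar)) w)"
    using fejer_integral[OF circle_prob_haar _ w, of "\<lambda>_. 1" N] by simp
  also have "fejer N (\<lambda>k. \<integral>z. z ^ k \<partial>haar) = 1"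
    by (rule poly_eqI) (auto simp: coeff_fejer integral_haar_power fejer_factor_def power_0_left)
  finally show ?thesis by simp
qed

text \<open>The kernel is nonnegative with mass 1, so taking Fejer means does not increase the sup
  norm. This reduces the claim to \<open>Re p\<close>, whose Fejer means have an explicit
  error.\<close>

lemma fejer_uniform:
  fixes \<phi> :: "complex \<Rightarrow> real"
  assumes \<phi>: "continuous_on circle \<phi>" and e: "0 < e"
  shows "eventually (\<lambda>N. \<forall>w\<in>circle. \<bar>Re (poly (fejer N (\<lambda>k. \<integral>z. \<phi> z * z ^ k \<partial>haar)) w) - \<phi> w\<bar> \<le> e) sequentially"
proof -
  obtain p where p: "\<And>z. z \<in> circle \<Longrightarrow> \<bar>\<phi> z - Re (poly p z)\<bar> < e / 3"
    using circle_Stone_Weierstrass[OF \<phi>, of "e / 3"] e by auto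
  let ?q = "\<lambda>z. Re (poly p z)"
  let ?K = "\<lambda>N w z. (cmod (\<Sum>k\<le>N. (z * cnj w) ^ k))\<^sup>2 / real (Suc N)"
  let ?F = "\<lambda>N \<phi> w. Re (poly (fejer N (\<lambda>k. \<integral>z. \<phi> z * z ^ k \<partial>haar)) w)"
  have qc: "continuous_on circle ?q" by (intro continuous_intros)
  have Kc: "continuous_on circle (?K N w)" for N w by (intro continuous_intros) auto
  have 1: "\<bar>?F N \<phi> w - ?F N ?q w\<bar> \<le> e / 3" if w: "w \<in> circle" for N w
  proof -
    have "integrable haar (\<lambda>z. ?K N w z * \<phi> z)" "integrable haar (\<lambda>z. ?K N w z * ?q z)"
      by (intro circle_prob_integrable circle_prob_haar continuous_on_mult Kc \<phi> qc)+
    note id = Bochner_Integration.integral_diff[OF this]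
    have "?F N \<phi> w - ?F N ?q w = (\<integral>z. ?K N w z * \<phi> z - ?K N w z * ?q z \<partial>haar)"
      unfolding fejer_integral[OF circle_prob_haar \<phi> w] fejer_integral[OF circle_prob_haar qc w]
      by (rule id[symmetric])
    also have "\<bar>\<dots>\<bar> \<le> (\<integral>z. \<bar>?K N w z * \<phi> z - ?K N w z * ?q z\<bar> \<partial>haar)"
      by (rule integral_abs_bound)
    also have "\<dots> \<le> (\<integral>z. e / 3 * ?K N w z \<partial>haar)"
    proof (rule integral_mono)
      show "integrable haar (\<lambda>z. \<bar>?K N w z * \<phi> z - ?K N w z * ?q z\<bar>)"
        by (intro circle_prob_integrable circle_prob_haar continuous_intros Kc \<phi>) auto
      show "integrable haar (\<lambda>z. e / 3 * ?K N w z)"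
        by (intro circle_prob_integrable circle_prob_haar continuous_intros Kc) auto
      fix z assume "z \<in> space haar"
      then have "\<bar>\<phi> z - ?q z\<bar> \<le> e / 3" using p[of z] by simp
      then have "?K N w z * \<bar>\<phi> z - ?q z\<bar> \<le> ?K N w z * (e / 3)" by (intro mult_left_mono) auto
      moreover have "\<bar>?K N w z * \<phi> z - ?K N w z * ?q z\<bar> = ?K N w z * \<bar>\<phi> z - ?q z\<bar>"
        unfolding right_diff_distrib[symmetric] abs_mult by simp
      ultimately show "\<bar>?K N w z * \<phi> z - ?K N w z * ?q z\<bar> \<le> e / 3 * ?K N w z" by (simp only: mult.commute)
    qed
    also have "\<dots> = e / 3" using integral_fejer_kernel[OF w, of N] by (simp only: integral_mult_right_zero mult_1_right)
    finally show ?thesis .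
  qed
  \<comment> \<open>For \<open>k > 0\<close> the moment is \<open>cnj (coeff p k) / 2\<close> and
    the weight \<open>2 * (1 - k / (N + 1))\<close>, so the coefficient error is exactly
    \<open>- k / (N + 1)\<close> times the coefficient.\<close>
  define C where "C = (\<Sum>k\<le>degree p. real k * cmod (coeff p k))"
  have 2: "\<bar>?F N ?q w - ?q w\<bar> \<le> C * inverse (real (Suc N))" if N: "degree p \<le> N" and w: "w \<in> circle" for N w
  proof -
    have m: "(\<integral>z. complex_of_real (?q z) * z ^ k \<partial>haar) = (if k = 0 then of_real (Re (coeff p 0)) else cnj (coeff p k) / 2)" for k
    proof (cases "k = 0")
      case False
      then show ?thesis using integral_haar_power_Re_poly[of k p] by (simp add: mult.commute)
    next
      case True
      have "(\<integral>z. ?q z \<partial>haar) = Re (\<integral>z. poly p z \<partial>haar)"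
        by (rule integral_Re) (intro circle_prob_integrable circle_prob_haar continuous_intros)
      then show ?thesis using True by (simp add: integral_haar_poly integral_complex_of_real)
    qed
    have pN: "poly r w = (\<Sum>k\<le>N. coeff r k * w ^ k)" if "degree r \<le> N" for r
      unfolding poly_altdef by (rule sum.mono_neutral_left) (use that in \<open>auto simp: coeff_eq_0\<close>)
    have "?F N ?q w - ?q w = (\<Sum>k\<le>N. Re ((coeff (fejer N (\<lambda>k. \<integral>z. of_real (?q z) * z ^ k \<partial>haar)) k - coeff p k) * w ^ k))"
      unfolding pN[OF N] pN[OF degree_fejer_le]
      by (simp only: Re_sum minus_complex.sel(1) left_diff_distrib sum_subtractf)
    also have "\<dots> = (\<Sum>k\<le>N. - (real k * inverse (real (Suc N)) * Re (coeff p k * w ^ k)))"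
    proof (rule sum.cong[OF refl])
      fix k assume k: "k \<in> {..N}"
      show "Re ((coeff (fejer N (\<lambda>k. \<integral>z. of_real (?q z) * z ^ k \<partial>haar)) k - coeff p k) * w ^ k)
        = - (real k * inverse (real (Suc N)) * Re (coeff p k * w ^ k))"
      proof (cases "k = 0")
        case True then show ?thesis unfolding coeff_fejer m by (simp add: fejer_factor_def)
      next
        case False
        then have "coeff (fejer N (\<lambda>k. \<integral>z. of_real (?q z) * z ^ k \<partial>haar)) k - coeff p k
          = of_real (- (real k * inverse (real (Suc N)))) * coeff p k"
        proof -
          have aux: "complex_of_real (2 * (1 - x)) * cnj (cnj c / 2) - c = of_real (- x) * c" for x c
            by (simp add: algebra_simps)
          have ff: "fejer_factor N k = 2 * (1 - real k * inverse (real (Suc N)))"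
            using False by (simp add: fejer_factor_def divide_inverse)
          have "k \<le> N" using k by simp
          then show ?thesis by (simp only: coeff_fejer m False ff aux if_True if_False)
        qed
        then show ?thesis by (simp add: mult.assoc Re_complex_of_real del: of_real_minus of_real_mult of_real_inverse)
      qed
    qed
    also have "\<bar>\<dots>\<bar> \<le> (\<Sum>k\<le>N. \<bar>- (real k * inverse (real (Suc N)) * Re (coeff p k * w ^ k))\<bar>)" by (rule sum_abs)
    also have "\<dots> \<le> (\<Sum>k\<le>N. real k * cmod (coeff p k) * inverse (real (Suc N)))"
    proof (rule sum_mono)
      fix k
      have "\<bar>Re (coeff p k * w ^ k)\<bar> \<le> cmod (coeff p k * w ^ k)" by (rule abs_Re_le_cmod)
      also have "\<dots> = cmod (coeff p k)" using w by (simp add: circle_iff norm_mult norm_power)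
      finally have "(real k * inverse (real (Suc N))) * \<bar>Re (coeff p k * w ^ k)\<bar> \<le> (real k * inverse (real (Suc N))) * cmod (coeff p k)"
        by (rule mult_left_mono) simp
      then show "\<bar>- (real k * inverse (real (Suc N)) * Re (coeff p k * w ^ k))\<bar> \<le> real k * cmod (coeff p k) * inverse (real (Suc N))"
        by (simp add: abs_mult mult_ac)
    qed
    also have "\<dots> = C * inverse (real (Suc N))"
      unfolding C_def sum_distrib_right[symmetric]
      by (intro arg_cong2[where f="(*)"] refl sum.mono_neutral_right) (use N in \<open>auto simp: coeff_eq_0\<close>)
    finally show ?thesis .
  qed
  have "(\<lambda>N. C * inverse (real (Suc N))) \<longlonglongrightarrow> C * 0" by (intro tendsto_intros LIMSEQ_inverse_real_of_nat)
  then have "eventually (\<lambda>N. C * inverse (real (Suc N)) < e / 3) sequentially"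
    by (rule order_tendstoD(2)) (use e in simp)
  then show ?thesis
    using eventually_ge_at_top[of "degree p"]
  proof eventually_elim
    case (elim N)
    show ?case
    proof
      fix w assume w: "w \<in> circle"
      show "\<bar>?F N \<phi> w - \<phi> w\<bar> \<le> e" using 1[OF w, of N] 2[OF elim(2) w] elim(1) p[OF w] by linarith
    qed
  qed
qed

section \<open>The equilibrium measure and its perturbations\<close>


text \<open>Passes from a density with values in \<open>ennreal\<close> to a real one; total mass 1
  makes it finite almost everywhere.\<close>

lemma density_inf_posE:
  assumes \<mu>: "circle_prob \<mu>" and pos: "density_inf_pos \<mu>"
  obtains m c where "m \<in> borel_measurable haar" "integrable haar m" "0 < c"
    "AE z in haar. c \<le> m z" "\<mu> = density haar (\<lambda>z. ennreal (m z))"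
proof -
  interpret prob_space \<mu> using \<mu> by (simp add: circle_prob_def)
  obtain f where f [measurable]: "f \<in> borel_measurable haar" and \<mu>f: "\<mu> = density haar f"
    and inf: "0 < (INF z\<in>circle. f z)" using pos unfolding density_inf_pos_def by blast
  have "(\<integral>\<^sup>+z. f z \<partial>haar) = emeasure \<mu> (space \<mu>)"
    unfolding \<mu>f using sets.top[of haar] by (subst emeasure_density) (auto intro!: nn_integral_cong)
  then have 1: "(\<integral>\<^sup>+z. f z \<partial>haar) = 1" by (simp add: emeasure_space_1)
  then have fin: "AE z in haar. f z \<noteq> \<infinity>" by (intro nn_integral_PInf_AE) auto
  define m where "m z = enn2real (f z)" for z
  have m [measurable]: "m \<in> borel_measurable haar" unfolding m_def by measurable
  have mf: "AE z in haar. ennreal (m z) = f z"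
    using fin by (rule eventually_mono) (auto simp: m_def less_top)
  have "(\<integral>\<^sup>+z. ennreal (m z) \<partial>haar) = 1" using nn_integral_cong_AE[OF mf] 1 by simp
  then have mi: "integrable haar m" by (intro integrableI_nonneg) (auto simp: m_def)
  \<comment> \<open>The truncation at 1 makes the lower bound a real number at once.\<close>
  define c where "c = enn2real (min 1 (INF z\<in>circle. f z))"
  have cfin: "min 1 (INF z\<in>circle. f z) < \<infinity>" by (rule le_less_trans[OF min.cobounded1]) simp
  have c0: "0 < c" unfolding c_def using inf cfin by (simp add: enn2real_positive_iff)
  have "AE z in haar. c \<le> m z"
  proof (rule AE_mp[OF mf], intro AE_I2 impI)
    fix z assume z: "z \<in> space haar" and e: "ennreal (m z) = f z"
    have "ennreal c = min 1 (INF z\<in>circle. f z)" unfolding c_def using cfin by (simp add: less_top)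
    also have "\<dots> \<le> f z" using z by (intro min.coboundedI2 INF_lower) simp
    finally have "ennreal c \<le> ennreal (m z)" using e by simp
    then show "c \<le> m z" by (simp add: m_def)
  qed
  moreover have "\<mu> = density haar (\<lambda>z. ennreal (m z))"
    unfolding \<mu>f by (rule density_cong) (use mf in \<open>auto elim!: eventually_mono\<close>)
  ultimately show thesis using that m mi c0 by blast
qed

lemma energy_real:
  assumes "circle_prob \<mu>" and s: "summable (\<lambda>k. (cmod (moment \<mu> k))\<^sup>2 / real k)"
  shows "energy Q \<mu> = ereal ((\<integral>x. Q x \<partial>\<mu>) + (\<Sum>k. (cmod (moment \<mu> k))\<^sup>2 / real k))"
proof -
  have "(\<Sum>k. ennreal ((cmod (moment \<mu> k))\<^sup>2 / real k)) = ennreal (\<Sum>k. (cmod (moment \<mu> k))\<^sup>2 / real k)"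
    by (rule suminf_ennreal2[OF _ s]) simp
  moreover have "0 \<le> (\<Sum>k. (cmod (moment \<mu> k))\<^sup>2 / real k)" by (rule suminf_nonneg[OF s]) simp
  ultimately show ?thesis unfolding energy_eq[OF assms(1)] by simp
qed

lemma moment_0:
  assumes "circle_prob \<mu>" shows "moment \<mu> 0 = 1"
proof -
  interpret prob_space \<mu> using assms by (simp add: circle_prob_def)
  show ?thesis by (simp add: moment_def prob_space)
qed

text \<open>Haar measure is a competitor of finite energy, as all its moments of positive order
  vanish. A minimizer thus cannot have a divergent series.\<close>

lemma equilibrium_summable:
  assumes eq: "is_equilibrium Q \<mu>"
  shows "summable (\<lambda>k. (cmod (moment \<mu> k))\<^sup>2 / real k)"
proof (rule ccontr)
  assume n: "\<not> summable (\<lambda>k. (cmod (moment \<mu> k))\<^sup>2 / real k)"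
  have \<mu>: "circle_prob \<mu>" using eq by (simp add: is_equilibrium_def)
  have "(\<Sum>k. ennreal ((cmod (moment \<mu> k))\<^sup>2 / real k)) = \<infinity>"
  proof (rule ccontr)
    assume "(\<Sum>k. ennreal ((cmod (moment \<mu> k))\<^sup>2 / real k)) \<noteq> \<infinity>"
    then have "(\<Sum>k. ennreal ((cmod (moment \<mu> k))\<^sup>2 / real k)) \<noteq> top" unfolding infinity_ennreal_def .
    from summable_suminf_not_top[OF _ this] n show False by (metis divide_nonneg_nonneg of_nat_0_le_iff zero_le_power2)
  qed
  then have "energy Q \<mu> = \<infinity>" unfolding energy_eq[OF \<mu>] by simp
  moreover have "energy Q haar = ereal (\<integral>x. Q x \<partial>haar)"
  proof -
    have z: "(cmod (moment haar k))\<^sup>2 / real k = 0" for k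
      by (cases "k = 0") (simp_all add: moment_def integral_haar_power)
    show ?thesis unfolding energy_eq[OF circle_prob_haar] z by (simp add: zero_ennreal.rep_eq)
  qed
  moreover have "energy Q \<mu> \<le> energy Q haar" using eq circle_prob_haar by (simp add: is_equilibrium_def)
  ultimately show False by simp
qed

text \<open>Varying the measure by \<open>t Re (\<kappa> z\<^sup>k) d\<alpha>\<close> changes only the \<open>k\<close>-th moment, so that the
  energy is a quadratic polynomial in \<open>t\<close>; \<open>\<kappa>\<close> is chosen in the direction of steepest descent.\<close>

lemma equilibrium_moment:
  assumes Q: "continuous_on circle Q" and eq: "is_equilibrium Q \<mu>" and pos: "density_inf_pos \<mu>" and k: "0 < k"
  shows "moment \<mu> k = - of_nat k * (\<integral>z. of_real (Q z) * z ^ k \<partial>haar)"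
proof -
  have \<mu>: "circle_prob \<mu>" using eq by (simp add: is_equilibrium_def)
  obtain m c where m [measurable]: "m \<in> borel_measurable haar" and mi: "integrable haar m" and c: "0 < c"
    and cm: "AE z in haar. c \<le> m z" and \<mu>m: "\<mu> = density haar (\<lambda>z. ennreal (m z))"
    using density_inf_posE[OF \<mu> pos] .
  define q where "q = (\<integral>z. of_real (Q z) * z ^ k \<partial>haar)"
  \<comment> \<open>The residual of the criticality condition. If it were nonzero, the density
    \<open>- Re (cnj x * z ^ k)\<close> would be a direction of descent with slope
    \<open>- |x|^2\<close>.\<close>
  define x where "x = q + moment \<mu> k / of_nat k"
  have "x = 0"
  proof (rule ccontr)
    assume x: "x \<noteq> 0"
    define h where "h z = Re (poly (monom (- cnj x) k) z)" for z
    \<comment> \<open>\<open>t <= c / |x|\<close> keeps the perturbed density nonnegative;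
      \<open>t <= 1 < 4 k\<close> lets the linear term dominate the quadratic one.\<close>
    define t where "t = min 1 (c / cmod x)"
    have t: "0 < t" "t \<le> 1" "t * cmod x \<le> c"
    proof -
      show "0 < t" "t \<le> 1" using c x by (auto simp: t_def)
      have "t \<le> c / cmod x" by (simp add: t_def)
      then show "t * cmod x \<le> c" using x by (simp add: field_simps)
    qed
    have hc: "continuous_on circle h" unfolding h_def by (intro continuous_intros)
    have hm [measurable]: "h \<in> borel_measurable haar"
      by (rule circle_prob_measurable_continuous[OF circle_prob_haar hc])
    have hx: "\<bar>h z\<bar> \<le> cmod x" if "z \<in> circle" for z
    proof -
      have "\<bar>h z\<bar> \<le> cmod (poly (monom (- cnj x) k) z)" unfolding h_def by (rule abs_Re_le_cmod)
      then show ?thesis using that by (simp add: poly_monom norm_mult norm_power circle_iff)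
    qed
    have nn: "AE z in haar. 0 \<le> m z + t * h z"
    proof (rule AE_mp[OF cm], intro AE_I2 impI)
      fix z assume z: "z \<in> space haar" and cm: "c \<le> m z"
      have "\<bar>t * h z\<bar> \<le> t * cmod x" using hx[of z] z t by (simp add: abs_mult mult_left_mono)
      then show "0 \<le> m z + t * h z" using cm t(3) by linarith
    qed
    have nn0: "AE z in haar. 0 \<le> m z" using cm by (rule eventually_mono) (use c in simp)
    define \<nu> where "\<nu> = density haar (\<lambda>z. ennreal (m z + t * h z))"
    have mfi: "integrable haar (\<lambda>z. m z *\<^sub>R f z)" if f: "continuous_on circle f"
      for f :: "complex \<Rightarrow> 'b::{banach,second_countable_topology}"
    proof -
      obtain B where "0 < B" and B: "\<And>z. z \<in> circle \<Longrightarrow> norm (f z) \<le> B" using circle_bounded[OF f] by blast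
      have [measurable]: "f \<in> borel_measurable haar"
        by (rule circle_prob_measurable_continuous[OF circle_prob_haar f])
      show ?thesis
        by (rule Bochner_Integration.integrable_bound[of _ "\<lambda>z. B * m z"])
          (use mi B in \<open>auto intro!: AE_I2 mult_left_mono simp: abs_mult mult.commute[of B] abs_of_pos[OF \<open>0 < B\<close>]\<close>)
    qed
    have ints: "(\<integral>z. f z \<partial>\<nu>) = (\<integral>z. f z \<partial>\<mu>) + t *\<^sub>R (\<integral>z. h z *\<^sub>R f z \<partial>haar)" if f: "continuous_on circle f"
      for f :: "complex \<Rightarrow> 'b::{banach,second_countable_topology}"
    proof -
      have [measurable]: "f \<in> borel_measurable haar"
        by (rule circle_prob_measurable_continuous[OF circle_prob_haar f])
      have "(\<integral>z. f z \<partial>\<nu>) = (\<integral>z. (m z + t * h z) *\<^sub>R f z \<partial>haar)"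
        unfolding \<nu>_def by (rule integral_density) (use nn in measurable)
      also have "\<dots> = (\<integral>z. m z *\<^sub>R f z + t *\<^sub>R (h z *\<^sub>R f z) \<partial>haar)"
        by (simp add: scaleR_add_left)
      also have "\<dots> = (\<integral>z. m z *\<^sub>R f z \<partial>haar) + (\<integral>z. t *\<^sub>R (h z *\<^sub>R f z) \<partial>haar)"
        by (rule Bochner_Integration.integral_add)
          (intro mfi f circle_prob_integrable circle_prob_haar continuous_intros hc)+
      also have "(\<integral>z. m z *\<^sub>R f z \<partial>haar) = (\<integral>z. f z \<partial>\<mu>)"
        unfolding \<mu>m by (rule integral_density[symmetric]) (use nn0 in measurable)
      finally show ?thesis by (simp only: integral_scaleR_right)
    qed
    have mom: "moment \<nu> j = moment \<mu> j + (if j = k then of_real t * (- x) / 2 else 0)" if "0 < j" for j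
    proof -
      have "moment \<nu> j = moment \<mu> j + t *\<^sub>R (\<integral>z. h z *\<^sub>R z ^ j \<partial>haar)"
        unfolding moment_def by (rule ints) (intro continuous_intros)
      also have "(\<integral>z. h z *\<^sub>R z ^ j \<partial>haar) = (\<integral>z. z ^ j * of_real (Re (poly (monom (- cnj x) k) z)) \<partial>haar)"
        by (simp add: h_def scaleR_conv_of_real mult.commute)
      also have "\<dots> = cnj (coeff (monom (- cnj x) k) j) / 2"
        by (rule integral_haar_power_Re_poly[OF that])
      finally show ?thesis by (auto simp: scaleR_conv_of_real)
    qed
    have h0: "(\<integral>z. h z \<partial>haar) = 0"
    proof -
      have "(\<integral>z. h z \<partial>haar) = Re (\<integral>z. poly (monom (- cnj x) k) z \<partial>haar)"
        unfolding h_def by (rule integral_Re) (intro circle_prob_integrable circle_prob_haar continuous_intros)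
      then show ?thesis using k by (simp add: integral_haar_poly)
    qed
    have \<nu>: "circle_prob \<nu>"
    proof -
      have mh: "integrable haar (\<lambda>z. m z + t * h z)"
        by (intro Bochner_Integration.integrable_add mi integrable_mult_right circle_prob_integrable circle_prob_haar hc)
      have "(\<integral>z. m z \<partial>haar) = (\<integral>z. m z *\<^sub>R 1 \<partial>haar)" by simp
      also have "\<dots> = (\<integral>z. 1 \<partial>\<mu>)"
        unfolding \<mu>m by (rule integral_density[symmetric]) (use nn0 in measurable)
      also have "\<dots> = 1"
      proof -
        interpret prob_space \<mu> using \<mu> by (simp add: circle_prob_def)
        show ?thesis by (simp add: prob_space)
      qed
      finally have m1: "(\<integral>z. m z \<partial>haar) = 1" .
      have "emeasure \<nu> (space \<nu>) = (\<integral>\<^sup>+z. ennreal (m z + t * h z) \<partial>haar)"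
        unfolding \<nu>_def using sets.top[of haar] by (subst emeasure_density) (auto intro!: nn_integral_cong)
      also have "\<dots> = ennreal (\<integral>z. m z + t * h z \<partial>haar)"
        by (rule nn_integral_eq_integral[OF mh nn])
      also have "(\<integral>z. m z + t * h z \<partial>haar) = 1"
        using mi circle_prob_integrable[OF circle_prob_haar hc] m1 h0 by simp
      finally have "prob_space \<nu>" by (intro prob_spaceI) simp
      then show ?thesis by (simp add: circle_prob_def \<nu>_def)
    qed
    let ?a = "\<lambda>j. (cmod (moment \<mu> j))\<^sup>2 / real j"
    define b where "b = ((cmod (moment \<mu> k - of_real t * x / 2))\<^sup>2 - (cmod (moment \<mu> k))\<^sup>2) / real k"
    have a': "(cmod (moment \<nu> j))\<^sup>2 / real j = ?a j + (if j = k then b else 0)" for j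
      by (cases "j = 0") (use k in \<open>auto simp: mom b_def diff_divide_distrib\<close>)
    have as: "?a sums (\<Sum>j. ?a j)" by (rule summable_sums[OF equilibrium_summable[OF eq]])
    have a's: "(\<lambda>j. (cmod (moment \<nu> j))\<^sup>2 / real j) sums ((\<Sum>j. ?a j) + b)"
      unfolding a' by (intro sums_add as sums_single)
    have "energy Q \<mu> \<le> energy Q \<nu>" using eq \<nu> by (simp add: is_equilibrium_def)
    then have "(\<integral>z. Q z \<partial>\<mu>) + (\<Sum>j. ?a j) \<le> (\<integral>z. Q z \<partial>\<nu>) + ((\<Sum>j. ?a j) + b)"
      unfolding energy_real[OF \<mu> equilibrium_summable[OF eq]] energy_real[OF \<nu> sums_summable[OF a's]]
        sums_unique[OF a's, symmetric] by simp
    then have ge: "0 \<le> t * (\<integral>z. h z * Q z \<partial>haar) + b"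
      unfolding ints[OF Q] by simp
    have hQ: "(\<integral>z. h z * Q z \<partial>haar) = Re (- cnj x * q)"
    proof -
      have "(\<integral>z. h z * Q z \<partial>haar) = (\<integral>z. Re (- cnj x * (of_real (Q z) * z ^ k)) \<partial>haar)"
        by (simp add: h_def poly_monom algebra_simps)
      also have "\<dots> = Re (\<integral>z. - cnj x * (of_real (Q z) * z ^ k) \<partial>haar)"
        by (rule integral_Re) (intro circle_prob_integrable circle_prob_haar continuous_intros Q)
      finally show ?thesis by (simp only: q_def integral_mult_right_zero)
    qed
    have bb: "b = (- t * Re (cnj x * moment \<mu> k) + t\<^sup>2 * (cmod x)\<^sup>2 / 4) / real k"
    proof -
      have "(cmod (M - of_real t * x / 2))\<^sup>2 - (cmod M)\<^sup>2 = - t * Re (cnj x * M) + t\<^sup>2 * (cmod x)\<^sup>2 / 4" for M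
        unfolding cmod_power2 by (simp add: power2_eq_square field_simps)
      then show ?thesis unfolding b_def by simp
    qed
    have xx: "Re (cnj x * q) + Re (cnj x * moment \<mu> k) / real k = (cmod x)\<^sup>2"
    proof -
      have "complex_of_real ((cmod x)\<^sup>2) = cnj x * q + cnj x * moment \<mu> k / of_nat k"
        unfolding complex_norm_square by (subst x_def) (simp add: algebra_simps)
      from arg_cong[OF this, of Re] show ?thesis by (simp add: Re_divide_of_nat)
    qed
    have "t * (\<integral>z. h z * Q z \<partial>haar) + b = - t * (cmod x)\<^sup>2 + t * t * (cmod x)\<^sup>2 / (4 * real k)"
    proof -
      have "t * (- A) + (- t * B + t\<^sup>2 * X / 4) / real k = - t * (A + B / real k) + t * t * X / (4 * real k)" for A B X
        using k by (simp add: field_simps power2_eq_square)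
      from this[of "Re (cnj x * q)" "Re (cnj x * moment \<mu> k)" "(cmod x)\<^sup>2"] show ?thesis
        unfolding hQ bb xx mult_minus_left uminus_complex.sel .
    qed
    also have "\<dots> = t * (cmod x)\<^sup>2 * (t / (4 * real k) - 1)"
      by (simp add: field_simps)
    also have "\<dots> < 0"
    proof (rule mult_pos_neg)
      show "0 < t * (cmod x)\<^sup>2" using t x by simp
      have "t < 4 * real k" using t k by simp
      then show "t / (4 * real k) - 1 < 0" using k by (simp add: field_simps)
    qed
    finally show False using ge by simp
  qed
  then have "moment \<mu> k / of_nat k = - q" unfolding x_def by (metis add_eq_0_iff)
  moreover have "moment \<mu> k = of_nat k * (moment \<mu> k / of_nat k)" using k by simp
  ultimately have "moment \<mu> k = of_nat k * (- q)" by (simp only:)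
  then show ?thesis unfolding q_def by simp
qed

text \<open>The density enters the later arguments through three consequences: \<open>\<mu>\<close>
  dominates \<open>c\<close> times Haar measure on test functions, the criticality equations, and
  the absence of atoms.\<close>

locale equilibrium =
  fixes Q :: "complex \<Rightarrow> real" and \<mu> :: "complex measure" and c :: real
  assumes Q: "continuous_on circle Q" and eq: "is_equilibrium Q \<mu>" and c: "0 < c"
    and lower: "\<And>g. continuous_on circle g \<Longrightarrow> (\<And>z. z \<in> circle \<Longrightarrow> 0 \<le> g z)
      \<Longrightarrow> c * (\<integral>z. g z \<partial>haar) \<le> (\<integral>z. g z \<partial>\<mu>)"
    and moment: "\<And>k. 0 < k \<Longrightarrow> moment \<mu> k = - of_nat k * (\<integral>z. of_real (Q z) * z ^ k \<partial>haar)"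
    and atomless: "\<And>z. emeasure \<mu> {z} = 0"

lemma equilibriumI:
  assumes Q: "continuous_on circle Q" and eq: "is_equilibrium Q \<mu>" and pos: "density_inf_pos \<mu>"
  shows "\<exists>c. equilibrium Q \<mu> c"
proof -
  have \<mu>: "circle_prob \<mu>" using eq by (simp add: is_equilibrium_def)
  obtain m c where m [measurable]: "m \<in> borel_measurable haar" and mi: "integrable haar m" and c: "0 < c"
    and cm: "AE z in haar. c \<le> m z" and \<mu>m: "\<mu> = density haar (\<lambda>z. ennreal (m z))"
    using density_inf_posE[OF \<mu> pos] .
  have "equilibrium Q \<mu> c"
  proof
    fix g :: "complex \<Rightarrow> real" assume g: "continuous_on circle g" "\<And>z. z \<in> circle \<Longrightarrow> 0 \<le> g z"
    have [measurable]: "g \<in> borel_measurable haar"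
      by (rule circle_prob_measurable_continuous[OF circle_prob_haar g(1)])
    have nn: "AE z in haar. 0 \<le> m z" using cm by (rule eventually_mono) (use c in simp)
    obtain B where B0: "0 < B" and B: "\<And>z. z \<in> circle \<Longrightarrow> norm (g z) \<le> B" using circle_bounded[OF g(1)] by blast
    have "c * (\<integral>z. g z \<partial>haar) = (\<integral>z. c * g z \<partial>haar)" by simp
    also have "\<dots> \<le> (\<integral>z. m z *\<^sub>R g z \<partial>haar)"
    proof (rule integral_mono_AE)
      show "integrable haar (\<lambda>z. c * g z)"
        by (intro circle_prob_integrable circle_prob_haar continuous_intros g)
      show "integrable haar (\<lambda>z. m z *\<^sub>R g z)"
        by (rule Bochner_Integration.integrable_bound[of _ "\<lambda>z. B * m z"])
          (use mi B in \<open>auto intro!: AE_I2 mult_left_mono simp: abs_mult mult.commute[of B] abs_of_pos[OF B0]\<close>)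
      show "AE z in haar. c * g z \<le> m z *\<^sub>R g z"
        by (rule AE_mp[OF cm], intro AE_I2 impI) (auto intro!: mult_right_mono g)
    qed
    also have "\<dots> = (\<integral>z. g z \<partial>\<mu>)"
      unfolding \<mu>m by (rule integral_density[symmetric]) (use nn in measurable)
    finally show "c * (\<integral>z. g z \<partial>haar) \<le> (\<integral>z. g z \<partial>\<mu>)" .
  next
    fix z
    show "emeasure \<mu> {z} = 0"
    proof (cases "{z} \<in> sets haar")
      case True
      have "AE w in haar. ennreal (m w) * indicator {z} w = 0"
        using circle_AE_neq[of z] by (rule eventually_mono) auto
      moreover have "(\<lambda>w. ennreal (m w) * indicator {z} w) \<in> borel_measurable haar" using True by measurable
      ultimately have "(\<integral>\<^sup>+w. ennreal (m w) * indicator {z} w \<partial>haar) = 0"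
        by (simp only: nn_integral_0_iff_AE)
      then show ?thesis unfolding \<mu>m
        using True by (subst emeasure_density) auto
    next
      case False
      then show ?thesis by (intro emeasure_notin_sets) (simp add: \<mu>m)
    qed
  qed (fact Q eq c equilibrium_moment[OF Q eq pos])+
  then show ?thesis ..
qed

section \<open>Smoothing and perturbing the equilibrium measure\<close>

context equilibrium
begin

lemma \<mu>: "circle_prob \<mu>"
  using eq by (simp add: is_equilibrium_def)

definition perturbed :: "complex poly \<Rightarrow> nat \<Rightarrow> complex poly"
  where "perturbed d N = fejer N (moment \<mu>) + d"

text \<open>The value at \<open>w\<close> is the integral over \<open>\<mu>\<close> of a nonnegative
  kernel of Haar mass 1, so the lower bound of \<open>\<mu>\<close> passes to it unchanged, for
  every \<open>N\<close>.\<close>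

lemma fejer_lower: "w \<in> circle \<Longrightarrow> c \<le> Re (poly (fejer N (moment \<mu>)) w)"
proof -
  assume w: "w \<in> circle"
  let ?K = "\<lambda>z. (cmod (\<Sum>k\<le>N. (z * cnj w) ^ k))\<^sup>2 / real (Suc N)"
  have Kc: "continuous_on circle ?K" by (intro continuous_intros) auto
  have "c * (\<integral>z. ?K z \<partial>haar) \<le> (\<integral>z. ?K z \<partial>\<mu>)" by (rule lower[OF Kc]) auto
  also have "(\<integral>z. ?K z \<partial>\<mu>) = Re (poly (fejer N (moment \<mu>)) w)"
    using fejer_integral[OF \<mu> _ w, of "\<lambda>_. 1" N] by (simp add: moment_def[abs_def])
  finally show ?thesis unfolding integral_fejer_kernel[OF w] by simp
qed

lemma perturbed_poly_density:
  assumes "coeff d 0 = 0" "\<And>z. z \<in> circle \<Longrightarrow> \<bar>Re (poly d z)\<bar> \<le> c"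
  shows "poly_density (perturbed d N)"
proof
  show "0 \<le> Re (poly (perturbed d N) z)" if "z \<in> circle" for z
    using assms(2)[OF that] fejer_lower[OF that, of N] by (simp add: perturbed_def)
  show "Re (coeff (perturbed d N) 0) = 1"
    using assms(1) by (simp add: perturbed_def coeff_fejer fejer_factor_def moment_0[OF \<mu>])
qed

text \<open>Each moment converges; for measures of mass 1, uniform approximation by real parts of
  polynomials extends this to continuous \<open>\<phi>\<close>.\<close>

lemma weak_tendsto_0:
  fixes \<phi> :: "complex \<Rightarrow> real"
  assumes \<phi>: "continuous_on circle \<phi>"
  shows "(\<lambda>N. \<integral>z. \<phi> z \<partial>poly_measure (perturbed 0 N)) \<longlonglongrightarrow> (\<integral>z. \<phi> z \<partial>\<mu>)"
proof (rule LIMSEQ_I)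
  fix e :: real assume e: "0 < e"
  have pd: "poly_density (perturbed 0 N)" for N by (rule perturbed_poly_density) (use c in auto)
  let ?P = "\<lambda>N. poly_measure (perturbed 0 N)"
  have P: "circle_prob (?P N)" for N by (rule poly_density.circle_prob_poly_measure[OF pd])
  obtain p where p: "\<And>z. z \<in> circle \<Longrightarrow> \<bar>\<phi> z - Re (poly p z)\<bar> < e / 3"
    using circle_Stone_Weierstrass[OF \<phi>, of "e / 3"] e by auto
  have near: "\<bar>(\<integral>z. \<phi> z \<partial>\<nu>) - (\<integral>z. Re (poly p z) \<partial>\<nu>)\<bar> \<le> e / 3" if \<nu>: "circle_prob \<nu>" for \<nu>
  proof -
    interpret prob_space \<nu> using \<nu> by (simp add: circle_prob_def)
    have i: "integrable \<nu> \<phi>" "integrable \<nu> (\<lambda>z. Re (poly p z))" "integrable \<nu> (\<lambda>z. \<bar>\<phi> z - Re (poly p z)\<bar>)"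
      by (intro circle_prob_integrable \<nu> continuous_intros \<phi>)+
    have "\<bar>\<integral>z. \<phi> z - Re (poly p z) \<partial>\<nu>\<bar> \<le> (\<integral>z. \<bar>\<phi> z - Re (poly p z)\<bar> \<partial>\<nu>)" by (rule integral_abs_bound)
    also have "\<dots> \<le> (\<integral>z. e / 3 \<partial>\<nu>)"
      by (rule integral_mono[OF i(3)]) (use p in \<open>auto simp: circle_prob_space[OF \<nu>] intro: less_imp_le\<close>)
    finally show ?thesis using i by (simp add: prob_space)
  qed
  have rp: "(\<integral>z. Re (poly p z) \<partial>\<nu>) = Re (\<Sum>k\<le>degree p. coeff p k * moment \<nu> k)" if \<nu>: "circle_prob \<nu>" for \<nu>
  proof -
    have "(\<integral>z. Re (poly p z) \<partial>\<nu>) = Re (\<integral>z. poly p z \<partial>\<nu>)"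
      by (rule integral_Re) (intro circle_prob_integrable \<nu> continuous_intros)
    also have "(\<integral>z. poly p z \<partial>\<nu>) = (\<Sum>k\<le>degree p. coeff p k * moment \<nu> k)"
      using integral_poly[OF \<nu>, of "\<lambda>_. 1" p] by (simp add: moment_def)
    finally show ?thesis .
  qed
  have ml: "(\<lambda>N. moment (?P N) k) \<longlonglongrightarrow> moment \<mu> k" for k
  proof (cases "k = 0")
    case True then show ?thesis using moment_0 P \<mu> by simp
  next
    case False
    then have "(\<lambda>N. cnj (coeff (fejer N (moment \<mu>)) k) / 2) \<longlonglongrightarrow> cnj (2 * cnj (moment \<mu> k)) / 2"
      by (intro tendsto_intros coeff_fejer_tendsto) auto
    moreover have "moment (?P N) k = cnj (coeff (fejer N (moment \<mu>)) k) / 2" for N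
      using False poly_density.moment_poly_measure[OF pd, of k N] by (simp add: perturbed_def)
    ultimately show ?thesis by (simp only: complex_cnj_mult complex_cnj_cnj) simp
  qed
  have "(\<lambda>N. Re (\<Sum>k\<le>degree p. coeff p k * moment (?P N) k)) \<longlonglongrightarrow> Re (\<Sum>k\<le>degree p. coeff p k * moment \<mu> k)"
    by (intro tendsto_intros ml)
  then have "(\<lambda>N. \<integral>z. Re (poly p z) \<partial>?P N) \<longlonglongrightarrow> (\<integral>z. Re (poly p z) \<partial>\<mu>)"
    by (simp only: rp[OF P] rp[OF \<mu>])
  from LIMSEQ_D[OF this, of "e / 3"] e
  obtain N0 where N0: "\<And>N. N \<ge> N0 \<Longrightarrow> norm ((\<integral>z. Re (poly p z) \<partial>?P N) - (\<integral>z. Re (poly p z) \<partial>\<mu>)) < e / 3" by auto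
  show "\<exists>N0. \<forall>N\<ge>N0. norm ((\<integral>z. \<phi> z \<partial>?P N) - (\<integral>z. \<phi> z \<partial>\<mu>)) < e"
  proof (intro exI[of _ N0] allI impI)
    fix N assume "N0 \<le> N"
    from N0[OF this] near[OF P, of N] near[OF \<mu>]
    show "norm ((\<integral>z. \<phi> z \<partial>?P N) - (\<integral>z. \<phi> z \<partial>\<mu>)) < e" unfolding real_norm_def by linarith
  qed
qed

context
  fixes d :: "complex poly"
  assumes d0: "coeff d 0 = 0" and dc: "\<And>z. z \<in> circle \<Longrightarrow> \<bar>Re (poly d z)\<bar> \<le> c"
begin

lemma poly_density_perturbed: "poly_density (perturbed d N)"
  by (rule perturbed_poly_density[OF d0]) (rule dc)

lemma integral_perturbed:
  fixes \<phi> :: "complex \<Rightarrow> real"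
  assumes \<phi>: "continuous_on circle \<phi>"
  shows "(\<integral>z. \<phi> z \<partial>poly_measure (perturbed d N))
    = (\<integral>z. \<phi> z \<partial>poly_measure (perturbed 0 N)) + (\<integral>z. Re (poly d z) * \<phi> z \<partial>haar)"
proof -
  have pd0: "poly_density (perturbed 0 N)" by (rule perturbed_poly_density) (use c in auto)
  have i: "integrable haar (\<lambda>z. Re (poly (fejer N (moment \<mu>)) z) * \<phi> z)" "integrable haar (\<lambda>z. Re (poly d z) * \<phi> z)"
    by (intro circle_prob_integrable circle_prob_haar continuous_intros \<phi>)+
  show ?thesis
    unfolding poly_density.integral_poly_measure[OF poly_density_perturbed \<phi>]
      poly_density.integral_poly_measure[OF pd0 \<phi>]
    using i by (simp add: perturbed_def distrib_right)
qed

lemma weak_tendsto: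
  fixes \<phi> :: "complex \<Rightarrow> real"
  assumes \<phi>: "continuous_on circle \<phi>"
  shows "(\<lambda>N. \<integral>z. \<phi> z \<partial>poly_measure (perturbed d N)) \<longlonglongrightarrow> (\<integral>z. \<phi> z \<partial>\<mu>) + (\<integral>z. Re (poly d z) * \<phi> z \<partial>haar)"
  unfolding integral_perturbed[OF \<phi>] by (intro tendsto_intros weak_tendsto_0 \<phi>)

text \<open>The first-order change of the potential energy, rewritten by criticality so that it is
  visibly opposite to the cross term of the squared moments.\<close>

lemma integral_Q_perturbation:
  "(\<integral>z. Re (poly d z) * Q z \<partial>haar) = - (\<Sum>k\<le>degree d. Re (coeff d k * moment \<mu> k) / real k)"
proof -
  have "(\<integral>z. Re (poly d z) * Q z \<partial>haar) = (\<integral>z. Re (of_real (Q z) * poly d z) \<partial>haar)"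
    by (simp add: mult.commute)
  also have "\<dots> = Re (\<integral>z. of_real (Q z) * poly d z \<partial>haar)"
    by (rule integral_Re) (intro circle_prob_integrable circle_prob_haar continuous_intros Q)
  also have "(\<integral>z. of_real (Q z) * poly d z \<partial>haar) = (\<Sum>k\<le>degree d. coeff d k * (\<integral>z. of_real (Q z) * z ^ k \<partial>haar))"
    by (rule integral_poly[OF circle_prob_haar]) (intro continuous_intros Q)
  also have "Re \<dots> = (\<Sum>k\<le>degree d. - (Re (coeff d k * moment \<mu> k) / real k))"
    unfolding Re_sum
  proof (rule sum.cong[OF refl])
    fix k
    show "Re (coeff d k * (\<integral>z. of_real (Q z) * z ^ k \<partial>haar)) = - (Re (coeff d k * moment \<mu> k) / real k)"
    proof (cases "k = 0")
      case False
      have "coeff d k * moment \<mu> k = of_real (- real k) * (coeff d k * (\<integral>z. of_real (Q z) * z ^ k \<partial>haar))"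
        using moment[of k] False by simp
      then have "Re (coeff d k * moment \<mu> k) = - real k * Re (coeff d k * (\<integral>z. of_real (Q z) * z ^ k \<partial>haar))"
        by (simp only: Re_complex_of_real Im_complex_of_real times_complex.sel mult_zero_left diff_zero)
      then show ?thesis using False by simp
    qed (simp add: d0)
  qed
  finally show ?thesis by (simp add: sum_negf)
qed

text \<open>The gap is \<open>D N + Y N\<close>: \<open>Y N\<close> is the gap of the unperturbed
  Fejer mean, \<open>D N\<close> the effect of \<open>d\<close>. The latter involves a fixed finite
  set of coefficients, so its limit is taken term by term, and the terms linear in \<open>d\<close>
  cancel.\<close>

lemma energy_gap:
  obtains G where "\<And>N. energy Q (poly_measure (perturbed d N)) - energy Q \<mu> = ereal (G N)"
    "G \<longlonglongrightarrow> (\<Sum>k\<le>degree d. (cmod (coeff d k))\<^sup>2 / (4 * real k))"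
proof -
  let ?M = "moment \<mu>" let ?a = "\<lambda>N. coeff (fejer N ?M)"
  let ?S = "\<Sum>k. (cmod (?M k))\<^sup>2 / real k"
  have pd0: "poly_density (perturbed 0 N)" for N by (rule perturbed_poly_density) (use c in auto)
  note pd = poly_density_perturbed
  define D where "D N = (\<integral>z. Re (poly d z) * Q z \<partial>haar)
    + (\<Sum>k\<le>degree d. ((cmod (?a N k + coeff d k))\<^sup>2 - (cmod (?a N k))\<^sup>2) / (4 * real k))" for N
  define Y where "Y N = (\<integral>z. Q z \<partial>poly_measure (perturbed 0 N)) + (\<Sum>k\<le>N + degree d. (cmod (?a N k))\<^sup>2 / (4 * real k))
     - ((\<integral>z. Q z \<partial>\<mu>) + ?S)" for N
  note E\<mu> = energy_real[OF \<mu> equilibrium_summable[OF eq], of Q]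
  have deg: "degree (perturbed d N) \<le> N + degree d" "degree (perturbed 0 N) \<le> N + degree d" for N
    using degree_fejer_le[of N ?M] by (auto simp: perturbed_def intro!: degree_add_le)
  have E0: "energy Q (poly_measure (perturbed 0 N)) - energy Q \<mu> = ereal (Y N)" for N
    unfolding poly_density.energy_poly_measure[OF pd0 deg(2)] E\<mu> Y_def by (simp add: perturbed_def)
  have "energy Q (poly_measure (perturbed d N)) - energy Q \<mu> = ereal (D N + Y N)" for N
  proof -
    have "(\<Sum>k\<le>N + degree d. (cmod (?a N k + coeff d k))\<^sup>2 / (4 * real k))
      = (\<Sum>k\<le>N + degree d. (cmod (?a N k))\<^sup>2 / (4 * real k))
        + (\<Sum>k\<le>N + degree d. ((cmod (?a N k + coeff d k))\<^sup>2 - (cmod (?a N k))\<^sup>2) / (4 * real k))"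
      unfolding sum.distrib[symmetric] by (simp add: diff_divide_distrib)
    also have "(\<Sum>k\<le>N + degree d. ((cmod (?a N k + coeff d k))\<^sup>2 - (cmod (?a N k))\<^sup>2) / (4 * real k))
      = (\<Sum>k\<le>degree d. ((cmod (?a N k + coeff d k))\<^sup>2 - (cmod (?a N k))\<^sup>2) / (4 * real k))"
      by (rule sum.mono_neutral_right) (auto simp: coeff_eq_0)
    finally show ?thesis
      unfolding poly_density.energy_poly_measure[OF pd deg(1)] E\<mu> Y_def D_def integral_perturbed[OF Q]
      by (simp add: perturbed_def)
  qed
  moreover have "(\<lambda>N. D N + Y N) \<longlonglongrightarrow> (\<Sum>k\<le>degree d. (cmod (coeff d k))\<^sup>2 / (4 * real k)) + 0"
  proof (rule tendsto_add)
    have "((\<lambda>N. ((cmod (?a N k + coeff d k))\<^sup>2 - (cmod (?a N k))\<^sup>2) / (4 * real k))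
      \<longlonglongrightarrow> Re (coeff d k * ?M k) / real k + (cmod (coeff d k))\<^sup>2 / (4 * real k))" for k
    proof (cases "k = 0")
      case False
      have lim: "(\<lambda>N. ?a N k) \<longlonglongrightarrow> 2 * cnj (?M k)" using False by (intro coeff_fejer_tendsto) simp
      have "(\<lambda>N. ((cmod (?a N k + coeff d k))\<^sup>2 - (cmod (?a N k))\<^sup>2) / (4 * real k))
        \<longlonglongrightarrow> ((cmod (2 * cnj (?M k) + coeff d k))\<^sup>2 - (cmod (2 * cnj (?M k)))\<^sup>2) / (4 * real k)"
        by (intro tendsto_intros lim) (use False in simp)
      \<comment> \<open>After division by \<open>4 * real k\<close> the cross term is
        \<open>Re (coeff d k * ?M k) / k\<close>, the negative of its counterpart in
        \<open>integral_Q_perturbation\<close>.\<close>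
      moreover have "(cmod (2 * cnj u + v))\<^sup>2 - (cmod (2 * cnj u))\<^sup>2 = 4 * Re (v * u) + (cmod v)\<^sup>2" for u v
        unfolding cmod_power2 by (simp add: power2_eq_square algebra_simps)
      ultimately have "(\<lambda>N. ((cmod (?a N k + coeff d k))\<^sup>2 - (cmod (?a N k))\<^sup>2) / (4 * real k))
        \<longlonglongrightarrow> (4 * Re (coeff d k * ?M k) + (cmod (coeff d k))\<^sup>2) / (4 * real k)" by (simp only:)
      then show ?thesis by (simp only: add_divide_distrib mult_divide_mult_cancel_left_if) simp
    qed simp
    then have "D \<longlonglongrightarrow> (\<integral>z. Re (poly d z) * Q z \<partial>haar)
      + (\<Sum>k\<le>degree d. Re (coeff d k * ?M k) / real k + (cmod (coeff d k))\<^sup>2 / (4 * real k))"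
      unfolding D_def by (intro tendsto_intros)
    then show "D \<longlonglongrightarrow> (\<Sum>k\<le>degree d. (cmod (coeff d k))\<^sup>2 / (4 * real k))"
      unfolding integral_Q_perturbation by (simp add: sum.distrib)
    \<comment> \<open>Below, minimality gives 0. Above, the Fejer weights shrink all moments, so the
      logarithmic part cannot exceed that of \<open>\<mu>\<close>, and only the difference of the
      potential terms remains.\<close>
    show "Y \<longlonglongrightarrow> 0"
    proof (rule real_tendsto_sandwich)
      show "eventually (\<lambda>N. 0 \<le> Y N) sequentially"
      proof (rule always_eventually, rule allI)
        fix N
        have "energy Q \<mu> \<le> energy Q (poly_measure (perturbed 0 N))"
          using eq poly_density.circle_prob_poly_measure[OF pd0] by (simp add: is_equilibrium_def)
        then show "0 \<le> Y N" using E0[of N] unfolding E\<mu>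
          by (cases "energy Q (poly_measure (perturbed 0 N))") auto
      qed
      show "eventually (\<lambda>N. Y N \<le> (\<integral>z. Q z \<partial>poly_measure (perturbed 0 N)) - (\<integral>z. Q z \<partial>\<mu>)) sequentially"
      proof (rule always_eventually, rule allI)
        fix N
        have "(\<Sum>k\<le>N + degree d. (cmod (?a N k))\<^sup>2 / (4 * real k)) \<le> (\<Sum>k\<le>N + degree d. (cmod (?M k))\<^sup>2 / real k)"
        proof (rule sum_mono)
          fix k
          show "(cmod (?a N k))\<^sup>2 / (4 * real k) \<le> (cmod (?M k))\<^sup>2 / real k"
          proof (cases "0 < k \<and> k \<le> N")
            case True
            then have "0 \<le> fejer_factor N k" "fejer_factor N k \<le> 2" by (auto simp: fejer_factor_def field_simps)
            then have "cmod (?a N k) \<le> 2 * cmod (?M k)"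
              using True by (auto simp: coeff_fejer norm_mult intro!: mult_right_mono)
            then have "(cmod (?a N k))\<^sup>2 \<le> (2 * cmod (?M k))\<^sup>2" by (intro power_mono) auto
            then show ?thesis using True by (simp add: field_simps power_mult_distrib)
          qed (auto simp: coeff_fejer)
        qed
        also have "\<dots> \<le> ?S"
          by (rule sum_le_suminf[OF equilibrium_summable[OF eq]]) auto
        finally show "Y N \<le> (\<integral>z. Q z \<partial>poly_measure (perturbed 0 N)) - (\<integral>z. Q z \<partial>\<mu>)"
          by (simp add: Y_def)
      qed
      have "(\<lambda>N. (\<integral>z. Q z \<partial>poly_measure (perturbed 0 N)) - (\<integral>z. Q z \<partial>\<mu>)) \<longlonglongrightarrow> (\<integral>z. Q z \<partial>\<mu>) - (\<integral>z. Q z \<partial>\<mu>)"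
        by (intro tendsto_intros weak_tendsto_0 Q)
      then show "(\<lambda>N. (\<integral>z. Q z \<partial>poly_measure (perturbed 0 N)) - (\<integral>z. Q z \<partial>\<mu>)) \<longlonglongrightarrow> 0" by simp
    qed simp
  qed
  ultimately show thesis using that[of "\<lambda>N. D N + Y N"] by simp
qed

end

end

section \<open>Hilbert transform and Fisher information\<close>


lemma circle_Ck_has_vector_derivative:
  fixes \<phi> :: "complex \<Rightarrow> 'a::real_normed_vector"
  assumes "circle_Ck (Suc k) \<phi>"
  shows "((\<lambda>t. \<phi> (cis t)) has_vector_derivative circle_deriv \<phi> (cis t)) (at t)"
proof -
  have "(\<lambda>s. \<phi> (cis t * cis s)) differentiable at 0" using assms by simp
  then have D: "((\<lambda>s. \<phi> (cis t * cis s)) has_vector_derivative circle_deriv \<phi> (cis t)) (at (t - t))"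
    unfolding circle_deriv_def vector_derivative_works by simp
  have "((\<lambda>s. s - t) has_vector_derivative 1) (at t)"
    by (auto intro!: derivative_eq_intros)
  from vector_diff_chain_at[OF this D] show ?thesis by (simp add: o_def cis_mult)
qed

text \<open>\<open>circle_Ck\<close> of positive order speaks of differentiability along rotations,
  so continuity in \<open>z\<close> has to be recovered. Near \<open>cis t\<close> a continuous
  inverse of \<open>cis\<close> is \<open>t + Arg (w * cnj z)\<close>.\<close>

lemma continuous_on_circleI:
  fixes \<phi> :: "complex \<Rightarrow> 'a::real_normed_vector"
  assumes "\<And>t. isCont (\<lambda>t. \<phi> (cis t)) t"
  shows "continuous_on circle \<phi>"
  unfolding continuous_on_eq_continuous_within
proof
  fix z assume z: "z \<in> circle"
  then obtain t where t: "z = cis t" unfolding circle_eq_range_cis by blast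
  have zz: "z * cnj z = 1" by (rule circle_cnj_mult[OF z])
  have m: "isCont (\<lambda>w. w * cnj z) z" by (intro continuous_intros)
  have "isCont Arg (z * cnj z)" unfolding zz by (rule continuous_at_Arg) simp
  from isCont_o2[OF m this] have "isCont (\<lambda>w. t + Arg (w * cnj z)) z"
    by (rule isCont_add[OF continuous_const])
  then have "isCont (\<lambda>w. \<phi> (cis (t + Arg (w * cnj z)))) z"
    by (rule isCont_o2) (rule assms)
  then have c: "continuous (at z within circle) (\<lambda>w. \<phi> (cis (t + Arg (w * cnj z))))"
    by (rule continuous_at_imp_continuous_within)
  have e: "cis (t + Arg (w * cnj z)) = w" if "w \<in> circle" for w
  proof -
    have "cmod (w * cnj z) = 1" using that z by (simp add: circle_iff norm_mult)
    then have "cis (Arg (w * cnj z)) = w * cnj z" using rcis_cmod_Arg[of "w * cnj z"] by (simp add: rcis_def)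
    then have "cis (t + Arg (w * cnj z)) = w * (z * cnj z)" by (simp add: t flip: cis_mult)
    then show ?thesis using zz by simp
  qed
  show "continuous (at z within circle) \<phi>"
    using c by (rule continuous_transform_within[of _ _ _ 1]) (use z in \<open>auto simp: e\<close>)
qed

lemma circle_Ck_continuous:
  fixes \<phi> :: "complex \<Rightarrow> 'a::real_normed_vector"
  assumes "circle_Ck k \<phi>"
  shows "continuous_on circle \<phi>"
proof (cases k)
  case (Suc j)
  then have "circle_Ck (Suc j) \<phi>" using assms by simp
  then show ?thesis
    by (intro continuous_on_circleI has_vector_derivative_continuous[OF circle_Ck_has_vector_derivative])
qed (use assms in simp)

lemma integral_haar_derivative:
  fixes G :: "complex \<Rightarrow> 'a::euclidean_space"
  assumes D: "\<And>t. ((\<lambda>t. G (cis t)) has_vector_derivative G' (cis t)) (at t)" and c: "continuous_on circle G'"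
  shows "(\<integral>z. G' z \<partial>haar) = 0"
proof -
  have "((\<lambda>t. G' (cis t)) has_integral (G (cis (2 * pi)) - G (cis 0))) {0..2 * pi}"
    by (rule fundamental_theorem_of_calculus) (auto intro: has_vector_derivative_at_within D)
  then have "integral {0..2 * pi} (\<lambda>t. G' (cis t)) = 0" by (simp add: integral_unique)
  then show ?thesis unfolding integral_haar(1)[OF c] by simp
qed

text \<open>Integration by parts without boundary terms. With criticality it makes
  \<open>\<integral> Q' z^k d\<alpha>\<close> equal to \<open>\<i>\<close> times the
  \<open>k\<close>-th moment of \<open>\<mu>\<close> for \<open>k > 0\<close>: in Fourier terms,
  \<open>Q'\<close> is the Hilbert transform of \<open>\<mu>\<close>.\<close>

lemma integral_circle_deriv_power:
  fixes Q :: "complex \<Rightarrow> real"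
  assumes Q: "circle_Ck (Suc (Suc j)) Q"
  shows "(\<integral>z. of_real (circle_deriv Q z) * z ^ k \<partial>haar) = - \<i> * of_nat k * (\<integral>z. of_real (Q z) * z ^ k \<partial>haar)"
proof -
  have Qc: "continuous_on circle Q" by (rule circle_Ck_continuous[OF Q])
  have Q'c: "continuous_on circle (circle_deriv Q)" using Q by (intro circle_Ck_continuous[of "Suc j"]) simp
  have Qd: "((\<lambda>t. of_real (Q (cis t))) has_vector_derivative complex_of_real (circle_deriv Q (cis t))) (at t)" for t
    by (rule bounded_linear.has_vector_derivative[OF bounded_linear_of_real circle_Ck_has_vector_derivative[OF Q]])
  have zd: "((\<lambda>t. cis t ^ k) has_vector_derivative \<i> * of_nat k * cis t ^ k) (at t)" for t
    using poly_cis_vector_derivative[of "monom 1 k" 1 t]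
    by (simp add: poly_monom rot_deriv_def pderiv_monom) (cases k, auto simp: poly_monom mult_ac)
  have "(\<integral>z. of_real (circle_deriv Q z) * z ^ k + of_real (Q z) * (\<i> * of_nat k * z ^ k) \<partial>haar) = 0"
  proof (rule integral_haar_derivative[where G="\<lambda>z. of_real (Q z) * z ^ k"])
    fix t
    show "((\<lambda>t. complex_of_real (Q (cis t)) * cis t ^ k) has_vector_derivative
         of_real (circle_deriv Q (cis t)) * cis t ^ k + of_real (Q (cis t)) * (\<i> * of_nat k * cis t ^ k)) (at t)"
      using has_vector_derivative_mult[OF Qd zd, of t] by (simp only: add.commute)
  qed (intro continuous_intros Qc Q'c)
  moreover have "(\<integral>z. of_real (circle_deriv Q z) * z ^ k + of_real (Q z) * (\<i> * of_nat k * z ^ k) \<partial>haar)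
    = (\<integral>z. of_real (circle_deriv Q z) * z ^ k \<partial>haar) + (\<integral>z. \<i> * of_nat k * (of_real (Q z) * z ^ k) \<partial>haar)"
    by (subst Bochner_Integration.integral_add[symmetric])
      (auto intro!: circle_prob_integrable circle_prob_haar continuous_intros Qc Q'c simp: mult_ac)
  ultimately show ?thesis by (simp add: add_eq_0_iff)
qed

text \<open>Resolves the choice in \<open>smooth_density\<close>: the difference of two continuous
  densities has vanishing moments, hence vanishing Fejer means, and these converge to it.\<close>

lemma smooth_density_poly_measure:
  assumes pd: "poly_density a" and w: "w \<in> circle"
  shows "smooth_density (poly_measure a) w = Re (poly a w)"
proof -
  interpret poly_density a by (rule pd)
  define m where "m = smooth_density (poly_measure a)"
  have m: "is_smooth_density (poly_measure a) m"
    unfolding m_def smooth_density_def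
    by (rule someI[of "is_smooth_density (poly_measure a)", OF smooth_poly_measure])
  then have mc: "continuous_on circle m"
    by (metis circle_smooth_def circle_Ck.simps(1) is_smooth_density_def)
  define \<phi> where "\<phi> z = m z - Re (poly a z)" for z
  have \<phi>: "continuous_on circle \<phi>" unfolding \<phi>_def by (intro continuous_intros mc)
  have z: "(\<integral>z. of_real (\<phi> z) * z ^ k \<partial>haar) = 0" for k
  proof -
    have [measurable]: "m \<in> borel_measurable haar"
      by (rule circle_prob_measurable_continuous[OF circle_prob_haar mc])
    have nn: "AE z in haar. 0 \<le> m z" using m by (auto simp: is_smooth_density_def)
    have "(\<integral>z. z ^ k \<partial>poly_measure a) = (\<integral>z. m z *\<^sub>R z ^ k \<partial>haar)"
    proof -
      have "poly_measure a = density haar (\<lambda>z. ennreal (m z))" using m by (simp add: is_smooth_density_def)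
      moreover have "(\<lambda>z. z ^ k) \<in> borel_measurable haar"
        by (intro circle_prob_measurable_continuous circle_prob_haar continuous_intros)
      ultimately show ?thesis using nn by (simp add: integral_density)
    qed
    also have "(\<integral>z. z ^ k \<partial>poly_measure a) = (\<integral>z. Re (poly a z) *\<^sub>R z ^ k \<partial>haar)"
      by (rule integral_poly_measure) (intro continuous_intros)
    finally have "(\<integral>z. m z *\<^sub>R z ^ k - Re (poly a z) *\<^sub>R z ^ k \<partial>haar) = 0"
      by (subst Bochner_Integration.integral_diff)
        (auto intro!: circle_prob_integrable circle_prob_haar continuous_intros mc)
    then show ?thesis by (simp add: \<phi>_def scaleR_conv_of_real left_diff_distrib)
  qed
  have f0: "fejer N (\<lambda>_. 0) = 0" for N by (rule poly_eqI) (simp add: coeff_fejer)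
  have "\<bar>\<phi> w\<bar> \<le> e" if "0 < e" for e
    using eventually_happens[OF fejer_uniform[OF \<phi> that]] w unfolding z f0 by auto
  then have "\<bar>\<phi> w\<bar> \<le> 0" by (rule field_le_epsilon) simp
  then show ?thesis by (simp add: \<phi>_def m_def)
qed

section \<open>Conjugate kernels and the principal value\<close>

text \<open>This is \<open>cot (t / 2) * sin (k t)\<close> with the singularity at 0 removed; as a
  sum of cosines it has an elementary primitive.\<close>

definition conj_kernel :: "nat \<Rightarrow> real \<Rightarrow> real"
  where "conj_kernel k t = (\<Sum>j<k. cos (real j * t) + cos (real (Suc j) * t))"

text \<open>For \<open>j = 0\<close> the primitive of \<open>cos (j t)\<close> is \<open>t\<close>, not the junk value \<open>sin 0 / 0 = 0\<close>.\<close>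

definition conj_primitive :: "nat \<Rightarrow> real \<Rightarrow> real"
  where "conj_primitive k t =
    (\<Sum>j<k. (if j = 0 then t else sin (real j * t) / real j) + sin (real (Suc j) * t) / real (Suc j))"

lemma conj_kernel_eq: "sin (t / 2) * conj_kernel k t = cos (t / 2) * sin (real k * t)"
proof (induction k)
  case (Suc k)
  have "sin (t / 2) * (cos (real k * t) + cos (real (Suc k) * t))
    = cos (t / 2) * (sin (real (Suc k) * t) - sin (real k * t))"
  proof -
    define u where "u = real k * t + t / 2"
    have "real k * t = u - t / 2" "real (Suc k) * t = u + t / 2"
      by (simp_all add: u_def algebra_simps)
    then show ?thesis by (simp only: cos_diff cos_add sin_diff sin_add) (simp add: algebra_simps)
  qed
  then show ?case using Suc by (simp add: conj_kernel_def algebra_simps)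
qed (simp add: conj_kernel_def)

lemma conj_primitive_derivative:
  "(conj_primitive k has_vector_derivative conj_kernel k t) (at t within S)"
  unfolding conj_primitive_def[abs_def] conj_kernel_def has_real_derivative_iff_has_vector_derivative[symmetric]
proof (intro DERIV_sum DERIV_add)
  fix j
  show "((\<lambda>t. if j = 0 then t else sin (real j * t) / real j) has_real_derivative cos (real j * t)) (at t within S)"
    by (cases "j = 0") (auto intro!: derivative_eq_intros)
  show "((\<lambda>t. sin (real (Suc j) * t) / real (Suc j)) has_real_derivative cos (real (Suc j) * t)) (at t within S)"
    by (auto intro!: derivative_eq_intros simp del: of_nat_Suc)
qed

text \<open>All sines vanish at \<open>pi\<close>, so only the linear term is left. That the value
  is the same for all \<open>k > 0\<close> is why the Hilbert transform acts on each frequency with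
  modulus 1.\<close>

lemma conj_primitive_pi: "conj_primitive k pi = (if k = 0 then 0 else pi)"
proof (cases k)
  case (Suc n)
  have "conj_primitive k pi = (\<Sum>j<Suc n. if j = 0 then pi else 0)"
    unfolding conj_primitive_def Suc by (rule sum.cong) (auto simp del: of_nat_Suc)
  then show ?thesis using Suc by simp
qed (simp add: conj_primitive_def)

lemma conj_primitive_0: "conj_primitive k 0 = 0"
  unfolding conj_primitive_def by (rule sum.neutral) simp

lemma continuous_conj_primitive: "isCont (conj_primitive k) t"
  by (rule has_vector_derivative_continuous[OF conj_primitive_derivative])

lemma set_integral_reflect:
  fixes G :: "real \<Rightarrow> real"
  shows "(LBINT y:{x - b..x - a}. G y) = (LBINT t:{a..b}. G (x - t))"
    and "(LBINT y:{x + a..x + b}. G y) = (LBINT t:{a..b}. G (x + t))"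
proof -
  have "(LBINT y:{x - b..x - a}. G y) = (LBINT t. indicator {x - b..x - a} (x + (-1) * t) *\<^sub>R G (x + (-1) * t))"
    unfolding set_lebesgue_integral_def by (subst lborel_integral_real_affine[of "-1" _ x]) auto
  also have "\<dots> = (LBINT t:{a..b}. G (x - t))"
    unfolding set_lebesgue_integral_def by (rule Bochner_Integration.integral_cong) (auto simp: indicator_def)
  finally show "(LBINT y:{x - b..x - a}. G y) = (LBINT t:{a..b}. G (x - t))" .
  have "(LBINT y:{x + a..x + b}. G y) = (LBINT t. indicator {x + a..x + b} (x + 1 * t) *\<^sub>R G (x + 1 * t))"
    unfolding set_lebesgue_integral_def by (subst lborel_integral_real_affine[of "1" _ x]) auto
  also have "\<dots> = (LBINT t:{a..b}. G (x + t))"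
    unfolding set_lebesgue_integral_def by (rule Bochner_Integration.integral_cong) (auto simp: indicator_def)
  finally show "(LBINT y:{x + a..x + b}. G y) = (LBINT t:{a..b}. G (x + t))" .
qed

text \<open>Reflecting the left half of the punctured period onto the right half removes the singularity:
  \<open>cot (t/2) (h (x - t) - h (x + t))\<close> is a trigonometric polynomial in \<open>t\<close>.\<close>

lemma hilbert_transform_poly_measure:
  assumes pd: "poly_density a" and z: "z \<in> circle"
  shows "hilbert_transform (poly_measure a) z = Im (poly a z) - Im (coeff a 0)"
proof -
  define x where "x = Arg z"
  have zx: "cis x = z" using z rcis_cmod_Arg[of z] by (simp add: x_def circle_iff rcis_def)
  define h where "h y = Re (poly a (cis y))" for y
  define G where "G y = cot ((x - y) / 2) * h y / (2 * pi)" for y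
  define F where "F t = (\<Sum>k\<le>degree a. Im (coeff a k * z ^ k) / pi * conj_primitive k t)" for t
  define F' where "F' t = (\<Sum>k\<le>degree a. Im (coeff a k * z ^ k) / pi * conj_kernel k t)" for t
  have hc: "continuous_on S h" for S unfolding h_def
    by (intro continuous_intros continuous_on_compose2[OF continuous_on_circle_poly[of UNIV]]) auto
  have hdiff: "h (x - t) - h (x + t) = (\<Sum>k\<le>degree a. 2 * sin (real k * t) * Im (coeff a k * z ^ k))" for t
  proof -
    have "h (x - t) - h (x + t) = (\<Sum>k\<le>degree a. Re (coeff a k * (z * cis (- t)) ^ k) - Re (coeff a k * (z * cis t) ^ k))"
      unfolding h_def poly_altdef Re_sum sum_subtractf[symmetric] zx[symmetric] cis_mult by simp
    also have "\<dots> = (\<Sum>k\<le>degree a. 2 * sin (real k * t) * Im (coeff a k * z ^ k))"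
    proof (rule sum.cong[OF refl])
      fix k
      have "Re (u * cis (- s)) - Re (u * cis s) = 2 * sin s * Im u" for u s by simp
      from this[of "coeff a k * z ^ k" "real k * t"]
      show "Re (coeff a k * (z * cis (- t)) ^ k) - Re (coeff a k * (z * cis t) ^ k) = 2 * sin (real k * t) * Im (coeff a k * z ^ k)"
        by (simp only: power_mult_distrib Complex.DeMoivre mult.assoc mult_minus_right)
    qed
    finally show ?thesis .
  qed
  have GF: "G (x - t) + G (x + t) = F' t" if t: "0 < t" "t \<le> pi" for t
  proof -
    have s: "sin (t / 2) \<noteq> 0" using t by (intro less_imp_neq[symmetric] sin_gt_zero) auto
    have ck: "cot (t / 2) * sin (real k * t) = conj_kernel k t" for k
      using conj_kernel_eq[of t k] s by (simp add: cot_def field_simps)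
    have "(x - (x + t)) / 2 = - (t / 2)" "(x - (x - t)) / 2 = t / 2" by simp_all
    then have "G (x - t) + G (x + t) = cot (t / 2) * (h (x - t) - h (x + t)) / (2 * pi)"
      unfolding G_def by (simp only: cot_minus) (simp add: field_simps)
    also have "\<dots> = (\<Sum>k\<le>degree a. Im (coeff a k * z ^ k) / pi * (cot (t / 2) * sin (real k * t)))"
      unfolding hdiff sum_distrib_left sum_divide_distrib by (rule sum.cong) (auto simp: field_simps)
    finally show ?thesis unfolding F'_def ck .
  qed
  have Gc: "continuous_on {x - pi..x - e} G" "continuous_on {x + e..x + pi} G" if e: "0 < e" "e < pi" for e
  proof -
    have "sin ((x - y) / 2) \<noteq> 0" if y: "y \<in> {x - pi..x - e}" for y
      using y e by (intro less_imp_neq[symmetric] sin_gt_zero) auto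
    then show "continuous_on {x - pi..x - e} G"
      unfolding G_def cot_def by (intro continuous_intros hc) auto
    have "sin ((x - y) / 2) \<noteq> 0" if y: "y \<in> {x + e..x + pi}" for y
    proof -
      have "0 < sin ((y - x) / 2)" using y e by (intro sin_gt_zero) auto
      then show ?thesis by (metis minus_diff_eq minus_divide_left neg_0_equal_iff_equal order_less_irrefl sin_minus)
    qed
    then show "continuous_on {x + e..x + pi} G"
      unfolding G_def cot_def by (intro continuous_intros hc) auto
  qed
  have I: "(LBINT y:{x - pi..x - e} \<union> {x + e..x + pi}. G y) = F pi - F e" if e: "0 < e" "e < pi" for e
  proof -
    have i: "set_integrable lborel {x - pi..x - e} G" "set_integrable lborel {x + e..x + pi} G"
      unfolding set_integrable_def by (intro borel_integrable_compact Gc[OF e]; simp)+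
    have c1: "continuous_on {e..pi} (\<lambda>t. G (x - t))"
      by (rule continuous_on_compose2[OF Gc(1)[OF e]]) (auto intro!: continuous_intros)
    have c2: "continuous_on {e..pi} (\<lambda>t. G (x + t))"
      by (rule continuous_on_compose2[OF Gc(2)[OF e]]) (auto intro!: continuous_intros)
    have j: "set_integrable lborel {e..pi} (\<lambda>t. G (x - t))" "set_integrable lborel {e..pi} (\<lambda>t. G (x + t))"
      unfolding set_integrable_def by (intro borel_integrable_compact c1 c2; simp)+
    have "(LBINT y:{x - pi..x - e} \<union> {x + e..x + pi}. G y)
      = (LBINT t:{e..pi}. G (x - t)) + (LBINT t:{e..pi}. G (x + t))"
      unfolding set_integral_reflect[symmetric] by (rule set_integral_Un) (use e i in auto)
    also have "\<dots> = (LBINT t:{e..pi}. G (x - t) + G (x + t))"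
      by (rule set_integral_add(2)[symmetric]) (rule j)+
    also have "\<dots> = integral {e..pi} (\<lambda>t. G (x - t) + G (x + t))"
      by (intro set_borel_integral_eq_integral(2) set_integral_add(1) j)
    also have "\<dots> = integral {e..pi} F'"
      by (rule Henstock_Kurzweil_Integration.integral_cong) (use e GF in auto)
    also have "(F' has_integral (F pi - F e)) {e..pi}"
    proof (rule fundamental_theorem_of_calculus)
      fix t
      show "(F has_vector_derivative F' t) (at t within {e..pi})"
        unfolding F_def[abs_def] F'_def
        by (intro has_vector_derivative_sum has_vector_derivative_mult_right conj_primitive_derivative)
    qed (use e in simp)
    then have "integral {e..pi} F' = F pi - F e" by (rule integral_unique)
    finally show ?thesis .
  qed
  have F0: "F 0 = 0" by (simp add: F_def conj_primitive_0)
  have Fpi: "F pi = Im (poly a z) - Im (coeff a 0)"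
  proof -
    have "F pi = (\<Sum>k\<le>degree a. Im (coeff a k * z ^ k) - (if k = 0 then Im (coeff a 0) else 0))"
      unfolding F_def conj_primitive_pi by (rule sum.cong) auto
    then show ?thesis by (simp add: sum_subtractf poly_altdef)
  qed
  \<comment> \<open>The primitive is continuous at 0, so the truncated integrals
    \<open>F pi - F e\<close> converge and the principal value is \<open>F pi\<close>.\<close>
  have "isCont F 0" unfolding F_def by (intro continuous_intros continuous_conj_primitive)
  then have "(F \<longlongrightarrow> F 0) (at_right 0)" by (simp add: isCont_def filterlim_at_split)
  then have "((\<lambda>e. F pi - F e) \<longlongrightarrow> F pi - F 0) (at_right 0)" by (intro tendsto_intros)
  moreover have "eventually (\<lambda>e. F pi - F e = (LBINT y:{x - pi..x - e} \<union> {x + e..x + pi}. G y)) (at_right 0)"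
    using eventually_at_right_less[of "0::real"] eventually_at_rightI[of 0 pi "\<lambda>e. e < pi"]
    by (auto simp: I elim: eventually_elim2)
  ultimately have "((\<lambda>e. LBINT y:{x - pi..x - e} \<union> {x + e..x + pi}. G y) \<longlongrightarrow> F pi - F 0) (at_right 0)"
    by (rule Lim_transform_eventually)
  then have "Lim (at_right 0) (\<lambda>e. LBINT y:{x - pi..x - e} \<union> {x + e..x + pi}. G y) = F pi"
    unfolding F0 by (intro tendsto_Lim) auto
  moreover have "cot ((x - y) / 2) * smooth_density (poly_measure a) (cis y) / (2 * pi) = G y" for y
    by (simp add: G_def h_def smooth_density_poly_measure[OF pd])
  ultimately show ?thesis unfolding hilbert_transform_def Let_def x_def[symmetric] Fpi by simp
qed

section \<open>Limit of the Fisher information\<close>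

text \<open>For the perturbed measure \<open>H - Q'\<close> equals \<open>Im d + r N\<close>, where
  \<open>r N\<close> is the Fejer mean of \<open>Q'\<close> minus \<open>Q'\<close> and tends to 0
  uniformly. What is left is \<open>Im d\<close>, integrated against weakly convergent
  measures.\<close>

lemma (in equilibrium) fisher_tendsto:
  assumes QC: "circle_Ck (Suc (Suc j)) Q"
    and d0: "coeff d 0 = 0" and dc: "\<And>z. z \<in> circle \<Longrightarrow> \<bar>Re (poly d z)\<bar> \<le> c"
  shows "(\<lambda>N. fisher_info Q (poly_measure (perturbed d N)))
    \<longlonglongrightarrow> ((\<integral>z. (Im (poly d z))\<^sup>2 \<partial>\<mu>) + (\<integral>z. Re (poly d z) * (Im (poly d z))\<^sup>2 \<partial>haar))
      - ((\<integral>z. Im (poly d z) \<partial>\<mu>) + (\<integral>z. Re (poly d z) * Im (poly d z) \<partial>haar))\<^sup>2"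
proof -
  note pd = poly_density_perturbed[OF d0 dc]
  have pd: "poly_density (perturbed d N)" for N by (rule pd)
  let ?P = "\<lambda>N. poly_measure (perturbed d N)"
  have P: "circle_prob (?P N)" for N by (rule poly_density.circle_prob_poly_measure[OF pd])
  let ?Q' = "circle_deriv Q"
  have Q'c: "continuous_on circle ?Q'" using QC by (intro circle_Ck_continuous[of "Suc j"]) simp
  define \<psi> where "\<psi> z = Im (poly d z)" for z
  define r where "r N z = Im (poly (fejer N (moment \<mu>)) z) - ?Q' z" for N z
  have rc: "continuous_on circle (r N)" for N unfolding r_def by (intro continuous_intros Q'c)
  have \<psi>c: "continuous_on circle \<psi>" unfolding \<psi>_def by (intro continuous_intros)
  have H: "hilbert_transform (?P N) z = \<psi> z + r N z + ?Q' z" "hilbert_transform (?P N) z = Im (poly (perturbed d N) z)" if "z \<in> circle" for N z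
    using hilbert_transform_poly_measure[OF pd that, of N] d0
    by (simp_all add: perturbed_def \<psi>_def r_def coeff_fejer fejer_factor_def moment_0[OF \<mu>])
  have runi: "eventually (\<lambda>N. \<forall>w\<in>circle. \<bar>r N w\<bar> \<le> e) sequentially" if e: "0 < e" for e
  proof -
    \<comment> \<open>The two polynomials differ by the factor \<open>- \<i>\<close>, except that
      the mass of \<open>\<mu>\<close> leaves an imaginary constant, which the real part
      discards.\<close>
    have "Re (poly (fejer N (\<lambda>k. \<integral>z. ?Q' z * z ^ k \<partial>haar)) w) = Im (poly (fejer N (moment \<mu>)) w)" for N w
    proof -
      have "of_real (fejer_factor N k) * cnj (\<integral>z. ?Q' z * z ^ k \<partial>haar) * w ^ k
         = - \<i> * (of_real (fejer_factor N k) * cnj (moment \<mu> k) * w ^ k) + (if k = 0 then \<i> else 0)" for k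
        unfolding integral_circle_deriv_power[OF QC]
        by (cases "k = 0") (auto simp: moment moment_0[OF \<mu>] fejer_factor_def)
      note e = this
      have "poly (fejer N (\<lambda>k. \<integral>z. ?Q' z * z ^ k \<partial>haar)) w = - \<i> * poly (fejer N (moment \<mu>)) w + \<i>"
        unfolding fejer_def poly_sum poly_monom e sum.distrib sum_distrib_left by simp
      then show ?thesis by simp
    qed
    then show ?thesis using fejer_uniform[OF Q'c e] by (simp add: r_def)
  qed
  have small: "(\<lambda>N. \<integral>z. s N z \<partial>?P N) \<longlonglongrightarrow> 0"
    if sc: "\<And>N. continuous_on circle (s N)" and s: "\<And>e. 0 < e \<Longrightarrow> eventually (\<lambda>N. \<forall>w\<in>circle. \<bar>s N w\<bar> \<le> e) sequentially"
    for s :: "nat \<Rightarrow> complex \<Rightarrow> real"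
  proof (rule tendstoI)
    fix e :: real assume "0 < e"
    then have "eventually (\<lambda>N. \<forall>w\<in>circle. \<bar>s N w\<bar> \<le> e / 2) sequentially" by (intro s) simp
    then show "eventually (\<lambda>N. dist (\<integral>z. s N z \<partial>?P N) 0 < e) sequentially"
    proof (rule eventually_mono)
      fix N assume b: "\<forall>w\<in>circle. \<bar>s N w\<bar> \<le> e / 2"
      interpret prob_space "?P N" using P by (simp add: circle_prob_def)
      have "\<bar>\<integral>z. s N z \<partial>?P N\<bar> \<le> (\<integral>z. \<bar>s N z\<bar> \<partial>?P N)" by (rule integral_abs_bound)
      also have "\<dots> \<le> (\<integral>z. e / 2 \<partial>?P N)"
        by (rule integral_mono) (use b in \<open>auto simp: circle_prob_space[OF P] intro!: circle_prob_integrable P continuous_intros sc\<close>)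
      finally show "dist (\<integral>z. s N z \<partial>?P N) 0 < e" using \<open>0 < e\<close> by (simp add: prob_space)
    qed
  qed
  \<comment> \<open>Antisymmetry of the Hilbert transform: the integrand is
    \<open>Im (a^2) / 2\<close>, and \<open>a\<close> has constant coefficient 1.\<close>
  have mean0: "(\<integral>z. Im (poly (perturbed d N) z) \<partial>?P N) = 0" for N
  proof -
    let ?a = "perturbed d N"
    have "(\<integral>z. Im (poly ?a z) \<partial>?P N) = (\<integral>z. Re (poly ?a z) *\<^sub>R Im (poly ?a z) \<partial>haar)"
      by (rule poly_density.integral_poly_measure[OF pd]) (intro continuous_intros)
    also have "\<dots> = (\<integral>z. Im (poly (smult (1/2) (?a * ?a)) z) \<partial>haar)"
      by (simp add: mult.commute)
    also have "\<dots> = Im (\<integral>z. poly (smult (1/2) (?a * ?a)) z \<partial>haar)"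
      by (rule integral_Im) (intro circle_prob_integrable circle_prob_haar continuous_intros)
    also have "\<dots> = 0"
      unfolding integral_haar_poly
      using d0 by (simp add: coeff_mult perturbed_def coeff_fejer fejer_factor_def moment_0[OF \<mu>])
    finally show ?thesis .
  qed
  have fi: "fisher_info Q (?P N) = (\<integral>z. (\<psi> z)\<^sup>2 \<partial>?P N) + (\<integral>z. r N z * (2 * \<psi> z + r N z) \<partial>?P N)
      - ((\<integral>z. \<psi> z \<partial>?P N) + (\<integral>z. r N z \<partial>?P N))\<^sup>2" for N
  proof -
    have i: "integrable (?P N) \<psi>" "integrable (?P N) (r N)" "integrable (?P N) (\<lambda>z. (\<psi> z)\<^sup>2)"
      "integrable (?P N) (\<lambda>z. r N z * (2 * \<psi> z + r N z))" "integrable (?P N) ?Q'"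
      "integrable (?P N) (\<lambda>z. \<psi> z + r N z)" 
      by (intro circle_prob_integrable P continuous_intros \<psi>c rc Q'c)+
    have "(\<integral>z. (hilbert_transform (?P N) z - ?Q' z)\<^sup>2 \<partial>?P N) = (\<integral>z. (\<psi> z)\<^sup>2 + r N z * (2 * \<psi> z + r N z) \<partial>?P N)"
      by (rule Bochner_Integration.integral_cong[OF refl])
        (simp add: circle_prob_space[OF P] H(1) power2_eq_square algebra_simps)
    also have "\<dots> = (\<integral>z. (\<psi> z)\<^sup>2 \<partial>?P N) + (\<integral>z. r N z * (2 * \<psi> z + r N z) \<partial>?P N)"
      using i by simp
    finally have 1: "(\<integral>z. (hilbert_transform (?P N) z - ?Q' z)\<^sup>2 \<partial>?P N)
      = (\<integral>z. (\<psi> z)\<^sup>2 \<partial>?P N) + (\<integral>z. r N z * (2 * \<psi> z + r N z) \<partial>?P N)" .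
    \<comment> \<open>As \<open>H\<close> has mean 0, the mean of \<open>Q'\<close> is minus the
      mean of \<open>H - Q'\<close>. The squared mean in \<open>fisher_info\<close> is thus the one
      that completes a variance.\<close>
    have "0 = (\<integral>z. Im (poly (perturbed d N) z) \<partial>?P N)" by (simp add: mean0)
    also have "\<dots> = (\<integral>z. \<psi> z + r N z + ?Q' z \<partial>?P N)"
      by (rule Bochner_Integration.integral_cong[OF refl])
        (simp add: circle_prob_space[OF P] H(1)[symmetric] H(2))
    also have "\<dots> = (\<integral>z. \<psi> z \<partial>?P N) + (\<integral>z. r N z \<partial>?P N) + (\<integral>z. ?Q' z \<partial>?P N)"
      using i by simp
    finally have "(\<integral>z. ?Q' z \<partial>?P N) = - ((\<integral>z. \<psi> z \<partial>?P N) + (\<integral>z. r N z \<partial>?P N))" by simp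
    then show ?thesis unfolding fisher_info_def 1 by (simp only: power2_minus)
  qed
  obtain B where B: "0 < B" "\<And>z. z \<in> circle \<Longrightarrow> \<bar>\<psi> z\<bar> \<le> B" using circle_bounded[OF \<psi>c] by auto
  have r2: "eventually (\<lambda>N. \<forall>w\<in>circle. \<bar>r N w * (2 * \<psi> w + r N w)\<bar> \<le> e) sequentially" if e: "0 < e" for e
  proof -
    \<comment> \<open>The cap at 1 bounds the factor \<open>2 * \<psi> + r N\<close> by
      \<open>2 * B + 1\<close>.\<close>
    define \<eta> where "\<eta> = min 1 (e / (2 * B + 1))"
    have \<eta>: "0 < \<eta>" "\<eta> \<le> 1" "\<eta> * (2 * B + 1) \<le> e"
    proof -
      show "0 < \<eta>" "\<eta> \<le> 1" using e B by (auto simp: \<eta>_def)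
      have "\<eta> \<le> e / (2 * B + 1)" by (simp add: \<eta>_def)
      then show "\<eta> * (2 * B + 1) \<le> e" using B by (simp add: pos_le_divide_eq)
    qed
    show ?thesis using runi[OF \<eta>(1)]
    proof (rule eventually_mono, intro ballI)
      fix N w assume w: "w \<in> circle" and "\<forall>w\<in>circle. \<bar>r N w\<bar> \<le> \<eta>"
      then have r: "\<bar>r N w\<bar> \<le> \<eta>" by simp
      have "\<bar>r N w\<bar> * \<bar>2 * \<psi> w + r N w\<bar> \<le> \<eta> * (2 * B + 1)"
        by (rule mult_mono) (use r B(2)[OF w] \<eta> in auto)
      then show "\<bar>r N w * (2 * \<psi> w + r N w)\<bar> \<le> e" using \<eta>(3) by (simp add: abs_mult)
    qed
  qed
  have "(\<lambda>N. fisher_info Q (?P N)) \<longlonglongrightarrow> ((\<integral>z. (\<psi> z)\<^sup>2 \<partial>\<mu>) + (\<integral>z. Re (poly d z) * (\<psi> z)\<^sup>2 \<partial>haar)) + 0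
      - (((\<integral>z. \<psi> z \<partial>\<mu>) + (\<integral>z. Re (poly d z) * \<psi> z \<partial>haar)) + 0)\<^sup>2"
    unfolding fi
    by (intro tendsto_intros weak_tendsto[OF d0 dc] small runi r2 rc continuous_intros \<psi>c)
  then show ?thesis by (simp add: \<psi>_def)
qed

section \<open>The Douglas formula\<close>


text \<open>By Parseval, the coefficient of index \<open>k\<close> contributes to the shifts by
  \<open>1, ..., k\<close> and to no others, which is the weight \<open>k\<close>.\<close>

lemma integral_norm_poly_shift:
  assumes "degree p \<le> n"
  shows "(\<Sum>j<n. \<integral>w. (cmod (poly (poly_shift (Suc j) p) w))\<^sup>2 \<partial>haar) = (\<Sum>k\<le>n. real k * (cmod (coeff p k))\<^sup>2)"
proof -
  let ?g = "\<lambda>k. (cmod (coeff p k))\<^sup>2"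
  have "(\<integral>w. (cmod (poly (poly_shift (Suc j) p) w))\<^sup>2 \<partial>haar) = (\<Sum>k\<le>n. if j < k then ?g k else 0)" for j
  proof -
    let ?q = "poly_shift (Suc j) p"
    have "(\<integral>w. (cmod (poly ?q w))\<^sup>2 \<partial>haar) = (\<Sum>i\<le>degree ?q. ?g (i + Suc j))"
      by (simp add: integral_haar_norm_poly coeff_poly_shift)
    also have "\<dots> = (\<Sum>i\<le>n + degree ?q. ?g (i + Suc j))"
    proof (rule sum.mono_neutral_left)
      show "\<forall>i\<in>{..n + degree ?q} - {..degree ?q}. ?g (i + Suc j) = 0"
        using coeff_eq_0[of ?q] by (auto simp: coeff_poly_shift)
    qed auto
    also have "\<dots> = (\<Sum>k\<in>{Suc j..n + degree ?q + Suc j}. ?g k)"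
      by (rule sum.reindex_bij_witness[of _ "\<lambda>k. k - Suc j" "\<lambda>i. i + Suc j"]) auto
    also have "\<dots> = (\<Sum>k\<in>{k. k \<le> n \<and> j < k}. ?g k)"
      by (rule sum.mono_neutral_right) (use assms in \<open>auto intro: order_trans[OF le_degree]\<close>)
    also have "\<dots> = (\<Sum>k\<le>n. if j < k then ?g k else 0)"
      by (subst sum.inter_filter[symmetric]) auto
    finally show ?thesis .
  qed
  then have "(\<Sum>j<n. \<integral>w. (cmod (poly (poly_shift (Suc j) p) w))\<^sup>2 \<partial>haar) = (\<Sum>k\<le>n. \<Sum>j<n. if j < k then ?g k else 0)"
    by (simp add: sum.swap[of _ "{..<n}"])
  also have "\<dots> = (\<Sum>k\<le>n. real k * ?g k)"
  proof (rule sum.cong[OF refl])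
    fix k assume "k \<in> {..n}"
    then have "{j. j < n \<and> j < k} = {..<k}" by auto
    moreover have "(\<Sum>j<n. if j < k then ?g k else 0) = (\<Sum>j\<in>{j\<in>{..<n}. j < k}. ?g k)"
      by (rule sum.inter_filter[symmetric]) simp
    ultimately show "(\<Sum>j<n. if j < k then ?g k else 0) = real k * ?g k" by simp
  qed
  finally show ?thesis .
qed

lemma circle_diff_square:
  assumes "z \<in> circle" "w \<in> circle"
  shows "(z - w)\<^sup>2 = - z * w * of_real ((cmod (z - w))\<^sup>2)"
proof -
  have "z * w * ((z - w) * (cnj z - cnj w)) = (z - w) * (w * (z * cnj z) - z * (w * cnj w))"
    by (simp add: algebra_simps)
  also have "\<dots> = - (z - w)\<^sup>2"
    using circle_cnj_mult[OF assms(1)] circle_cnj_mult[OF assms(2)] by (simp add: power2_eq_square algebra_simps)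
  finally show ?thesis
    unfolding complex_norm_square complex_cnj_diff by simp
qed

text \<open>Writing \<open>p(z) - p(w) = (z - w) S(z)\<close>, the square of the real part splits as
  \<open>|z - w|\<^sup>2 (|S|\<^sup>2 - Re (z w S\<^sup>2)) / 2\<close> because \<open>(z - w)\<^sup>2 = - z w |z - w|\<^sup>2\<close>; the second summand
  is a polynomial in \<open>z\<close> without constant term and integrates to 0.\<close>

lemma douglas_poly:
  "(\<integral>\<^sup>+w. \<integral>\<^sup>+z. ennreal (((Re (poly p z) - Re (poly p w)) / cmod (z - w))\<^sup>2) \<partial>haar \<partial>haar)
    = ennreal ((\<Sum>k\<le>degree p. real k * (cmod (coeff p k))\<^sup>2) / 2)"
proof -
  \<comment> \<open>The successor makes \<open>n\<close> positive also for constant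
    \<open>p\<close>, as the factorization of \<open>p(z) - p(w)\<close> requires.\<close>
  define n where "n = Suc (degree p)"
  have dn: "degree p \<le> n" by (simp add: n_def)
  \<comment> \<open>The quotient of \<open>p(z) - p(w)\<close> by \<open>z - w\<close> as a
    polynomial in \<open>z\<close>; its coefficients are shifted copies of \<open>p\<close>
    evaluated at \<open>w\<close>.\<close>
  define S where "S w = (\<Sum>j<n. monom (poly (poly_shift (Suc j) p) w) j)" for w
  have coeffS: "coeff (S w) j = (if j < n then poly (poly_shift (Suc j) p) w else 0)" for w j
    unfolding S_def coeff_sum by (auto simp: if_distrib cong: if_cong)
  have pn: "poly p x = (\<Sum>i\<le>n. coeff p i * x ^ i)" for x
    unfolding poly_altdef by (rule sum.mono_neutral_left) (use dn in \<open>auto simp: coeff_eq_0\<close>)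
  have shift: "poly (poly_shift (Suc j) p) w = (\<Sum>k<n - j. coeff p (j + k + 1) * w ^ k)" if j: "j < n" for j w
  proof -
    let ?q = "poly_shift (Suc j) p"
    have "degree ?q \<le> n - j - 1"
      by (rule degree_le) (use j dn in \<open>auto simp: coeff_poly_shift intro!: coeff_eq_0\<close>)
    then have "poly ?q w = (\<Sum>k<n - j. coeff ?q k * w ^ k)"
      unfolding poly_altdef by (intro sum.mono_neutral_left) (use j in \<open>auto intro!: coeff_eq_0\<close>)
    then show ?thesis by (simp add: coeff_poly_shift add_ac)
  qed
  have diff: "poly p z - poly p w = (z - w) * poly (S w) z" for z w
  proof -
    have "poly p z - poly p w = (z - w) * (\<Sum>j<n. \<Sum>k<n - j. coeff p (j + k + 1) * w ^ k * z ^ j)"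
      unfolding pn by (rule polyfun_diff_alt) (simp add: n_def)
    also have "(\<Sum>j<n. \<Sum>k<n - j. coeff p (j + k + 1) * w ^ k * z ^ j) = poly (S w) z"
      unfolding S_def poly_sum poly_monom by (rule sum.cong) (auto simp: shift sum_distrib_right)
    finally show ?thesis .
  qed
  have pt: "((Re (poly p z) - Re (poly p w)) / cmod (z - w))\<^sup>2
      = ((cmod (poly (S w) z))\<^sup>2 - Re (poly (pCons 0 (smult w (S w * S w))) z)) / 2"
    if z: "z \<in> circle" and w: "w \<in> circle" and ne: "z \<noteq> w" for z w
  proof -
    define u where "u = (z - w) * poly (S w) z"
    have "(Re (poly p z) - Re (poly p w))\<^sup>2 = (Re u)\<^sup>2" using diff[of z w] by (simp add: u_def flip: minus_complex.sel)
    also have "\<dots> = ((cmod u)\<^sup>2 + Re (u\<^sup>2)) / 2" unfolding cmod_power2 by (simp add: power2_eq_square)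
    also have "u\<^sup>2 = - of_real ((cmod (z - w))\<^sup>2) * poly (pCons 0 (smult w (S w * S w))) z"
      unfolding u_def power_mult_distrib circle_diff_square[OF z w] by (simp add: power2_eq_square mult_ac)
    also have "Re \<dots> = - (cmod (z - w))\<^sup>2 * Re (poly (pCons 0 (smult w (S w * S w))) z)"
      by (simp only: mult_minus_left uminus_complex.sel Re_complex_of_real Im_complex_of_real times_complex.sel mult_zero_left diff_zero)
    also have "(cmod u)\<^sup>2 = (cmod (z - w))\<^sup>2 * (cmod (poly (S w) z))\<^sup>2"
      by (simp add: u_def norm_mult power_mult_distrib)
    finally show ?thesis using ne by (simp add: power_divide field_simps)
  qed
  have "(\<integral>\<^sup>+z. ennreal (((Re (poly p z) - Re (poly p w)) / cmod (z - w))\<^sup>2) \<partial>haar)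
      = ennreal ((\<Sum>j<n. (cmod (poly (poly_shift (Suc j) p) w))\<^sup>2) / 2)" if w: "w \<in> circle" for w
  proof -
    let ?f = "\<lambda>z. ((Re (poly p z) - Re (poly p w)) / cmod (z - w))\<^sup>2"
    let ?h = "\<lambda>z. ((cmod (poly (S w) z))\<^sup>2 - Re (poly (pCons 0 (smult w (S w * S w))) z)) / 2"
    have fh: "AE z in haar. ?f z = ?h z"
    proof (rule AE_mp[OF circle_AE_neq[of w]], intro AE_I2 impI)
      fix z assume "z \<in> space haar" "z \<noteq> w"
      then show "?f z = ?h z" using pt[of z w] w by simp
    qed
    have hi: "integrable haar ?h"
      by (intro circle_prob_integrable circle_prob_haar continuous_intros) auto
    have "(\<integral>\<^sup>+z. ennreal (?f z) \<partial>haar) = (\<integral>\<^sup>+z. ennreal (?h z) \<partial>haar)"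
      by (rule nn_integral_cong_AE, rule eventually_mono[OF fh]) (rule arg_cong)
    \<comment> \<open>Nonnegativity of \<open>?h\<close> is inherited from the square with which it
      agrees off the null set \<open>z = w\<close>.\<close>
    also have "\<dots> = ennreal (\<integral>z. ?h z \<partial>haar)"
      by (rule nn_integral_eq_integral[OF hi], rule eventually_mono[OF fh]) (metis zero_le_power2)
    also have "(\<integral>z. ?h z \<partial>haar)
      = ((\<integral>z. (cmod (poly (S w) z))\<^sup>2 \<partial>haar) - (\<integral>z. Re (poly (pCons 0 (smult w (S w * S w))) z) \<partial>haar)) / 2"
    proof -
      have "integrable haar (\<lambda>z. (cmod (poly (S w) z))\<^sup>2)" "integrable haar (\<lambda>z. Re (poly (pCons 0 (smult w (S w * S w))) z))"
        by (intro circle_prob_integrable circle_prob_haar continuous_intros)+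
      from Bochner_Integration.integral_diff[OF this] show ?thesis by (simp only: integral_divide_zero)
    qed
    also have "(\<integral>z. Re (poly (pCons 0 (smult w (S w * S w))) z) \<partial>haar) = Re (\<integral>z. poly (pCons 0 (smult w (S w * S w))) z \<partial>haar)"
      by (rule integral_Re) (intro circle_prob_integrable circle_prob_haar continuous_intros)
    also have "\<dots> = 0" unfolding integral_haar_poly by simp
    also have "(\<integral>z. (cmod (poly (S w) z))\<^sup>2 \<partial>haar) = (\<Sum>j\<le>degree (S w). (cmod (coeff (S w) j))\<^sup>2)"
      by (rule integral_haar_norm_poly)
    also have "\<dots> = (\<Sum>j\<le>n + degree (S w). (cmod (coeff (S w) j))\<^sup>2)"
      by (rule sum.mono_neutral_left) (auto simp: coeff_eq_0)
    also have "\<dots> = (\<Sum>j<n. (cmod (coeff (S w) j))\<^sup>2)"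
      by (rule sum.mono_neutral_right) (auto simp: coeffS)
    also have "\<dots> = (\<Sum>j<n. (cmod (poly (poly_shift (Suc j) p) w))\<^sup>2)"
      by (rule sum.cong) (auto simp: coeffS)
    finally show ?thesis by simp
  qed
  then have "(\<integral>\<^sup>+w. \<integral>\<^sup>+z. ennreal (((Re (poly p z) - Re (poly p w)) / cmod (z - w))\<^sup>2) \<partial>haar \<partial>haar)
    = (\<integral>\<^sup>+w. ennreal ((\<Sum>j<n. (cmod (poly (poly_shift (Suc j) p) w))\<^sup>2) / 2) \<partial>haar)"
    by (intro nn_integral_cong) simp
  also have "\<dots> = ennreal (\<integral>w. (\<Sum>j<n. (cmod (poly (poly_shift (Suc j) p) w))\<^sup>2) / 2 \<partial>haar)"
    by (rule nn_integral_eq_integral)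
      (auto intro!: circle_prob_integrable circle_prob_haar continuous_intros sum_nonneg divide_nonneg_nonneg)
  also have "(\<integral>w. (\<Sum>j<n. (cmod (poly (poly_shift (Suc j) p) w))\<^sup>2) / 2 \<partial>haar)
    = (\<Sum>j<n. \<integral>w. (cmod (poly (poly_shift (Suc j) p) w))\<^sup>2 \<partial>haar) / 2"
    by (simp only: integral_divide_zero, subst Bochner_Integration.integral_sum)
      (auto intro!: circle_prob_integrable circle_prob_haar continuous_intros)
  also have "\<dots> = (\<Sum>k\<le>n. real k * (cmod (coeff p k))\<^sup>2) / 2"
    by (simp only: integral_norm_poly_shift[OF dn])
  also have "(\<Sum>k\<le>n. real k * (cmod (coeff p k))\<^sup>2) = (\<Sum>k\<le>degree p. real k * (cmod (coeff p k))\<^sup>2)"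
    by (rule sum.mono_neutral_right) (auto simp: n_def coeff_eq_0)
  finally show ?thesis .
qed

section \<open>From polynomials to smooth functions\<close>

definition var :: "complex measure \<Rightarrow> (complex \<Rightarrow> real) \<Rightarrow> real"
  where "var \<mu> g = (\<integral>z. (g z)\<^sup>2 \<partial>\<mu>) - (\<integral>z. g z \<partial>\<mu>)\<^sup>2"

lemma var_nonneg:
  assumes "circle_prob \<mu>" "continuous_on circle g"
  shows "0 \<le> var \<mu> g"
proof -
  interpret prob_space \<mu> using assms by (simp add: circle_prob_def)
  have "0 \<le> (\<integral>z. (g z - (\<integral>z. g z \<partial>\<mu>))\<^sup>2 \<partial>\<mu>)" by simp
  also have "\<dots> = var \<mu> g"
    unfolding var_def by (rule variance_eq) (intro circle_prob_integrable assms continuous_intros)+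
  finally show ?thesis .
qed

lemma integral_close:
  fixes f g :: "complex \<Rightarrow> real"
  assumes \<mu>: "circle_prob \<mu>" and f: "continuous_on circle f" and g: "continuous_on circle g"
    and e: "\<And>z. z \<in> circle \<Longrightarrow> \<bar>f z - g z\<bar> \<le> e"
  shows "\<bar>(\<integral>z. f z \<partial>\<mu>) - (\<integral>z. g z \<partial>\<mu>)\<bar> \<le> e"
proof -
  interpret prob_space \<mu> using \<mu> by (simp add: circle_prob_def)
  have "(\<integral>z. f z \<partial>\<mu>) - (\<integral>z. g z \<partial>\<mu>) = (\<integral>z. f z - g z \<partial>\<mu>)"
    by (rule Bochner_Integration.integral_diff[symmetric]) (intro circle_prob_integrable \<mu> f g)+
  also have "\<bar>\<dots>\<bar> \<le> (\<integral>z. \<bar>f z - g z\<bar> \<partial>\<mu>)" by (rule integral_abs_bound)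
  also have "\<dots> \<le> (\<integral>z. e \<partial>\<mu>)"
    by (rule integral_mono) (auto simp: circle_prob_space[OF \<mu>] intro!: circle_prob_integrable \<mu> continuous_intros f g e)
  finally show ?thesis by (simp add: prob_space)
qed

lemma var_tendsto:
  assumes \<mu>: "circle_prob \<mu>" and g: "continuous_on circle g" and u: "\<And>n. continuous_on circle (u n)"
    and b: "\<And>n z. z \<in> circle \<Longrightarrow> \<bar>u n z - g z\<bar> \<le> b n" and b0: "b \<longlonglongrightarrow> 0"
  shows "(\<lambda>n. var \<mu> (u n)) \<longlonglongrightarrow> var \<mu> g"
proof -
  obtain B where B: "0 < B" "\<And>z. z \<in> circle \<Longrightarrow> \<bar>g z\<bar> \<le> B" using circle_bounded[OF g] by auto
  have "(\<lambda>n. (\<integral>z. u n z \<partial>\<mu>) - (\<integral>z. g z \<partial>\<mu>)) \<longlonglongrightarrow> 0"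
    by (rule Lim_null_comparison[OF _ b0]) (use integral_close[OF \<mu> u g b] in auto)
  then have 1: "(\<lambda>n. \<integral>z. u n z \<partial>\<mu>) \<longlonglongrightarrow> (\<integral>z. g z \<partial>\<mu>)" by (rule LIM_zero_cancel)
  have sq: "\<bar>(u n z)\<^sup>2 - (g z)\<^sup>2\<bar> \<le> b n * (b n + 2 * B)" if z: "z \<in> circle" for n z
  proof -
    have "\<bar>(u n z)\<^sup>2 - (g z)\<^sup>2\<bar> = \<bar>u n z - g z\<bar> * \<bar>u n z + g z\<bar>"
      by (simp add: power2_eq_square abs_mult[symmetric] algebra_simps)
    also have "\<dots> \<le> b n * (b n + 2 * B)"
      by (rule mult_mono) (use b[OF z, of n] B(2)[OF z] in auto)
    finally show ?thesis .
  qed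
  have "(\<lambda>n. (\<integral>z. (u n z)\<^sup>2 \<partial>\<mu>) - (\<integral>z. (g z)\<^sup>2 \<partial>\<mu>)) \<longlonglongrightarrow> 0"
  proof (rule Lim_null_comparison)
    show "eventually (\<lambda>n. norm ((\<integral>z. (u n z)\<^sup>2 \<partial>\<mu>) - (\<integral>z. (g z)\<^sup>2 \<partial>\<mu>)) \<le> b n * (b n + 2 * B)) sequentially"
      by (rule always_eventually) (auto intro!: integral_close \<mu> continuous_intros u g sq)
    have "(\<lambda>n. b n * (b n + 2 * B)) \<longlonglongrightarrow> 0 * (0 + 2 * B)" by (intro tendsto_intros b0)
    then show "(\<lambda>n. b n * (b n + 2 * B)) \<longlonglongrightarrow> 0" by simp
  qed
  then have 2: "(\<lambda>n. \<integral>z. (u n z)\<^sup>2 \<partial>\<mu>) \<longlonglongrightarrow> (\<integral>z. (g z)\<^sup>2 \<partial>\<mu>)" by (rule LIM_zero_cancel)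
  show ?thesis unfolding var_def by (intro tendsto_intros 1 2)
qed

text \<open>The derivative is approximated first and then integrated along an arc of length at most
  \<open>2 * pi\<close>. Approximating the function itself would give no control of its
  derivative.\<close>

lemma approx_with_derivative:
  fixes \<phi> \<phi>' :: "complex \<Rightarrow> real"
  assumes D: "\<And>t. ((\<lambda>t. \<phi> (cis t)) has_vector_derivative \<phi>' (cis t)) (at t)" and c: "continuous_on circle \<phi>'"
    and e: "0 < e"
  obtains p where "\<And>z. z \<in> circle \<Longrightarrow> \<bar>Re (poly (rot_deriv p) z) - \<phi>' z\<bar> \<le> e"
    "\<And>z. z \<in> circle \<Longrightarrow> \<bar>Re (poly p z) - \<phi> z\<bar> \<le> 2 * pi * e"
proof -
  obtain q where q: "\<And>z. z \<in> circle \<Longrightarrow> \<bar>\<phi>' z - Re (poly q z)\<bar> < e / 2"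
    using circle_Stone_Weierstrass[OF c, of "e / 2"] e by auto
  \<comment> \<open>A constant term has no polynomial primitive on the circle; since
    \<open>\<phi>'\<close> has mean 0, dropping it costs at most \<open>e / 2\<close>.\<close>
  have q0: "\<bar>Re (coeff q 0)\<bar> \<le> e / 2"
  proof -
    have "(\<integral>z. Re (poly q z) \<partial>haar) = Re (\<integral>z. poly q z \<partial>haar)"
      by (rule integral_Re) (intro circle_prob_integrable circle_prob_haar continuous_intros)
    then have "Re (coeff q 0) = (\<integral>z. Re (poly q z) \<partial>haar)" by (simp add: integral_haar_poly)
    moreover have "\<bar>(\<integral>z. \<phi>' z \<partial>haar) - (\<integral>z. Re (poly q z) \<partial>haar)\<bar> \<le> e / 2"
      by (rule integral_close[OF circle_prob_haar c]) (use q in \<open>auto intro!: continuous_intros less_imp_le\<close>)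
    ultimately show ?thesis unfolding integral_haar_derivative[OF D c] by simp
  qed
  define r where "r k = (if k = 0 then 0 else coeff q k / (\<i> * of_nat k))" for k
  define p0 where "p0 = (\<Sum>k\<le>degree q. monom (r k) k)"
  \<comment> \<open>The constant makes \<open>p\<close> agree with \<open>\<phi>\<close> at 1, the
    starting point of the mean value argument.\<close>
  define p where "p = p0 + [:of_real (\<phi> 1 - Re (poly p0 1)):]"
  have cp0: "coeff p0 k = (if k = 0 then 0 else coeff q k / (\<i> * of_nat k))" for k
  proof -
    have "coeff p0 k = (\<Sum>j\<le>degree q. if j = k then r j else 0)"
      unfolding p0_def coeff_sum coeff_monom ..
    then show ?thesis by (auto simp: r_def coeff_eq_0)
  qed
  have rp: "rot_deriv p = q - [:coeff q 0:]"
    by (rule poly_eqI) (auto simp: coeff_rot_deriv p_def cp0 coeff_pCons simp del: of_nat_Suc split: nat.split)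
  have close: "\<bar>Re (poly (rot_deriv p) z) - \<phi>' z\<bar> \<le> e" if "z \<in> circle" for z
  proof -
    have "Re (poly (rot_deriv p) z) = Re (poly q z) - Re (coeff q 0)" by (simp add: rp)
    then show ?thesis using q[OF that] q0 by linarith
  qed
  have "\<bar>Re (poly p z) - \<phi> z\<bar> \<le> 2 * pi * e" if z: "z \<in> circle" for z
  proof -
    obtain s where s: "0 \<le> s" "s < 2 * pi" "z = cis s"
      using Arg2pi_ge_0[of z] Arg2pi_lt_2pi[of z] Arg2pi_eq[of z] z
      by (auto simp: circle_iff cis_conv_exp intro!: that[of "Arg2pi z"])
    define G where "G t = Re (poly p (cis t)) - \<phi> (cis t)" for t
    define G' where "G' t = Re (poly (rot_deriv p) (cis t)) - \<phi>' (cis t)" for t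
    have G: "DERIV G t :> G' t" for t
      unfolding G_def[abs_def] G'_def has_real_derivative_iff_has_vector_derivative
      using has_vector_derivative_diff[OF Re_poly_cis_vector_derivative[of p 1 t] D] by simp
    have G0: "G 0 = 0" by (simp add: G_def p_def)
    show ?thesis
    proof (cases "s = 0")
      case True
      then show ?thesis using G0 e s by (simp add: G_def)
    next
      case False
      then obtain t where "G s - G 0 = (s - 0) * G' t" using MVT2[of 0 s G G'] G s by auto
      then have "\<bar>G s\<bar> = s * \<bar>G' t\<bar>" using G0 s by (simp add: abs_mult)
      also have "\<dots> \<le> (2 * pi) * e"
        by (rule mult_mono) (use s close[of "cis t"] in \<open>auto simp: G'_def\<close>)
      finally show ?thesis by (simp add: G_def s)
    qed
  qed
  then show thesis using that close by blast
qed

lemma measurable_difference_quotient [measurable]: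
  fixes \<phi> :: "complex \<Rightarrow> real"
  assumes [measurable]: "\<phi> \<in> borel_measurable haar"
  shows "(\<lambda>(w, z). ennreal (((\<phi> z - \<phi> w) / cmod (z - w))\<^sup>2)) \<in> borel_measurable (haar \<Otimes>\<^sub>M haar)"
proof -
  have i: "(\<lambda>z. z) \<in> borel_measurable haar"
    by (intro circle_prob_measurable_continuous circle_prob_haar continuous_intros)
  have [measurable]: "fst \<in> borel_measurable (haar \<Otimes>\<^sub>M haar)" "snd \<in> borel_measurable (haar \<Otimes>\<^sub>M haar)"
    using measurable_compose[OF measurable_fst i] measurable_compose[OF measurable_snd i] by (simp_all add: eta_contract_eq)
  show ?thesis unfolding split_beta by measurable
qed

interpretation haar: prob_space haar by (rule prob_space_haar)

text \<open>Under the approximation the double integral is lower semicontinuous by Fatou's lemma,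
  applied in each variable, while the variance converges. The denominator \<open>2 * \<rho>\<close>
  comes from the 1/2 in the Douglas formula.\<close>

lemma douglas_bound:
  fixes \<phi> \<phi>' :: "complex \<Rightarrow> real"
  assumes \<mu>: "circle_prob \<mu>" and \<rho>: "0 < \<rho>"
    and P: "\<And>p. \<rho> * (\<Sum>k\<le>degree p. real k * (cmod (coeff p k))\<^sup>2) \<le> var \<mu> (\<lambda>z. Re (poly (rot_deriv p) z))"
    and D: "\<And>t. ((\<lambda>t. \<phi> (cis t)) has_vector_derivative \<phi>' (cis t)) (at t)" and c: "continuous_on circle \<phi>'"
  shows "(\<integral>\<^sup>+w. \<integral>\<^sup>+z. ennreal (((\<phi> z - \<phi> w) / cmod (z - w))\<^sup>2) \<partial>haar \<partial>haar) \<le> ennreal (var \<mu> \<phi>' / (2 * \<rho>))"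
proof -
  define e where "e n = inverse (real (Suc n))" for n
  have e0: "0 < e n" for n by (simp add: e_def)
  have el: "e \<longlonglongrightarrow> 0" unfolding e_def by (rule LIMSEQ_inverse_real_of_nat)
  have "\<exists>p. \<forall>z\<in>circle. \<bar>Re (poly (rot_deriv p) z) - \<phi>' z\<bar> \<le> e n \<and> \<bar>Re (poly p z) - \<phi> z\<bar> \<le> 2 * pi * e n" for n
    using approx_with_derivative[OF D c e0[of n]] by metis
  then obtain p where p: "\<And>n z. z \<in> circle \<Longrightarrow> \<bar>Re (poly (rot_deriv (p n)) z) - \<phi>' z\<bar> \<le> e n"
    "\<And>n z. z \<in> circle \<Longrightarrow> \<bar>Re (poly (p n) z) - \<phi> z\<bar> \<le> 2 * pi * e n" by metis
  define F where "F n w z = ennreal (((Re (poly (p n) z) - Re (poly (p n) w)) / cmod (z - w))\<^sup>2)" for n w z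
  have Fm [measurable]: "(\<lambda>(w, z). F n w z) \<in> borel_measurable (haar \<Otimes>\<^sub>M haar)" for n
    unfolding F_def by measurable
  have [measurable]: "(\<lambda>w. \<integral>\<^sup>+z. F n w z \<partial>haar) \<in> borel_measurable haar" for n
    by measurable
  have pl: "(\<lambda>n. Re (poly (p n) z)) \<longlonglongrightarrow> \<phi> z" if z: "z \<in> circle" for z
  proof -
    have "(\<lambda>n. 2 * pi * e n) \<longlonglongrightarrow> 2 * pi * 0" by (intro tendsto_intros el)
    then have "(\<lambda>n. Re (poly (p n) z) - \<phi> z) \<longlonglongrightarrow> 0"
      by (intro Lim_null_comparison[of "\<lambda>n. Re (poly (p n) z) - \<phi> z" "\<lambda>n. 2 * pi * e n"]) (use p(2)[OF z] in auto)
    then show ?thesis by (rule LIM_zero_cancel)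
  qed
  have Fl: "(\<lambda>n. F n w z) \<longlonglongrightarrow> ennreal (((\<phi> z - \<phi> w) / cmod (z - w))\<^sup>2)" if "w \<in> circle" "z \<in> circle" for w z
  proof (cases "z = w")
    case False
    then show ?thesis unfolding F_def by (intro tendsto_ennrealI tendsto_intros pl that) auto
  qed (simp add: F_def)
  have lim: "liminf (\<lambda>n. F n w z) = ennreal (((\<phi> z - \<phi> w) / cmod (z - w))\<^sup>2)" if "w \<in> circle" "z \<in> circle" for w z
    by (rule lim_imp_Liminf[OF trivial_limit_sequentially Fl[OF that]])
  have "(\<integral>\<^sup>+w. \<integral>\<^sup>+z. ennreal (((\<phi> z - \<phi> w) / cmod (z - w))\<^sup>2) \<partial>haar \<partial>haar)
    \<le> (\<integral>\<^sup>+w. liminf (\<lambda>n. \<integral>\<^sup>+z. F n w z \<partial>haar) \<partial>haar)"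
  proof (rule nn_integral_mono)
    fix w assume w: "w \<in> space haar"
    have [measurable]: "F n w \<in> borel_measurable haar" for n
      using measurable_Pair2[OF Fm w] by simp
    have "(\<integral>\<^sup>+z. ennreal (((\<phi> z - \<phi> w) / cmod (z - w))\<^sup>2) \<partial>haar) = (\<integral>\<^sup>+z. liminf (\<lambda>n. F n w z) \<partial>haar)"
      by (rule nn_integral_cong) (use lim w in auto)
    also have "\<dots> \<le> liminf (\<lambda>n. \<integral>\<^sup>+z. F n w z \<partial>haar)" by (rule nn_integral_liminf) measurable
    finally show "(\<integral>\<^sup>+z. ennreal (((\<phi> z - \<phi> w) / cmod (z - w))\<^sup>2) \<partial>haar) \<le> liminf (\<lambda>n. \<integral>\<^sup>+z. F n w z \<partial>haar)" .
  qed
  also have "\<dots> \<le> liminf (\<lambda>n. \<integral>\<^sup>+w. \<integral>\<^sup>+z. F n w z \<partial>haar \<partial>haar)" by (rule nn_integral_liminf) measurable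
  also have "\<dots> \<le> liminf (\<lambda>n. ennreal (var \<mu> (\<lambda>z. Re (poly (rot_deriv (p n)) z)) / (2 * \<rho>)))"
  proof (rule Liminf_mono, rule always_eventually, rule allI)
    fix n
    show "(\<integral>\<^sup>+w. \<integral>\<^sup>+z. F n w z \<partial>haar \<partial>haar) \<le> ennreal (var \<mu> (\<lambda>z. Re (poly (rot_deriv (p n)) z)) / (2 * \<rho>))"
      unfolding F_def douglas_poly using P[of "p n"] \<rho> by (intro ennreal_leI) (simp add: field_simps)
  qed
  also have "\<dots> = ennreal (var \<mu> \<phi>' / (2 * \<rho>))"
  proof (rule lim_imp_Liminf[OF trivial_limit_sequentially], rule tendsto_ennrealI)
    show "(\<lambda>n. var \<mu> (\<lambda>z. Re (poly (rot_deriv (p n)) z)) / (2 * \<rho>)) \<longlonglongrightarrow> var \<mu> \<phi>' / (2 * \<rho>)"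
      by (intro tendsto_divide tendsto_const var_tendsto[OF \<mu> c _ p(1) el] continuous_intros) (use \<rho> in auto)
  qed
  finally show ?thesis .
qed

text \<open>Both sides of P are additive in the squares of the real and imaginary parts, so the real
  inequality is applied to each part and summed.\<close>

lemma satisfies_P_I:
  assumes \<mu>: "circle_prob \<mu>" and \<rho>: "0 < \<rho>"
    and P: "\<And>p. \<rho> * (\<Sum>k\<le>degree p. real k * (cmod (coeff p k))\<^sup>2) \<le> var \<mu> (\<lambda>z. Re (poly (rot_deriv p) z))"
  shows "satisfies_P \<mu> \<rho>"
  unfolding satisfies_P_def
proof (intro allI impI)
  fix f :: "complex \<Rightarrow> complex" assume "circle_smooth f"
  then have f: "circle_Ck (Suc (Suc 0)) f" by (simp add: circle_smooth_def del: circle_Ck.simps)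
  let ?f' = "circle_deriv f"
  have f'c: "continuous_on circle ?f'" using f by (intro circle_Ck_continuous[of "Suc 0"]) simp
  have fc: "continuous_on circle f" by (rule circle_Ck_continuous[OF f])
  note D = circle_Ck_has_vector_derivative[OF f]
  let ?A = "\<lambda>w z. ((Re (f z) - Re (f w)) / cmod (z - w))\<^sup>2"
  let ?B = "\<lambda>w z. ((Im (f z) - Im (f w)) / cmod (z - w))\<^sup>2"
  define v where "v = var \<mu> (\<lambda>z. Re (?f' z)) + var \<mu> (\<lambda>z. Im (?f' z))"
  have v1: "0 \<le> var \<mu> (\<lambda>z. Re (?f' z))" and v2: "0 \<le> var \<mu> (\<lambda>z. Im (?f' z))"
    by (intro var_nonneg \<mu> continuous_intros f'c)+
  have 1: "(\<integral>\<^sup>+w. \<integral>\<^sup>+z. ennreal (?A w z) \<partial>haar \<partial>haar) \<le> ennreal (var \<mu> (\<lambda>z. Re (?f' z)) / (2 * \<rho>))"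
    by (rule douglas_bound[OF \<mu> \<rho> P]) (intro bounded_linear.has_vector_derivative[OF bounded_linear_Re D] continuous_intros f'c)+
  have 2: "(\<integral>\<^sup>+w. \<integral>\<^sup>+z. ennreal (?B w z) \<partial>haar \<partial>haar) \<le> ennreal (var \<mu> (\<lambda>z. Im (?f' z)) / (2 * \<rho>))"
    by (rule douglas_bound[OF \<mu> \<rho> P]) (intro bounded_linear.has_vector_derivative[OF bounded_linear_Im D] continuous_intros f'c)+
  have ReIm: "(cmod ((f z - f w) / (z - w)))\<^sup>2 = ?A w z + ?B w z" for z w
    unfolding norm_divide power_divide add_divide_distrib[symmetric] cmod_power2 by simp
  have [measurable]: "(\<lambda>z. Re (f z)) \<in> borel_measurable haar" "(\<lambda>z. Im (f z)) \<in> borel_measurable haar"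
    by (intro circle_prob_measurable_continuous circle_prob_haar continuous_intros fc)+
  have m: "(\<lambda>(w, z). ennreal (?A w z)) \<in> borel_measurable (haar \<Otimes>\<^sub>M haar)"
      "(\<lambda>(w, z). ennreal (?B w z)) \<in> borel_measurable (haar \<Otimes>\<^sub>M haar)" by measurable
  have m2 [measurable]: "(\<lambda>w. \<integral>\<^sup>+z. ennreal (?A w z) \<partial>haar) \<in> borel_measurable haar"
    "(\<lambda>w. \<integral>\<^sup>+z. ennreal (?B w z) \<partial>haar) \<in> borel_measurable haar"
    using haar.borel_measurable_nn_integral[OF m(1)] haar.borel_measurable_nn_integral[OF m(2)] by simp_all
  have "(\<integral>\<^sup>+w. \<integral>\<^sup>+z. ennreal ((cmod ((f z - f w) / (z - w)))\<^sup>2) \<partial>haar \<partial>haar)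
    = (\<integral>\<^sup>+w. (\<integral>\<^sup>+z. ennreal (?A w z) \<partial>haar) + (\<integral>\<^sup>+z. ennreal (?B w z) \<partial>haar) \<partial>haar)"
  proof (rule nn_integral_cong)
    fix w assume w: "w \<in> space haar"
    have "(\<integral>\<^sup>+z. ennreal ((cmod ((f z - f w) / (z - w)))\<^sup>2) \<partial>haar) = (\<integral>\<^sup>+z. ennreal (?A w z) + ennreal (?B w z) \<partial>haar)"
      unfolding ReIm by simp
    also have "\<dots> = (\<integral>\<^sup>+z. ennreal (?A w z) \<partial>haar) + (\<integral>\<^sup>+z. ennreal (?B w z) \<partial>haar)"
      by (rule nn_integral_add) (use measurable_Pair2[OF m(1) w] measurable_Pair2[OF m(2) w] in simp_all)
    finally show "(\<integral>\<^sup>+z. ennreal ((cmod ((f z - f w) / (z - w)))\<^sup>2) \<partial>haar)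
      = (\<integral>\<^sup>+z. ennreal (?A w z) \<partial>haar) + (\<integral>\<^sup>+z. ennreal (?B w z) \<partial>haar)" .
  qed
  also have "\<dots> = (\<integral>\<^sup>+w. \<integral>\<^sup>+z. ennreal (?A w z) \<partial>haar \<partial>haar) + (\<integral>\<^sup>+w. \<integral>\<^sup>+z. ennreal (?B w z) \<partial>haar \<partial>haar)"
    by (rule nn_integral_add) measurable
  also have "\<dots> \<le> ennreal (var \<mu> (\<lambda>z. Re (?f' z)) / (2 * \<rho>)) + ennreal (var \<mu> (\<lambda>z. Im (?f' z)) / (2 * \<rho>))"
    by (rule add_mono[OF 1 2])
  also have "\<dots> = ennreal (v / (2 * \<rho>))"
    using v1 v2 \<rho> by (subst ennreal_plus[symmetric]) (simp_all add: v_def add_divide_distrib)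
  finally have b: "(\<integral>\<^sup>+w. \<integral>\<^sup>+z. ennreal ((cmod ((f z - f w) / (z - w)))\<^sup>2) \<partial>haar \<partial>haar) \<le> ennreal (v / (2 * \<rho>))" .
  \<comment> \<open>Carries the bound back to the iterated Bochner integrals of P; it also holds
    where a Bochner integral has the default value 0.\<close>
  have le: "ennreal (integral\<^sup>L M g) \<le> (\<integral>\<^sup>+x. ennreal (g x) \<partial>M)" for M and g :: "complex \<Rightarrow> real"
  proof (cases "(\<integral>\<^sup>+x. ennreal (g x) \<partial>M)")
    case (real r)
    then have "integral\<^sup>L M g \<le> r" by (intro integral_real_bounded) auto
    then show ?thesis using real by (simp add: ennreal_leI)
  qed simp
  have "(\<integral>\<^sup>+w. ennreal (\<integral>z. (cmod ((f z - f w) / (z - w)))\<^sup>2 \<partial>haar) \<partial>haar) \<le> ennreal (v / (2 * \<rho>))"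
    by (rule order_trans[OF nn_integral_mono b]) (rule le)
  then have "(\<integral>w. (\<integral>z. (cmod ((f z - f w) / (z - w)))\<^sup>2 \<partial>haar) \<partial>haar) \<le> v / (2 * \<rho>)"
    using v1 v2 \<rho> by (intro integral_real_bounded) (auto simp: v_def)
  then have "2 * \<rho> * (\<integral>w. (\<integral>z. (cmod ((f z - f w) / (z - w)))\<^sup>2 \<partial>haar) \<partial>haar) \<le> v"
    using \<rho> by (simp add: field_simps)
  also have "v = (\<integral>z. (cmod (?f' z))\<^sup>2 \<partial>\<mu>) - (cmod (\<integral>z. ?f' z \<partial>\<mu>))\<^sup>2"
  proof -
    have i: "integrable \<mu> ?f'" "integrable \<mu> (\<lambda>z. (Re (?f' z))\<^sup>2)" "integrable \<mu> (\<lambda>z. (Im (?f' z))\<^sup>2)"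
      by (intro circle_prob_integrable \<mu> continuous_intros f'c)+
    have "(\<integral>z. (cmod (?f' z))\<^sup>2 \<partial>\<mu>) = (\<integral>z. (Re (?f' z))\<^sup>2 \<partial>\<mu>) + (\<integral>z. (Im (?f' z))\<^sup>2 \<partial>\<mu>)"
      unfolding cmod_power2 by (rule Bochner_Integration.integral_add[OF i(2,3)])
    then show ?thesis unfolding v_def var_def integral_Re[OF i(1)] integral_Im[OF i(1)] cmod_power2[of "integral\<^sup>L \<mu> _"] by simp
  qed
  finally show "2 * \<rho> * (\<integral>w. (\<integral>z. (cmod ((f z - f w) / (z - w)))\<^sup>2 \<partial>haar) \<partial>haar)
    \<le> (\<integral>z. (cmod (?f' z))\<^sup>2 \<partial>\<mu>) - (cmod (\<integral>z. ?f' z \<partial>\<mu>))\<^sup>2" .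
qed

section \<open>Linearized inequalities\<close>


text \<open>Holds for all real \<open>x\<close> and \<open>y\<close>, not just nearby angles, since
  couplings live on the line. Each frequency contributes the global bound
  \<open>|exp (\<i> s) - 1 - \<i> s| <= s^2 / 2\<close> with \<open>s = k (x - y)\<close>.\<close>

lemma Re_poly_cis_taylor:
  "Re (poly p (cis x)) - Re (poly p (cis y)) \<le> Re (poly (rot_deriv p) (cis y)) * (x - y)
    + (\<Sum>k\<le>degree p. (real k)\<^sup>2 * cmod (coeff p k)) / 2 * (x - y)\<^sup>2"
proof -
  let ?R = "\<lambda>k. iexp (real k * (x - y)) - 1 - \<i> * of_real (real k * (x - y))"
  have R: "cmod (?R k) \<le> (real k)\<^sup>2 * (x - y)\<^sup>2 / 2" for k
  proof -
    have "(\<Sum>j\<le>1. (\<i> * complex_of_real s) ^ j / fact j) = 1 + \<i> * of_real s" for s by simp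
    then show ?thesis using iexp_approx1[of "real k * (x - y)" 1]
      by (simp add: diff_diff_eq power_mult_distrib power2_eq_square[symmetric] numeral_2_eq_2[symmetric] abs_mult)
  qed
  have pe: "poly p (cis t) = (\<Sum>k\<le>degree p. coeff p k * cis (real k * t))" for t
    by (simp add: poly_altdef Complex.DeMoivre)
  have re: "poly (rot_deriv p) (cis y) = (\<Sum>k\<le>degree p. \<i> * of_nat k * coeff p k * cis (real k * y))"
  proof -
    have "poly (rot_deriv p) (cis y) = (\<Sum>k\<le>degree p. coeff (rot_deriv p) k * cis y ^ k)"
      unfolding poly_altdef by (rule sum.mono_neutral_left) (use degree_rot_deriv_le[of p] in \<open>auto simp: coeff_eq_0\<close>)
    then show ?thesis by (simp add: coeff_rot_deriv Complex.DeMoivre)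
  qed
  have "poly p (cis x) - poly p (cis y) - poly (rot_deriv p) (cis y) * of_real (x - y)
    = (\<Sum>k\<le>degree p. coeff p k * cis (real k * y) * ?R k)"
    unfolding pe re sum_distrib_right sum_subtractf[symmetric]
  proof (rule sum.cong[OF refl])
    fix k
    have "cis (real k * x) = cis (real k * y) * iexp (real k * (x - y))"
      unfolding cis_conv_exp[symmetric] cis_mult by (simp add: algebra_simps)
    then show "coeff p k * cis (real k * x) - coeff p k * cis (real k * y)
        - \<i> * of_nat k * coeff p k * cis (real k * y) * of_real (x - y)
      = coeff p k * cis (real k * y) * ?R k"
      by (simp add: algebra_simps)
  qed
  then have "Re (poly p (cis x)) - Re (poly p (cis y)) - Re (poly (rot_deriv p) (cis y)) * (x - y)
    = Re (\<Sum>k\<le>degree p. coeff p k * cis (real k * y) * ?R k)"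
    by (metis (no_types, lifting) minus_complex.sel(1) Re_complex_of_real Im_complex_of_real times_complex.sel(1) mult_zero_right diff_zero)
  also have "\<dots> \<le> cmod (\<Sum>k\<le>degree p. coeff p k * cis (real k * y) * ?R k)" by (rule complex_Re_le_cmod)
  also have "\<dots> \<le> (\<Sum>k\<le>degree p. cmod (coeff p k * cis (real k * y) * ?R k))" by (rule norm_sum)
  also have "\<dots> \<le> (\<Sum>k\<le>degree p. cmod (coeff p k) * ((real k)\<^sup>2 * (x - y)\<^sup>2 / 2))"
  proof (rule sum_mono)
    fix k
    have "cmod (coeff p k * cis (real k * y) * ?R k) = cmod (coeff p k) * cmod (?R k)"
      by (simp only: norm_mult norm_cis mult_1_right)
    then show "cmod (coeff p k * cis (real k * y) * ?R k) \<le> cmod (coeff p k) * ((real k)\<^sup>2 * (x - y)\<^sup>2 / 2)"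
      using mult_left_mono[OF R[of k] norm_ge_zero[of "coeff p k"]] by (simp only:)
  qed
  also have "\<dots> = (\<Sum>k\<le>degree p. (real k)\<^sup>2 * cmod (coeff p k)) / 2 * (x - y)\<^sup>2"
    unfolding sum_divide_distrib sum_distrib_right by (rule sum.cong) auto
  finally show ?thesis by simp
qed

context equilibrium
begin

context
  fixes p :: "complex poly" and \<rho> :: real
  assumes \<rho>: "0 < \<rho>"
begin

text \<open>This is \<open>\<epsilon> \<Sum> k p\<^sub>k z\<^sup>k\<close>, chosen so that its imaginary part is \<open>-\<epsilon>\<close> times the derivative of \<open>Re p\<close> along the circle.\<close>

definition dir :: "real \<Rightarrow> complex poly"
  where "dir \<epsilon> = smult (of_real \<epsilon>) (smult (- \<i>) (rot_deriv p))"

lemma coeff_dir: "coeff (dir \<epsilon>) k = of_real \<epsilon> * of_nat k * coeff p k"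
  by (simp add: dir_def coeff_rot_deriv algebra_simps)

lemma dir_0: "coeff (dir \<epsilon>) 0 = 0"
  by (simp add: coeff_dir)

lemma degree_dir: "degree (dir \<epsilon>) \<le> degree p"
  by (rule degree_le) (simp add: coeff_dir coeff_eq_0)

lemma Im_dir: "Im (poly (dir \<epsilon>) z) = - \<epsilon> * Re (poly (rot_deriv p) z)"
  by (simp add: dir_def)

lemma Re_dir: "Re (poly (dir \<epsilon>) z) = \<epsilon> * Re (poly (dir 1) z)"
  by (simp add: dir_def)

text \<open>By the Douglas formula this is the double integral of the squared difference quotient of
  \<open>Re p\<close>, so P for \<open>Re p\<close> reads
  \<open>2 * \<rho> * half_norm <= var \<mu> f'\<close>.\<close>

abbreviation "half_norm \<equiv> (\<Sum>k\<le>degree p. real k * (cmod (coeff p k))\<^sup>2) / 2"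

abbreviation "f' \<equiv> (\<lambda>z. Re (poly (rot_deriv p) z))"

lemma energy_dir: "(\<Sum>k\<le>degree (dir \<epsilon>). (cmod (coeff (dir \<epsilon>) k))\<^sup>2 / (4 * real k)) = \<epsilon>\<^sup>2 * half_norm / 2"
proof -
  have "(\<Sum>k\<le>degree (dir \<epsilon>). (cmod (coeff (dir \<epsilon>) k))\<^sup>2 / (4 * real k))
    = (\<Sum>k\<le>degree p. (cmod (coeff (dir \<epsilon>) k))\<^sup>2 / (4 * real k))"
    by (rule sum.mono_neutral_left) (use degree_dir[of \<epsilon>] in \<open>auto simp: coeff_eq_0\<close>)
  also have "\<dots> = (\<Sum>k\<le>degree p. \<epsilon>\<^sup>2 / 4 * (real k * (cmod (coeff p k))\<^sup>2))"
    by (rule sum.cong) (auto simp: coeff_dir norm_mult power_mult_distrib power2_eq_square)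
  also have "\<dots> = \<epsilon>\<^sup>2 / 4 * (\<Sum>k\<le>degree p. real k * (cmod (coeff p k))\<^sup>2)"
    by (rule sum_distrib_left[symmetric])
  finally show ?thesis by simp
qed

text \<open>The rate of change of \<open>\<integral> Re p\<close> along the perturbation is twice
  the quadratic coefficient of the energy along it. This duality lets the transport argument close
  with the sharp constant.\<close>

lemma integral_dir: "(\<integral>z. Re (poly (dir 1) z) * Re (poly p z) \<partial>haar) = half_norm"
proof -
  have "(\<integral>z. Re (poly (dir 1) z) * Re (poly p z) \<partial>haar) = (\<integral>z. Re (of_real (Re (poly p z)) * poly (dir 1) z) \<partial>haar)"
    by (simp add: mult.commute)
  also have "\<dots> = Re (\<integral>z. of_real (Re (poly p z)) * poly (dir 1) z \<partial>haar)"
    by (rule integral_Re) (intro circle_prob_integrable circle_prob_haar continuous_intros)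
  also have "(\<integral>z. of_real (Re (poly p z)) * poly (dir 1) z \<partial>haar)
    = (\<Sum>k\<le>degree (dir 1). coeff (dir 1) k * (\<integral>z. of_real (Re (poly p z)) * z ^ k \<partial>haar))"
    by (rule integral_poly[OF circle_prob_haar]) (intro continuous_intros)
  also have "\<dots> = (\<Sum>k\<le>degree p. coeff (dir 1) k * (\<integral>z. of_real (Re (poly p z)) * z ^ k \<partial>haar))"
    by (rule sum.mono_neutral_left) (use degree_dir[of 1] in \<open>auto simp: coeff_eq_0\<close>)
  also have "\<dots> = (\<Sum>k\<le>degree p. of_real (real k * (cmod (coeff p k))\<^sup>2 / 2))"
  proof (rule sum.cong[OF refl])
    fix k
    show "coeff (dir 1) k * (\<integral>z. of_real (Re (poly p z)) * z ^ k \<partial>haar) = of_real (real k * (cmod (coeff p k))\<^sup>2 / 2)"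
    proof (cases "k = 0")
      case False
      then have "(\<integral>z. of_real (Re (poly p z)) * z ^ k \<partial>haar) = cnj (coeff p k) / 2"
        using integral_haar_power_Re_poly[of k p] by (simp add: mult.commute)
      then show ?thesis by (simp add: coeff_dir complex_norm_square[symmetric] mult.assoc flip: of_real_power)
    qed (simp add: coeff_dir)
  qed
  finally show ?thesis by (simp only: of_real_sum[symmetric] Re_complex_of_real sum_divide_distrib)
qed

lemma small_dir:
  obtains \<epsilon>0 where "0 < \<epsilon>0" "\<And>\<epsilon> z. 0 < \<epsilon> \<Longrightarrow> \<epsilon> < \<epsilon>0 \<Longrightarrow> z \<in> circle \<Longrightarrow> \<bar>Re (poly (dir \<epsilon>) z)\<bar> \<le> c"
proof -
  have "continuous_on circle (\<lambda>z. Re (poly (dir 1) z))" by (intro continuous_intros)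
  then obtain B where B: "0 < B" "\<And>z. z \<in> circle \<Longrightarrow> norm (Re (poly (dir 1) z)) \<le> B"
    using circle_bounded by blast
  show thesis
  proof (rule that[of "c / B"])
    show "0 < c / B" using c B by simp
    fix \<epsilon> z assume e: "0 < \<epsilon>" "\<epsilon> < c / B" and z: "z \<in> circle"
    have "\<bar>Re (poly (dir \<epsilon>) z)\<bar> = \<epsilon> * \<bar>Re (poly (dir 1) z)\<bar>" using e by (subst Re_dir) (simp add: abs_mult)
    also have "\<dots> \<le> c / B * B" by (rule mult_mono) (use e B z c in auto)
    finally show "\<bar>Re (poly (dir \<epsilon>) z)\<bar> \<le> c" using B by simp
  qed
qed

text \<open>The absolute value yields one hypothesis implied by both LSI and HWI; it disappears at
  the end because the limit is a variance. After \<open>N\<close> tends to infinity both sides are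
  divided by \<open>\<epsilon>^2\<close>.\<close>

lemma half_norm_bound_of_fisher:
  assumes QC: "circle_Ck (Suc (Suc j)) Q"
    and ineq: "\<And>a. poly_density a
      \<Longrightarrow> energy Q (poly_measure a) - energy Q \<mu> \<le> ereal (\<bar>fisher_info Q (poly_measure a)\<bar> / (4 * \<rho>))"
  shows "2 * \<rho> * half_norm \<le> var \<mu> f'"
proof -
  obtain \<epsilon>0 where \<epsilon>0: "0 < \<epsilon>0" and small: "\<And>\<epsilon> z. 0 < \<epsilon> \<Longrightarrow> \<epsilon> < \<epsilon>0 \<Longrightarrow> z \<in> circle \<Longrightarrow> \<bar>Re (poly (dir \<epsilon>) z)\<bar> \<le> c"
    using small_dir by blast
  define g where "g z = Re (poly (dir 1) z)" for z
  \<comment> \<open>The limiting Fisher information divided by \<open>\<epsilon>^2\<close>. The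
    terms with \<open>g\<close> come from integrating against the perturbed measure rather than
    \<open>\<mu>\<close> and vanish with \<open>\<epsilon>\<close>.\<close>
  define V where "V \<epsilon> = ((\<integral>z. (f' z)\<^sup>2 \<partial>\<mu>) + \<epsilon> * (\<integral>z. g z * (f' z)\<^sup>2 \<partial>haar))
      - ((\<integral>z. f' z \<partial>\<mu>) + \<epsilon> * (\<integral>z. g z * f' z \<partial>haar))\<^sup>2" for \<epsilon>
  have le: "half_norm / 2 \<le> \<bar>V \<epsilon>\<bar> / (4 * \<rho>)" if e: "0 < \<epsilon>" "\<epsilon> < \<epsilon>0" for \<epsilon>
  proof -
    have dc: "\<bar>Re (poly (dir \<epsilon>) z)\<bar> \<le> c" if "z \<in> circle" for z using small[OF e that] .
    obtain G where G: "\<And>N. energy Q (poly_measure (perturbed (dir \<epsilon>) N)) - energy Q \<mu> = ereal (G N)"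
      and Gl: "G \<longlonglongrightarrow> \<epsilon>\<^sup>2 * half_norm / 2"
      using energy_gap[OF dir_0 dc, unfolded energy_dir] by blast
    have "((\<integral>z. (Im (poly (dir \<epsilon>) z))\<^sup>2 \<partial>\<mu>) + (\<integral>z. Re (poly (dir \<epsilon>) z) * (Im (poly (dir \<epsilon>) z))\<^sup>2 \<partial>haar))
      - ((\<integral>z. Im (poly (dir \<epsilon>) z) \<partial>\<mu>) + (\<integral>z. Re (poly (dir \<epsilon>) z) * Im (poly (dir \<epsilon>) z) \<partial>haar))\<^sup>2 = \<epsilon>\<^sup>2 * V \<epsilon>"
    proof -
      have 1: "(\<integral>z. (Im (poly (dir \<epsilon>) z))\<^sup>2 \<partial>\<mu>) = \<epsilon>\<^sup>2 * (\<integral>z. (f' z)\<^sup>2 \<partial>\<mu>)"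
        unfolding Im_dir by (simp add: power_mult_distrib)
      have 2: "(\<integral>z. Re (poly (dir \<epsilon>) z) * (Im (poly (dir \<epsilon>) z))\<^sup>2 \<partial>haar) = \<epsilon>\<^sup>2 * (\<epsilon> * (\<integral>z. g z * (f' z)\<^sup>2 \<partial>haar))"
        unfolding Im_dir Re_dir[of \<epsilon>] g_def integral_mult_right_zero[symmetric]
        by (simp add: power_mult_distrib mult_ac)
      have 3: "(\<integral>z. Im (poly (dir \<epsilon>) z) \<partial>\<mu>) = - \<epsilon> * (\<integral>z. f' z \<partial>\<mu>)"
        unfolding Im_dir by simp
      have 4: "(\<integral>z. Re (poly (dir \<epsilon>) z) * Im (poly (dir \<epsilon>) z) \<partial>haar) = - \<epsilon> * (\<epsilon> * (\<integral>z. g z * f' z \<partial>haar))"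
        unfolding Im_dir Re_dir[of \<epsilon>] g_def integral_mult_right_zero[symmetric] by (simp add: mult_ac)
      show ?thesis unfolding 1 2 3 4 V_def by (simp add: power2_eq_square algebra_simps)
    qed
    with fisher_tendsto[OF QC dir_0 dc]
    have Fl: "(\<lambda>N. fisher_info Q (poly_measure (perturbed (dir \<epsilon>) N))) \<longlonglongrightarrow> \<epsilon>\<^sup>2 * V \<epsilon>" by simp
    have "G N \<le> \<bar>fisher_info Q (poly_measure (perturbed (dir \<epsilon>) N))\<bar> / (4 * \<rho>)" for N
    proof -
      have "poly_density (perturbed (dir \<epsilon>) N)" by (rule poly_density_perturbed[OF dir_0 dc])
      from ineq[OF this] show ?thesis unfolding G by simp
    qed
    then have "\<epsilon>\<^sup>2 * half_norm / 2 \<le> \<bar>\<epsilon>\<^sup>2 * V \<epsilon>\<bar> / (4 * \<rho>)"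
      by (intro LIMSEQ_le[OF Gl tendsto_divide[OF tendsto_rabs[OF Fl] tendsto_const]]) (use \<rho> in auto)
    then have "\<epsilon>\<^sup>2 * (half_norm / 2) \<le> \<epsilon>\<^sup>2 * (\<bar>V \<epsilon>\<bar> / (4 * \<rho>))" by (simp add: abs_mult)
    then show ?thesis using e by (simp only: mult_le_cancel_left_pos zero_less_power)
  qed
  have "((\<lambda>\<epsilon>. \<bar>V \<epsilon>\<bar> / (4 * \<rho>)) \<longlongrightarrow> \<bar>V 0\<bar> / (4 * \<rho>)) (at_right 0)"
    unfolding V_def by (intro tendsto_intros) (use \<rho> in auto)
  moreover have "eventually (\<lambda>\<epsilon>. half_norm / 2 \<le> \<bar>V \<epsilon>\<bar> / (4 * \<rho>)) (at_right 0)"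
    using \<epsilon>0 le by (intro eventually_at_rightI[of 0 \<epsilon>0]) auto
  ultimately have "half_norm / 2 \<le> \<bar>V 0\<bar> / (4 * \<rho>)"
    by (intro tendsto_lowerbound) auto
  moreover have "V 0 = var \<mu> f'" by (simp add: V_def var_def)
  moreover have "0 \<le> var \<mu> f'" by (intro var_nonneg \<mu> continuous_intros)
  ultimately show ?thesis using \<rho> by (simp add: field_simps)
qed

text \<open>\<open>Re p\<close> is the test function: T bounds the squared distance by the energy
  gap of order \<open>\<epsilon>^2\<close>, while the integral of \<open>Re p\<close> moves by order
  \<open>\<epsilon>\<close>.\<close>

lemma half_norm_bound_of_transport:
  assumes T: "satisfies_T Q \<mu> \<rho>"
  shows "2 * \<rho> * half_norm \<le> var \<mu> f'"
proof -
  obtain \<epsilon>0 where \<epsilon>0: "0 < \<epsilon>0" and small: "\<And>\<epsilon> z. 0 < \<epsilon> \<Longrightarrow> \<epsilon> < \<epsilon>0 \<Longrightarrow> z \<in> circle \<Longrightarrow> \<bar>Re (poly (dir \<epsilon>) z)\<bar> \<le> c"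
    using small_dir by blast
  define L where "L = (\<Sum>k\<le>degree p. (real k)\<^sup>2 * cmod (coeff p k))"
  have L: "0 \<le> L" unfolding L_def by (intro sum_nonneg) simp
  have le: "half_norm \<le> var \<mu> f' / (4 * \<rho>) + half_norm / 2 + \<epsilon> * (L * half_norm / (4 * \<rho>))" if e: "0 < \<epsilon>" "\<epsilon> < \<epsilon>0" for \<epsilon>
  proof -
    have dc: "\<bar>Re (poly (dir \<epsilon>) z)\<bar> \<le> c" if "z \<in> circle" for z using small[OF e that] .
    obtain G where G: "\<And>N. energy Q (poly_measure (perturbed (dir \<epsilon>) N)) - energy Q \<mu> = ereal (G N)"
      and Gl: "G \<longlonglongrightarrow> \<epsilon>\<^sup>2 * half_norm / 2"
      using energy_gap[OF dir_0 dc, unfolded energy_dir] by blast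
    let ?P = "\<lambda>N. poly_measure (perturbed (dir \<epsilon>) N)"
    \<comment> \<open>The optimal weight. In the limit in \<open>N\<close> the distance term
      contributes \<open>\<epsilon> * half_norm / 2\<close>, half of the left side, leaving
      \<open>2 * \<rho> * half_norm <= var\<close> up to the Taylor term, which is of order
      \<open>\<epsilon>^2\<close>.\<close>
    define \<theta> where "\<theta> = \<epsilon> / (2 * \<rho>)"
    have \<theta>: "0 < \<theta>" using e \<rho> by (simp add: \<theta>_def)
    have fc: "continuous_on circle (\<lambda>z. Re (poly p z))" "continuous_on circle f'" by (intro continuous_intros)+
    have "(\<integral>z. Re (poly p z) \<partial>?P N) - (\<integral>z. Re (poly p z) \<partial>\<mu>) \<le> \<theta> / 2 * var \<mu> f' + (1 / (2 * \<theta>) + L / 2) * (G N / \<rho>)" for N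
    proof -
      have pd: "poly_density (perturbed (dir \<epsilon>) N)" by (rule poly_density_perturbed[OF dir_0 dc])
      have "ereal \<rho> * (enn2ereal (circle_wasserstein 2 (?P N) \<mu>))\<^sup>2 \<le> ereal (G N)"
        using T poly_density.smooth_prob_poly_measure[OF pd] unfolding satisfies_T_def G[symmetric] by blast
      \<comment> \<open>The energy gap is finite and \<open>\<rho> > 0\<close>, so T excludes an
        infinite distance.\<close>
      then obtain W where W: "circle_wasserstein 2 (?P N) \<mu> = ennreal W" "0 \<le> W" and WG: "\<rho> * W\<^sup>2 \<le> G N"
        using \<rho> by (cases "circle_wasserstein 2 (?P N) \<mu>") (auto simp: power2_eq_square)
      have "(\<integral>z. Re (poly p z) \<partial>?P N) - (\<integral>z. Re (poly p z) \<partial>\<mu>) \<le> \<theta> / 2 * var \<mu> f' + (1 / (2 * \<theta>) + L / 2) * W\<^sup>2"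
        unfolding var_def
        by (rule circle_wasserstein_bound[OF poly_density.circle_prob_poly_measure[OF pd] \<mu> W fc _ L \<theta>])
          (use Re_poly_cis_taylor[of p] in \<open>simp add: L_def\<close>)
      also have "W\<^sup>2 \<le> G N / \<rho>" using WG \<rho> by (simp add: field_simps)
      finally show ?thesis using L \<theta> by (simp add: mult_left_mono add_nonneg_nonneg)
    qed
    moreover have "(\<lambda>N. (\<integral>z. Re (poly p z) \<partial>?P N) - (\<integral>z. Re (poly p z) \<partial>\<mu>)) \<longlonglongrightarrow> \<epsilon> * half_norm"
    proof -
      have "(\<integral>z. Re (poly (dir \<epsilon>) z) * Re (poly p z) \<partial>haar) = \<epsilon> * half_norm"
        unfolding Re_dir[of \<epsilon>] integral_dir[symmetric] integral_mult_right_zero[symmetric] by (simp add: mult.assoc)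
      with tendsto_diff[OF weak_tendsto[OF dir_0 dc fc(1)] tendsto_const[of "\<integral>z. Re (poly p z) \<partial>\<mu>"]]
      show ?thesis by simp
    qed
    moreover have "(\<lambda>N. \<theta> / 2 * var \<mu> f' + (1 / (2 * \<theta>) + L / 2) * (G N / \<rho>))
      \<longlonglongrightarrow> \<theta> / 2 * var \<mu> f' + (1 / (2 * \<theta>) + L / 2) * ((\<epsilon>\<^sup>2 * half_norm / 2) / \<rho>)"
      by (intro tendsto_intros Gl) (use \<rho> in simp)
    ultimately have "\<epsilon> * half_norm \<le> \<theta> / 2 * var \<mu> f' + (1 / (2 * \<theta>) + L / 2) * ((\<epsilon>\<^sup>2 * half_norm / 2) / \<rho>)"
      by (intro LIMSEQ_le) auto
    also have "\<dots> = \<epsilon> * (var \<mu> f' / (4 * \<rho>) + half_norm / 2 + \<epsilon> * (L * half_norm / (4 * \<rho>)))"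
    proof -
      have "\<theta> / 2 * V + (1 / (2 * \<theta>) + L / 2) * ((\<epsilon>\<^sup>2 * A / 2) / \<rho>) = \<epsilon> * (V / (4 * \<rho>) + A / 2 + \<epsilon> * (L * A / (4 * \<rho>)))" for V A
        using e \<rho> unfolding \<theta>_def by (simp add: field_simps power2_eq_square)
      then show ?thesis .
    qed
    finally show ?thesis using e by (simp only: mult_le_cancel_left_pos)
  qed
  have "((\<lambda>\<epsilon>. var \<mu> f' / (4 * \<rho>) + half_norm / 2 + \<epsilon> * (L * half_norm / (4 * \<rho>)))
      \<longlongrightarrow> var \<mu> f' / (4 * \<rho>) + half_norm / 2 + 0 * (L * half_norm / (4 * \<rho>))) (at_right 0)"
    by (intro tendsto_intros)
  moreover have "eventually (\<lambda>\<epsilon>. half_norm \<le> var \<mu> f' / (4 * \<rho>) + half_norm / 2 + \<epsilon> * (L * half_norm / (4 * \<rho>))) (at_right 0)"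
    using \<epsilon>0 le by (intro eventually_at_rightI[of 0 \<epsilon>0]) auto
  ultimately have "half_norm \<le> var \<mu> f' / (4 * \<rho>) + half_norm / 2 + 0 * (L * half_norm / (4 * \<rho>))"
    by (intro tendsto_lowerbound) auto
  then show ?thesis using \<rho> by (simp add: field_simps)
qed

end

lemma P_of_T: "0 < \<rho> \<Longrightarrow> satisfies_T Q \<mu> \<rho> \<Longrightarrow> satisfies_P \<mu> \<rho>"
  using half_norm_bound_of_transport by (intro satisfies_P_I \<mu>) auto

lemma P_of_fisher:
  assumes "0 < \<rho>" "circle_Ck (Suc (Suc j)) Q"
    and "\<And>a. poly_density a
      \<Longrightarrow> energy Q (poly_measure a) - energy Q \<mu> \<le> ereal (\<bar>fisher_info Q (poly_measure a)\<bar> / (4 * \<rho>))"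
  shows "satisfies_P \<mu> \<rho>"
  using half_norm_bound_of_fisher[OF assms] assms(1) by (intro satisfies_P_I \<mu>) auto

lemma P_of_LSI:
  assumes \<rho>: "0 < \<rho>" and QC: "circle_Ck (Suc (Suc j)) Q" and LSI: "satisfies_LSI Q \<mu> \<rho>"
  shows "satisfies_P \<mu> \<rho>"
proof (rule P_of_fisher[OF \<rho> QC])
  fix a assume "poly_density a"
  then have "energy Q (poly_measure a) - energy Q \<mu> \<le> ereal (1 / (4 * \<rho>) * fisher_info Q (poly_measure a))"
    using LSI poly_density.smooth_prob_poly_measure by (auto simp: satisfies_LSI_def)
  also have "\<dots> \<le> ereal (\<bar>fisher_info Q (poly_measure a)\<bar> / (4 * \<rho>))"
    using \<rho> by (simp add: divide_right_mono)
  finally show "energy Q (poly_measure a) - energy Q \<mu> \<le> ereal (\<bar>fisher_info Q (poly_measure a)\<bar> / (4 * \<rho>))" .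
qed

text \<open>Maximizing the right-hand side of HWI over the distance gives LSI, once the distance is finite.\<close>

lemma P_of_HWI:
  assumes \<rho>: "0 < \<rho>" and QC: "circle_Ck (Suc (Suc j)) Q" and HWI: "satisfies_HWI Q \<mu> \<rho>"
  shows "satisfies_P \<mu> \<rho>"
proof (rule P_of_fisher[OF \<rho> QC])
  fix a assume pd: "poly_density a"
  let ?I = "fisher_info Q (poly_measure a)"
  have "circle_wasserstein 2 (poly_measure a) \<mu> \<noteq> \<infinity>"
    by (intro circle_wasserstein_finite poly_density.circle_prob_poly_measure[OF pd]
        poly_density.emeasure_poly_measure_singleton[OF pd] \<mu> atomless)
  then obtain W where W: "circle_wasserstein 2 (poly_measure a) \<mu> = ennreal W" "0 \<le> W"
    by (cases "circle_wasserstein 2 (poly_measure a) \<mu>") auto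
  have "energy Q (poly_measure a) - energy Q \<mu> \<le> ereal (sqrt ?I * W - \<rho> * W\<^sup>2)"
    using HWI poly_density.smooth_prob_poly_measure[OF pd] W(2)
    by (auto simp: satisfies_HWI_def W(1) dest!: spec[of _ "poly_measure a"])
  also have "sqrt ?I * W - \<rho> * W\<^sup>2 \<le> \<bar>?I\<bar> / (4 * \<rho>)"
  proof -
    have "0 \<le> (sqrt ?I - 2 * \<rho> * W)\<^sup>2 / (4 * \<rho>)" using \<rho> by simp
    also have "(sqrt ?I - 2 * \<rho> * W)\<^sup>2 = \<bar>?I\<bar> - 4 * \<rho> * (sqrt ?I * W - \<rho> * W\<^sup>2)"
    proof -
      \<comment> \<open>In HOL \<open>sqrt\<close> is odd, so the square of \<open>sqrt ?I\<close>
        is the modulus of \<open>?I\<close> for either sign.\<close>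
      have "(sqrt ?I)\<^sup>2 = \<bar>?I\<bar>" by (simp add: power2_eq_square)
      then show ?thesis by (simp add: power2_diff power_mult_distrib) (simp add: power2_eq_square algebra_simps)
    qed
    finally show ?thesis using \<rho> by (simp add: field_simps)
  qed
  finally show "energy Q (poly_measure a) - energy Q \<mu> \<le> ereal (\<bar>?I\<bar> / (4 * \<rho>))" by simp
qed

end

theorem theorem11:
  fixes Q :: "complex \<Rightarrow> real" and \<mu>Q :: "complex measure" and \<rho> :: real
  assumes "circle_Ck 3 Q"
    and "is_equilibrium Q \<mu>Q"
    and "density_inf_pos \<mu>Q"
    and "\<rho> > 0"
  shows "(satisfies_T Q \<mu>Q \<rho> \<longrightarrow> satisfies_P \<mu>Q \<rho>) \<and>
         (satisfies_LSI Q \<mu>Q \<rho> \<longrightarrow> satisfies_P \<mu>Q \<rho>) \<and>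
         (satisfies_HWI Q \<mu>Q \<rho> \<longrightarrow> satisfies_P \<mu>Q \<rho>)"
proof -
  have QC: "circle_Ck (Suc (Suc (Suc 0))) Q" using assms(1) by (simp only: numeral_3_eq_3)
  obtain c where "equilibrium Q \<mu>Q c"
    using equilibriumI[OF circle_Ck_continuous[OF assms(1)] assms(2,3)] by blast
  then interpret equilibrium Q \<mu>Q c .
  show ?thesis using P_of_T[OF assms(4)] P_of_LSI[OF assms(4) QC] P_of_HWI[OF assms(4) QC] by blast
qed

end
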